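(* Let $\mathscr{H}$ and $\mathscr{U}$ be complex Hilbert spaces, $\mathbb{T}$ a strongly continuous semigroup on $\mathscr{H}$ with generator $\mathcal{A}$, $\mathcal{B}$ an admissible control operator for $\mathbb{T}$, $T>0$, $x_0,x_T\in\mathscr{H}$, $U\subseteq L^2((0,T);\mathscr{U})$ a closed convex set, and $\theta\colon\mathscr{H}\times\mathscr{U}\times[0,T]\to\mathbb{R}$. Consider $$\min_{(x,u)}\ \mathcal{I}(x,u)=\int_0^T\theta(x(t),u(t),t)\,dt\quad\text{subject to}\quad\dot x(t)=\mathcal{A}x(t)+\mathcal{B}u(t),\ t\in[0,T],\ u\in U,\ x(0)=x_0,\ x(T)=x_T.\qquad(\ast)$$ Let $X=C([0,T];\mathscr{H})\times L^2((0,T);\mathscr{U})$, let $A$ be the set of all $(x,u)\in X$ with $u\in U$ and $x(t)=\mathbb{T}_tx_0+F_tu$ for all $t\in[0,T]$, and put $\varphi(x,u)=\|x(T)-x_T\|_{\mathscr{H}}$, $\Phi_\lambda=\mathcal{I}+\lambda\varphi$. Suppose that: 1. $\theta$ is continuous, and for any $R>0$ there exist $C_R>0$ and an a.e. nonnegative $\omega_R\in L^1(0,T)$ such that $|\theta(x,u,t)|\le C_R\|u\|_{\mathscr{U}}^2+\omega_R(t)$ for all $x\in\mathscr{H}$, $u\in\mathscr{U}$, $t\in(0,T)$ with $\|x\|_{\mathscr{H}}\le R$; 2. either $U$ is bounded in $L^2((0,T);\mathscr{U})$, or there exist $C_1>0$ and $\omega\in L^1(0,T)$ such that $\theta(x,u,t)\ge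 C_1\|u\|_{\mathscr{U}}^2+\omega(t)$ for all $x\in\mathscr{H}$, $u\in\mathscr{U}$, $t\in[0,T]$; 3. $\theta$ is differentiable in $x$ and $u$, the functions $\nabla_x\theta$ and $\nabla_u\theta$ are continuous, and for any $R>0$ there exist $C_R>0$ and a.e. nonnegative functions $\omega_R\in L^1(0,T)$, $\eta_R\in L^2(0,T)$ such that $\|\nabla_x\theta(x,u,t)\|_{\mathscr{H}}\le C_R\|u\|_{\mathscr{U}}^2+\omega_R(t)$ and $\|\nabla_u\theta(x,u,t)\|_{\mathscr{U}}\le C_R\|u\|_{\mathscr{U}}+\eta_R(t)$ for all $x\in\mathscr{H}$, $u\in\mathscr{U}$, $t\in(0,T)$ with $\|x\|_{\mathscr{H}}\le R$; 4. there exists a globally optimal solution of $(\ast)$, $\operatorname{relint}\mathcal{R}(x_0,T)\ne\emptyset$ and $x_T\in\operatorname{relint}\mathcal{R}(x_0,T)$; 5. either the set $U$ is bounded in $L^2((0,T);\mathscr{U})$, or the function $(x,u)\mapsto\theta(x,u,t)$ is convex for all $t\in[0,T]$. Then the penalty function $\Phi_\lambda$ for problem $(\ast)$ is completely exact on $A$.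
   Context: Control system: let $\mathscr{H}_{-1}$ be the extrapolation space of $\mathscr{H}$ (completion of $\mathscr{H}$ in the norm $\|(\beta I-\mathcal{A})^{-1}\cdot\|$, $\beta$ in the resolvent set of $\mathcal{A}$), to which $\mathbb{T}$ extends. A bounded linear $\mathcal{B}\colon\mathscr{U}\to\mathscr{H}_{-1}$ is an admissible control operator for $\mathbb{T}$ if for some $\tau>0$ the map $F_\tau u=\int_0^\tau\mathbb{T}_{\tau-\sigma}\mathcal{B}u(\sigma)\,d\sigma$ takes values in $\mathscr{H}$ for all $u\in L^2((0,\infty);\mathscr{U})$. Then for each $t\ge0$ the input map $F_tu=\int_0^t\mathbb{T}_{t-\sigma}\mathcal{B}u(\sigma)\,d\sigma$ is a bounded operator into $\mathscr{H}$, and for $u\in L^2((0,T);\mathscr{U})$ the unique solution in $C([0,T];\mathscr{H})$ of $\dot x=\mathcal{A}x+\mathcal{B}u$, $x(0)=x_0$ is $x(t)=\mathbb{T}_tx_0+F_tu$. $L^2((0,T);\mathscr{U})$ has its standard norm; $X$ carries the sum norm. Gradients of the real-valued $\theta$ are taken with respect to the underlying real Hilbert space structure. Reachable set: $\mathcal{R}(x_0,T)=\{x(T)\mid(x,u)\in A\}=\mathbb{T}_Tx_0+F_T(U)$, a convex set. The relative interior $\operatorname{relint}C$ of a convex subset $C$ of a Banach space is the interior of $C$ relative to the closed affine hull of $C$. $\Omega=\{(x,u)\in A\mid\varphi(x,u)=0\}$ is the feasible set of $(\ast)$. For $K\subseteq X$, $f\colon X\to\mathbb{R}$ and $z\in K$,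 $f^{\downarrow}_K(z)=\liminf_{y\to z,\,y\in K}\frac{f(y)-f(z)}{\|y-z\|_X}$ ($+\infty$ if $z$ is isolated in $K$); $z$ is an inf-stationary point of $f$ on $K$ if $f^{\downarrow}_K(z)\ge0$. "$\Phi_\lambda$ is completely exact on $A$" means: there exists $\lambda^*\ge0$ such that for every $\lambda\ge\lambda^*$: (1) the optimal values of $\min_\Omega\mathcal{I}$ and $\min_A\Phi_\lambda$ coincide; (2) their globally optimal solutions coincide; (3) $z\in A$ is a locally optimal solution of $\min_A\Phi_\lambda$ iff $z\in\Omega$ and $z$ is a locally optimal solution of $\min_\Omega\mathcal{I}$; (4) $z\in A$ is an inf-stationary point of $\Phi_\lambda$ on $A$ iff $z\in\Omega$ and $z$ is an inf-stationary point of $\mathcal{I}$ on $\Omega$. Local optimality is with respect to the norm of $X$. *)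

theory Defs
  imports "HOL-Analysis.Analysis"
begin

text \<open>The classes extend the real classes of the library, so that norms, limits and derivatives
  always refer to the underlying real structure, with real inner product \<open>Re \<langle>x, y\<rangle>\<close>.\<close>

class complex_banach = banach +
  fixes scaleC :: "complex \<Rightarrow> 'a \<Rightarrow> 'a"  (infixr \<open>*\<^sub>C\<close> 75)
  assumes scaleC_add_right: "c *\<^sub>C (x + y) = c *\<^sub>C x + c *\<^sub>C y"
    and scaleC_add_left: "(c + d) *\<^sub>C x = c *\<^sub>C x + d *\<^sub>C x"
    and scaleC_scaleC: "c *\<^sub>C d *\<^sub>C x = (c * d) *\<^sub>C x"
    and scaleC_of_real: "complex_of_real r *\<^sub>C x = r *\<^sub>R x"
    and norm_scaleC: "norm (c *\<^sub>C x) = cmod c * norm x"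

class complex_hilbert = complex_banach + real_inner +
  fixes cinner :: "'a \<Rightarrow> 'a \<Rightarrow> complex"
  assumes cinner_commute: "cinner x y = cnj (cinner y x)"
    and cinner_add_left: "cinner (x + y) z = cinner x z + cinner y z"
    and cinner_scaleC_left: "cinner (c *\<^sub>C x) y = c * cinner x y"
    and inner_eq_Re_cinner: "inner x y = Re (cinner x y)"

definition bounded_clinear :: "('a::complex_banach \<Rightarrow> 'b::complex_banach) \<Rightarrow> bool" where
  "bounded_clinear f \<longleftrightarrow> bounded_linear f \<and> (\<forall>c x. f (c *\<^sub>C x) = c *\<^sub>C f x)"

text \<open>The library's Bochner integral is restricted to second countable (hence separable) spaces.
  The same construction is repeated here for arbitrary normed spaces, with Borel measurability
  replaced by strong measurability.\<close>

definition strongly_measurable :: "'s measure \<Rightarrow> ('s \<Rightarrow> 'a::topological_space) \<Rightarrow> bool" where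
  "strongly_measurable M f \<longleftrightarrow>
     (\<exists>s. (\<forall>i. simple_function M (s i)) \<and> (AE x in M. (\<lambda>i::nat. s i x) \<longlonglongrightarrow> f x))"

definition has_strong_bochner_integral ::
    "'s measure \<Rightarrow> ('s \<Rightarrow> 'a::real_normed_vector) \<Rightarrow> 'a \<Rightarrow> bool" where
  "has_strong_bochner_integral M f y \<longleftrightarrow>
     strongly_measurable M f \<and>
     (\<exists>s. (\<forall>i::nat. Bochner_Integration.simple_bochner_integrable M (s i)) \<and>
          (\<lambda>i. \<integral>\<^sup>+ x. norm (f x - s i x) \<partial>M) \<longlonglongrightarrow> 0 \<and>
          (\<lambda>i. Bochner_Integration.simple_bochner_integral M (s i)) \<longlonglongrightarrow> y)"

definition strong_bochner_integral ::
    "'s measure \<Rightarrow> ('s \<Rightarrow> 'a::real_normed_vector) \<Rightarrow> 'a" where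
  "strong_bochner_integral M f = (THE y. has_strong_bochner_integral M f y)"

text \<open>Elements of \<open>L\<^sup>2(J; V)\<close> are represented by functions on the whole real line whose
  values outside \<open>J\<close> are irrelevant; functions that agree almost everywhere on \<open>J\<close> represent
  the same element, and \<open>norm_L2 J (u - v) = 0\<close> expresses this identification.\<close>

definition L2 :: "real set \<Rightarrow> (real \<Rightarrow> 'a::real_normed_vector) set" where
  "L2 J = {u. strongly_measurable (lebesgue_on J) u \<and>
              integrable (lebesgue_on J) (\<lambda>t. (norm (u t))\<^sup>2)}"

definition norm_L2 :: "real set \<Rightarrow> (real \<Rightarrow> 'a::real_normed_vector) \<Rightarrow> real" where
  "norm_L2 J u = sqrt (\<integral>t. (norm (u t))\<^sup>2 \<partial>lebesgue_on J)"

text \<open>A closed set in this sense is automatically saturated with respect to equality almost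
  everywhere on \<open>J\<close>, so closed sets of representatives are exactly closed sets of classes.\<close>

definition closed_L2 :: "real set \<Rightarrow> (real \<Rightarrow> 'a::real_normed_vector) set \<Rightarrow> bool" where
  "closed_L2 J V \<longleftrightarrow> V \<subseteq> L2 J \<and>
     (\<forall>v u. (\<forall>n::nat. v n \<in> V) \<longrightarrow> u \<in> L2 J \<longrightarrow> (\<lambda>n. norm_L2 J (v n - u)) \<longlonglongrightarrow> 0 \<longrightarrow> u \<in> V)"

definition convex_L2 :: "(real \<Rightarrow> 'a::real_normed_vector) set \<Rightarrow> bool" where
  "convex_L2 V \<longleftrightarrow>
     (\<forall>u\<in>V. \<forall>v\<in>V. \<forall>a\<in>{0..1}. (\<lambda>t. (1 - a) *\<^sub>R u t + a *\<^sub>R v t) \<in> V)"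

definition bounded_L2 :: "real set \<Rightarrow> (real \<Rightarrow> 'a::real_normed_vector) set \<Rightarrow> bool" where
  "bounded_L2 J V \<longleftrightarrow> (\<exists>M. \<forall>u\<in>V. norm_L2 J u \<le> M)"

definition C0_semigroup :: "(real \<Rightarrow> 'h::complex_banach \<Rightarrow> 'h) \<Rightarrow> bool" where
  "C0_semigroup S \<longleftrightarrow>
     (\<forall>t\<ge>0. bounded_clinear (S t)) \<and>
     (\<forall>x. S 0 x = x) \<and>
     (\<forall>s\<ge>0. \<forall>t\<ge>0. \<forall>x. S (s + t) x = S s (S t x)) \<and>
     (\<forall>x. ((\<lambda>t. S t x) \<longlongrightarrow> x) (at_right 0))"

definition generator_domain :: "(real \<Rightarrow> 'h::complex_banach \<Rightarrow> 'h) \<Rightarrow> 'h set" where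
  "generator_domain S = {x. \<exists>y. ((\<lambda>t. (S t x - x) /\<^sub>R t) \<longlongrightarrow> y) (at_right 0)}"

definition generator :: "(real \<Rightarrow> 'h::complex_banach \<Rightarrow> 'h) \<Rightarrow> 'h \<Rightarrow> 'h" where
  "generator S x = Lim (at_right 0) (\<lambda>t. (S t x - x) /\<^sub>R t)"

definition gen_resolvent :: "(real \<Rightarrow> 'h::complex_banach \<Rightarrow> 'h) \<Rightarrow> complex \<Rightarrow> 'h \<Rightarrow> 'h" where
  "gen_resolvent S \<beta> = inv_into (generator_domain S) (\<lambda>x. \<beta> *\<^sub>C x - generator S x)"

definition gen_resolvent_set :: "(real \<Rightarrow> 'h::complex_banach \<Rightarrow> 'h) \<Rightarrow> complex set" where
  "gen_resolvent_set S =
     {\<beta>. bij_betw (\<lambda>x. \<beta> *\<^sub>C x - generator S x) (generator_domain S) UNIV \<and>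
         bounded_clinear (gen_resolvent S \<beta>)}"

text \<open>\<open>'e\<close>, with the embedding \<open>j\<close>, is a completion of \<open>'h\<close> in the norm
  \<open>\<parallel>(\<beta>I - \<A>)\<^sup>-\<^sup>1 \<cdot>\<parallel>\<close>. Completions are unique up to isometric isomorphism. One always exists:
  take \<open>'e = 'h\<close> and \<open>j = gen_resolvent S \<beta>\<close>.\<close>

definition extrapolation_space ::
    "(real \<Rightarrow> 'h::complex_banach \<Rightarrow> 'h) \<Rightarrow> complex \<Rightarrow> ('h \<Rightarrow> 'e::complex_banach) \<Rightarrow> bool" where
  "extrapolation_space S \<beta> j \<longleftrightarrow>
     \<beta> \<in> gen_resolvent_set S \<and>
     (\<forall>x y. j (x + y) = j x + j y) \<and>
     (\<forall>c x. j (c *\<^sub>C x) = c *\<^sub>C j x) \<and>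
     (\<forall>x. norm (j x) = norm (gen_resolvent S \<beta> x)) \<and>
     closure (range j) = UNIV"

definition extended_semigroup ::
    "('h::complex_banach \<Rightarrow> 'e::complex_banach) \<Rightarrow> (real \<Rightarrow> 'h \<Rightarrow> 'h) \<Rightarrow> real \<Rightarrow> 'e \<Rightarrow> 'e" where
  "extended_semigroup j S t = (THE E. bounded_clinear E \<and> (\<forall>x. E (j x) = j (S t x)))"

text \<open>\<open>input_integral j S B t u\<close> is \<open>\<integral>\<^sub>0\<^sup>t S\<^sub>t\<^sub>-\<^sub>\<sigma> B u(\<sigma>) d\<sigma>\<close>, computed in the
  extrapolation space; \<open>input_map\<close> regards it as an element of the state space.\<close>

definition input_integral ::
    "('h::complex_banach \<Rightarrow> 'e::complex_banach) \<Rightarrow> (real \<Rightarrow> 'h \<Rightarrow> 'h) \<Rightarrow> ('u \<Rightarrow> 'e) \<Rightarrow>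
     real \<Rightarrow> (real \<Rightarrow> 'u) \<Rightarrow> 'e" where
  "input_integral j S B t u =
     strong_bochner_integral (lebesgue_on {0<..<t}) (\<lambda>\<sigma>. extended_semigroup j S (t - \<sigma>) (B (u \<sigma>)))"

definition admissible_control ::
    "('h::complex_banach \<Rightarrow> 'e::complex_banach) \<Rightarrow> (real \<Rightarrow> 'h \<Rightarrow> 'h) \<Rightarrow>
     ('u::complex_banach \<Rightarrow> 'e) \<Rightarrow> bool" where
  "admissible_control j S B \<longleftrightarrow>
     bounded_clinear B \<and> (\<exists>\<tau>>0. \<forall>u\<in>L2 {0<..}. input_integral j S B \<tau> u \<in> range j)"

definition input_map ::
    "('h::complex_banach \<Rightarrow> 'e::complex_banach) \<Rightarrow> (real \<Rightarrow> 'h \<Rightarrow> 'h) \<Rightarrow> ('u \<Rightarrow> 'e) \<Rightarrow>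
     real \<Rightarrow> (real \<Rightarrow> 'u) \<Rightarrow> 'h" where
  "input_map j S B t u = inv j (input_integral j S B t u)"

definition space_X ::
    "real \<Rightarrow> ((real \<Rightarrow> 'h::real_normed_vector) \<times> (real \<Rightarrow> 'u::real_normed_vector)) set" where
  "space_X T = {(x, u). continuous_on {0..T} x \<and> u \<in> L2 {0<..<T}}"

definition norm_X ::
    "real \<Rightarrow> (real \<Rightarrow> 'h::real_normed_vector) \<times> (real \<Rightarrow> 'u::real_normed_vector) \<Rightarrow> real" where
  "norm_X T z = (SUP t\<in>{0..T}. norm (fst z t)) + norm_L2 {0<..<T} (snd z)"

text \<open>As functions serve as representatives, \<open>y \<noteq> z\<close> in \<open>X\<close> means \<open>norm_X T (y - z) > 0\<close>.\<close>

definition nhds_within_X ::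
    "real \<Rightarrow> ((real \<Rightarrow> 'h::real_normed_vector) \<times> (real \<Rightarrow> 'u::real_normed_vector)) set \<Rightarrow>
     (real \<Rightarrow> 'h) \<times> (real \<Rightarrow> 'u) \<Rightarrow> ((real \<Rightarrow> 'h) \<times> (real \<Rightarrow> 'u)) filter" where
  "nhds_within_X T K z =
     (INF r\<in>{0<..}. principal {y\<in>K. 0 < norm_X T (y - z) \<and> norm_X T (y - z) < r})"

text \<open>If \<open>z\<close> is isolated in \<open>K\<close>, the filter is \<open>bot\<close> and the lower limit is \<open>\<infinity>\<close>.\<close>

definition lower_slope ::
    "real \<Rightarrow> ((real \<Rightarrow> 'h::real_normed_vector) \<times> (real \<Rightarrow> 'u::real_normed_vector) \<Rightarrow> real) \<Rightarrow>
     ((real \<Rightarrow> 'h) \<times> (real \<Rightarrow> 'u)) set \<Rightarrow> (real \<Rightarrow> 'h) \<times> (real \<Rightarrow> 'u) \<Rightarrow> ereal" where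
  "lower_slope T f K z =
     Liminf (nhds_within_X T K z) (\<lambda>y. ereal ((f y - f z) / norm_X T (y - z)))"

definition inf_stationary ::
    "real \<Rightarrow> ((real \<Rightarrow> 'h::real_normed_vector) \<times> (real \<Rightarrow> 'u::real_normed_vector) \<Rightarrow> real) \<Rightarrow>
     ((real \<Rightarrow> 'h) \<times> (real \<Rightarrow> 'u)) set \<Rightarrow> (real \<Rightarrow> 'h) \<times> (real \<Rightarrow> 'u) \<Rightarrow> bool" where
  "inf_stationary T f K z \<longleftrightarrow> z \<in> K \<and> 0 \<le> lower_slope T f K z"

definition global_opt :: "('z \<Rightarrow> real) \<Rightarrow> 'z set \<Rightarrow> 'z \<Rightarrow> bool" where
  "global_opt f K z \<longleftrightarrow> z \<in> K \<and> (\<forall>y\<in>K. f z \<le> f y)"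

definition local_opt ::
    "real \<Rightarrow> ((real \<Rightarrow> 'h::real_normed_vector) \<times> (real \<Rightarrow> 'u::real_normed_vector) \<Rightarrow> real) \<Rightarrow>
     ((real \<Rightarrow> 'h) \<times> (real \<Rightarrow> 'u)) set \<Rightarrow> (real \<Rightarrow> 'h) \<times> (real \<Rightarrow> 'u) \<Rightarrow> bool" where
  "local_opt T f K z \<longleftrightarrow>
     z \<in> K \<and> (\<exists>r>0. \<forall>y\<in>K. norm_X T (y - z) < r \<longrightarrow> f z \<le> f y)"

definition penalty :: "('z \<Rightarrow> real) \<Rightarrow> ('z \<Rightarrow> real) \<Rightarrow> real \<Rightarrow> 'z \<Rightarrow> real" where
  "penalty f \<phi> c z = f z + c * \<phi> z"

definition feasible_set :: "('z \<Rightarrow> real) \<Rightarrow> 'z set \<Rightarrow> 'z set" where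
  "feasible_set \<phi> A = {z\<in>A. \<phi> z = 0}"

definition completely_exact ::
    "real \<Rightarrow> ((real \<Rightarrow> 'h::real_normed_vector) \<times> (real \<Rightarrow> 'u::real_normed_vector) \<Rightarrow> real) \<Rightarrow>
     ((real \<Rightarrow> 'h) \<times> (real \<Rightarrow> 'u) \<Rightarrow> real) \<Rightarrow> ((real \<Rightarrow> 'h) \<times> (real \<Rightarrow> 'u)) set \<Rightarrow> bool" where
  "completely_exact T f \<phi> A \<longleftrightarrow>
     (\<exists>c0\<ge>0. \<forall>c\<ge>c0.
        (INF z\<in>feasible_set \<phi> A. ereal (f z)) = (INF z\<in>A. ereal (penalty f \<phi> c z)) \<and>
        {z. global_opt f (feasible_set \<phi> A) z} = {z. global_opt (penalty f \<phi> c) A z} \<and>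
        (\<forall>z\<in>A. local_opt T (penalty f \<phi> c) A z \<longleftrightarrow>
                z \<in> feasible_set \<phi> A \<and> local_opt T f (feasible_set \<phi> A) z) \<and>
        (\<forall>z\<in>A. inf_stationary T (penalty f \<phi> c) A z \<longleftrightarrow>
                z \<in> feasible_set \<phi> A \<and> inf_stationary T f (feasible_set \<phi> A) z))"

definition trajectory_set ::
    "('h::complex_hilbert \<Rightarrow> 'e::complex_banach) \<Rightarrow> (real \<Rightarrow> 'h \<Rightarrow> 'h) \<Rightarrow>
     ('u::complex_hilbert \<Rightarrow> 'e) \<Rightarrow> 'h \<Rightarrow> real \<Rightarrow> (real \<Rightarrow> 'u) set \<Rightarrow>
     ((real \<Rightarrow> 'h) \<times> (real \<Rightarrow> 'u)) set" where
  "trajectory_set j S B x0 T U =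
     {(x, u) \<in> space_X T. u \<in> U \<and> (\<forall>t\<in>{0..T}. x t = S t x0 + input_map j S B t u)}"

definition reachable_set ::
    "('h::complex_hilbert \<Rightarrow> 'e::complex_banach) \<Rightarrow> (real \<Rightarrow> 'h \<Rightarrow> 'h) \<Rightarrow>
     ('u::complex_hilbert \<Rightarrow> 'e) \<Rightarrow> 'h \<Rightarrow> real \<Rightarrow> (real \<Rightarrow> 'u) set \<Rightarrow> 'h set" where
  "reachable_set j S B x0 T U = {x T | x u. (x, u) \<in> trajectory_set j S B x0 T U}"

text \<open>The library's \<open>rel_interior\<close> is taken relative to the affine hull, not to its closure.\<close>

definition relint :: "'a::real_normed_vector set \<Rightarrow> 'a set" where
  "relint C = top_of_set (closure (affine hull C)) interior_of C"

definition cost ::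
    "('h::complex_hilbert \<Rightarrow> 'u::complex_hilbert \<Rightarrow> real \<Rightarrow> real) \<Rightarrow> real \<Rightarrow>
     (real \<Rightarrow> 'h) \<times> (real \<Rightarrow> 'u) \<Rightarrow> real" where
  "cost \<theta> T z = (\<integral>t. \<theta> (fst z t) (snd z t) t \<partial>lebesgue_on {0<..<T})"

definition terminal_gap ::
    "real \<Rightarrow> 'h::real_normed_vector \<Rightarrow> (real \<Rightarrow> 'h) \<times> (real \<Rightarrow> 'u) \<Rightarrow> real" where
  "terminal_gap T xT z = norm (fst z T - xT)"

end

theory Submission
  imports Defs "HOL-Library.Function_Algebras"
begin

text \<open>By admissibility and the uniform boundedness principle the input maps are bounded,
  uniformly on \<open>[0, T]\<close>; for this the integral in the extrapolation space is identified with a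
  Henstock-Kurzweil integral. Hence \<open>A\<close> is convex and complete. Continuity of \<open>t \<mapsto> F\<^sub>t u\<close> plays no
  role, because only pairs with a continuous state belong to \<open>A\<close>.

  Since \<open>x\<^sub>T\<close> is a relative interior point of the reachable set, some ball of radius \<open>r\<close> around
  \<open>x\<^sub>T\<close>, relative to the closed affine hull, is reachable. Going from \<open>z \<in> A\<close> towards a point of \<open>A\<close> that reaches
  the point of this ball opposite to \<open>z\<close>, one meets a feasible point after the fraction
  \<open>\<phi> z / (r + \<phi> z)\<close> of the way.

  If \<open>U\<close> is bounded, so is \<open>A\<close>; the feasible point then lies within \<open>O(\<phi> z)\<close> of \<open>z\<close>, and the cost is
  Lipschitz continuous on \<open>A\<close> by the gradient bounds, so the penalty term outweighs the change of
  the cost. If \<open>\<theta>\<close> is convex, the Robinson-Ursescu argument reaches the ball with a bounded part of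
  \<open>A\<close>, on which the cost is bounded; convexity along the segment gives
  \<open>\<I> + c \<phi> \<ge> min\<^sub>\<Omega> \<I>\<close> on \<open>A\<close> for large \<open>c\<close>, and for convex functions global, local and
  inf-stationary points coincide.\<close>

section \<open>Strong measurability\<close>

text \<open>As \<open>'h\<close> and \<open>'u\<close> may be nonseparable, measurability is argued
  through approximating simple functions, and the Henstock-Kurzweil integral, which is linear,
  additive over adjacent intervals and compatible with bounded operators in every Banach space,
  carries the vector-valued computations. Elements of \<open>L2\<close> and \<open>space_X\<close>
  are functions rather than classes, so \<open>norm_L2\<close> and \<open>norm_X\<close> are only
  seminorms there; pairs at distance zero need an argument of their own. Admissibility merely places
  values in \<open>range j\<close>; the passage to a bound in the state norm goes through the
  resolvent. The final dichotomy reflects quadratic growth in the control: the Lipschitz constant of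
  the cost depends on a bound for the controls, so it yields a single penalty parameter only on a
  bounded \<open>A\<close>. In the convex case, with terminal gap \<open>g\<close> and
  \<open>s = g / (r + g)\<close>, the inequality \<open>f z0 \<le> (1 - s) * f z + s * K\<close>
  becomes \<open>r * f z0 \<le> r * f z + g * (K - f z0)\<close>, which is linear in
  \<open>g\<close>; this is the origin of the penalty parameter.\<close>

lemma complete_measure_lebesgue_on:
  assumes "J \<in> sets lebesgue"
  shows "complete_measure (lebesgue_on J)"
proof
  fix A B assume B: "B \<subseteq> A" "A \<in> null_sets (lebesgue_on J)"
  then have "A \<in> null_sets lebesgue" "A \<subseteq> J"
    using assms by (auto simp: null_sets_restrict_space)
  then have "B \<in> sets lebesgue" using B(1) completion.complete by blast
  then show "B \<in> sets (lebesgue_on J)"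
    using B \<open>A \<subseteq> J\<close> assms by (auto simp: sets_restrict_space_iff)
qed

text \<open>The pointwise \<open>lim\<close> is measurable and agrees with \<open>f\<close> outside
  a null set; completeness of Lebesgue measure transfers measurability to \<open>f\<close> itself.
  Strong measurability supplies its limits only almost everywhere.\<close>

lemma borel_measurable_AE_lim:
  fixes f :: "real \<Rightarrow> real"
  assumes J: "J \<in> sets lebesgue"
    and s: "\<And>i::nat. s i \<in> borel_measurable (lebesgue_on J)"
    and lim: "AE x in lebesgue_on J. (\<lambda>i. s i x) \<longlonglongrightarrow> f x"
  shows "f \<in> borel_measurable (lebesgue_on J)"
proof (rule measurableI)
  define g where "g = (\<lambda>x. lim (\<lambda>i. s i x))"
  have g: "g \<in> borel_measurable (lebesgue_on J)"
    unfolding g_def by (rule borel_measurable_lim_metric) (rule s)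
  have eq: "AE x in lebesgue_on J. g x = f x"
    using lim by eventually_elim (simp add: g_def limI)
  fix A :: "real set" assume A: "A \<in> sets borel"
  have "g -` A \<inter> space (lebesgue_on J) \<in> sets (lebesgue_on J)"
    using g A by (rule measurable_sets)
  then show "f -` A \<inter> space (lebesgue_on J) \<in> sets (lebesgue_on J)"
    by (rule complete_measure.in_sets_AE[OF complete_measure_lebesgue_on[OF J], rotated])
      (use eq in \<open>auto elim!: AE_mp\<close>)
qed simp

lemma strongly_measurable_norm:
  fixes f :: "real \<Rightarrow> 'a::real_normed_vector"
  assumes J: "J \<in> sets lebesgue" and f: "strongly_measurable (lebesgue_on J) f"
  shows "(\<lambda>x. norm (f x)) \<in> borel_measurable (lebesgue_on J)"
proof -
  obtain s where s: "\<And>i. simple_function (lebesgue_on J) (s i)"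
    and lim: "AE x in lebesgue_on J. (\<lambda>i::nat. s i x) \<longlonglongrightarrow> f x"
    using f unfolding strongly_measurable_def by blast
  show ?thesis
  proof (rule borel_measurable_AE_lim[OF J])
    show "(\<lambda>x. norm (s i x)) \<in> borel_measurable (lebesgue_on J)" for i
      by (rule borel_measurable_simple_function) (rule simple_function_compose1[OF s])
    show "AE x in lebesgue_on J. (\<lambda>i. norm (s i x)) \<longlonglongrightarrow> norm (f x)"
      using lim by eventually_elim (rule tendsto_norm)
  qed
qed

text \<open>Sequential continuity of \<open>h\<close> suffices: applied to two approximating
  sequences it yields simple functions again, since only finitely many pairs of values occur. Unary
  maps are covered by letting \<open>h\<close> ignore one argument.\<close>

lemma strongly_measurable_compose2:
  fixes h :: "'a::topological_space \<Rightarrow> 'b::topological_space \<Rightarrow> 'c::topological_space"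
  assumes f: "strongly_measurable M f" and g: "strongly_measurable M g"
    and h: "\<And>a b x y. a \<longlonglongrightarrow> x \<Longrightarrow> b \<longlonglongrightarrow> y \<Longrightarrow> (\<lambda>i::nat. h (a i) (b i)) \<longlonglongrightarrow> h x y"
  shows "strongly_measurable M (\<lambda>x. h (f x) (g x))"
proof -
  obtain s where s: "\<And>i. simple_function M (s i)" "AE x in M. (\<lambda>i::nat. s i x) \<longlonglongrightarrow> f x"
    using f unfolding strongly_measurable_def by blast
  obtain r where r: "\<And>i. simple_function M (r i)" "AE x in M. (\<lambda>i::nat. r i x) \<longlonglongrightarrow> g x"
    using g unfolding strongly_measurable_def by blast
  have "AE x in M. (\<lambda>i. h (s i x) (r i x)) \<longlonglongrightarrow> h (f x) (g x)"
    using s(2) r(2) by eventually_elim (rule h)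
  then show ?thesis
    unfolding strongly_measurable_def
    by (intro exI[of _ "\<lambda>i x. h (s i x) (r i x)"] conjI allI simple_function_compose2[OF s(1) r(1)])
qed

lemma strongly_measurable_add:
  fixes f g :: "_ \<Rightarrow> 'a::real_normed_vector"
  assumes "strongly_measurable M f" "strongly_measurable M g"
  shows "strongly_measurable M (\<lambda>x. f x + g x)"
  using assms by (rule strongly_measurable_compose2) (rule tendsto_add)

lemma strongly_measurable_diff:
  fixes f g :: "_ \<Rightarrow> 'a::real_normed_vector"
  assumes "strongly_measurable M f" "strongly_measurable M g"
  shows "strongly_measurable M (\<lambda>x. f x - g x)"
  using assms by (rule strongly_measurable_compose2) (rule tendsto_diff)

lemma strongly_measurable_scaleR:
  fixes f :: "_ \<Rightarrow> 'a::real_normed_vector"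
  assumes "strongly_measurable M f"
  shows "strongly_measurable M (\<lambda>x. c *\<^sub>R f x)"
  using assms assms
  by (rule strongly_measurable_compose2[where h = "\<lambda>x y. c *\<^sub>R x"]) (rule tendsto_scaleR[OF tendsto_const])

lemma strongly_measurable_const: "strongly_measurable M (\<lambda>x. c)"
  unfolding strongly_measurable_def by (intro exI[of _ "\<lambda>i x. c"]) simp

lemma strongly_measurable_real:
  fixes f :: "real \<Rightarrow> real"
  assumes J: "J \<in> sets lebesgue" and f: "strongly_measurable (lebesgue_on J) f"
  shows "f \<in> borel_measurable (lebesgue_on J)"
proof -
  obtain s where s: "\<And>i. simple_function (lebesgue_on J) (s i)"
    and lim: "AE x in lebesgue_on J. (\<lambda>i::nat. s i x) \<longlonglongrightarrow> f x"
    using f unfolding strongly_measurable_def by blast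
  show ?thesis
    by (rule borel_measurable_AE_lim[OF J _ lim]) (rule borel_measurable_simple_function[OF s])
qed

text \<open>The simple functions \<open>r i\<close> round \<open>t\<close> down to a grid, so joint continuity lets the
  approximations of \<open>u\<close> and of the identity be combined.\<close>

lemma strongly_measurable_continuous_compose:
  fixes F :: "real \<Rightarrow> 'a::topological_space \<Rightarrow> 'b::topological_space"
  assumes cont: "continuous_on ({a..b} \<times> UNIV) (\<lambda>(t, v). F t v)"
    and u: "strongly_measurable (lebesgue_on {a<..<b}) u"
  shows "strongly_measurable (lebesgue_on {a<..<b}) (\<lambda>t. F t (u t))"
proof -
  let ?M = "lebesgue_on {a<..<b}"
  obtain s where s: "\<And>i. simple_function ?M (s i)"
    and lim: "AE x in ?M. (\<lambda>i::nat. s i x) \<longlonglongrightarrow> u x"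
    using u unfolding strongly_measurable_def by blast
  define r where "r = (\<lambda>(i::nat) t. a + of_int \<lfloor>(t - a) * real (Suc i)\<rfloor> / real (Suc i))"
  have r_le: "r i t \<le> t" and r_gt: "t - 1 / real (Suc i) < r i t" for i t
  proof -
    have "of_int \<lfloor>(t - a) * real (Suc i)\<rfloor> \<le> (t - a) * real (Suc i)"
      "(t - a) * real (Suc i) - 1 < of_int \<lfloor>(t - a) * real (Suc i)\<rfloor>"
      by linarith+
    moreover have "(0::real) < real (Suc i)" by simp
    ultimately have "of_int \<lfloor>(t - a) * real (Suc i)\<rfloor> / real (Suc i) \<le> t - a"
      "(t - a) - 1 / real (Suc i) < of_int \<lfloor>(t - a) * real (Suc i)\<rfloor> / real (Suc i)"
      by (metis pos_divide_le_eq, metis diff_divide_distrib divide_strict_right_mono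
          less_irrefl nonzero_mult_div_cancel_right)
    then show "r i t \<le> t" "t - 1 / real (Suc i) < r i t" by (auto simp: r_def)
  qed
  \<comment> \<open>The grid is anchored at \<open>a\<close>, so rounding down never leaves
    \<open>{a..b}\<close>, where joint continuity is available.\<close>
  have r_ge: "a \<le> r i t" if "a \<le> t" for i t
    using that by (auto simp: r_def)
  have r_lim: "(\<lambda>i. r i t) \<longlonglongrightarrow> t" for t
  proof (rule tendsto_sandwich[of "\<lambda>i. t - 1 / real (Suc i)" _ _ "\<lambda>i. t"])
    have "(\<lambda>i. t - 1 / real (Suc i)) \<longlonglongrightarrow> t - 0"
      by (intro tendsto_diff tendsto_const LIMSEQ_Suc[OF lim_1_over_n])
    then show "(\<lambda>i. t - 1 / real (Suc i)) \<longlonglongrightarrow> t" by simp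
  qed (use r_le r_gt in \<open>auto intro!: always_eventually less_imp_le\<close>)
  have r_simple: "simple_function ?M (r i)" for i
  proof (rule simple_function_borel_measurable)
    have "(\<lambda>t. a + of_int \<lfloor>(t - a) * real (Suc i)\<rfloor> / real (Suc i)) \<in> borel_measurable borel"
      by measurable
    then have "r i \<in> borel_measurable lebesgue"
      unfolding r_def by (simp add: measurable_completion)
    then show "r i \<in> borel_measurable ?M" by (rule measurable_restrict_space1)
    have "r i ` space ?M \<subseteq> (\<lambda>k. a + of_int k / real (Suc i)) ` {0..\<lfloor>(b - a) * real (Suc i)\<rfloor>}"
    proof
      fix y assume "y \<in> r i ` space ?M"
      then obtain t where t: "a < t" "t < b" "y = r i t" by auto
      have "\<lfloor>(t - a) * real (Suc i)\<rfloor> \<le> \<lfloor>(b - a) * real (Suc i)\<rfloor>"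
        using t by (intro floor_mono mult_right_mono) auto
      moreover have "0 \<le> \<lfloor>(t - a) * real (Suc i)\<rfloor>" using t by simp
      ultimately show "y \<in> (\<lambda>k. a + of_int k / real (Suc i)) ` {0..\<lfloor>(b - a) * real (Suc i)\<rfloor>}"
        using t unfolding r_def by auto
    qed
    then show "finite (r i ` space ?M)" by (rule finite_subset) simp
  qed
  have "AE t in ?M. (\<lambda>i. F (r i t) (s i t)) \<longlonglongrightarrow> F t (u t)"
    using lim AE_space
  proof eventually_elim
    case (elim t)
    then have t: "a < t" "t < b" by auto
    have "(\<lambda>i. (\<lambda>(t, v). F t v) (r i t, s i t)) \<longlonglongrightarrow> (\<lambda>(t, v). F t v) (t, u t)"
    proof (rule continuous_on_tendsto_compose[OF cont])
      show "(\<lambda>i. (r i t, s i t)) \<longlonglongrightarrow> (t, u t)" by (intro tendsto_Pair r_lim elim)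
      show "\<forall>\<^sub>F i in sequentially. (r i t, s i t) \<in> {a..b} \<times> UNIV"
        using t r_ge[of t] r_le[of _ t] order_trans[of "r _ t" t b]
        by (auto intro!: always_eventually)
    qed (use t in auto)
    then show ?case by simp
  qed
  then show ?thesis
    unfolding strongly_measurable_def
    by (intro exI[of _ "\<lambda>i t. F (r i t) (s i t)"] conjI allI simple_function_compose2[OF r_simple s])
qed

section \<open>The space of square integrable functions\<close>

text \<open>Pointwise operations make functions, and pairs of functions, a real vector space, so
  \<open>subspace\<close>, \<open>convex\<close>, \<open>convex_on\<close> and \<open>linear\<close>
  apply directly to representatives of controls and trajectories.\<close>

instantiation "fun" :: (type, real_vector) real_vector
begin

definition scaleR_fun :: "real \<Rightarrow> ('a \<Rightarrow> 'b) \<Rightarrow> 'a \<Rightarrow> 'b" where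
  "scaleR_fun c f = (\<lambda>x. c *\<^sub>R f x)"

instance
  by standard (simp_all add: scaleR_fun_def fun_eq_iff plus_fun_def scaleR_add_right scaleR_add_left)

end

lemma scaleR_fun_apply [simp]: "(c *\<^sub>R f) x = c *\<^sub>R f x"
  by (simp add: scaleR_fun_def)

text \<open>The discriminant argument: the integral of the square of \<open>f + s g\<close> is a
  nonnegative quadratic polynomial in \<open>s\<close>.\<close>

lemma Cauchy_Schwarz_integral:
  fixes f g :: "'s \<Rightarrow> real"
  assumes meas: "f \<in> borel_measurable M" "g \<in> borel_measurable M"
    and f2: "integrable M (\<lambda>x. (f x)\<^sup>2)" and g2: "integrable M (\<lambda>x. (g x)\<^sup>2)"
  shows "integrable M (\<lambda>x. f x * g x)"
    and "\<bar>\<integral>x. f x * g x \<partial>M\<bar> \<le> sqrt (\<integral>x. (f x)\<^sup>2 \<partial>M) * sqrt (\<integral>x. (g x)\<^sup>2 \<partial>M)"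
proof -
  show int: "integrable M (\<lambda>x. f x * g x)"
  proof (rule Bochner_Integration.integrable_bound)
    show "integrable M (\<lambda>x. (f x)\<^sup>2 + (g x)\<^sup>2)" using f2 g2 by simp
    show "AE x in M. norm (f x * g x) \<le> norm ((f x)\<^sup>2 + (g x)\<^sup>2)"
    proof (rule AE_I2)
      fix x
      have "0 \<le> (\<bar>f x\<bar> - \<bar>g x\<bar>)\<^sup>2" by simp
      then have "2 * (\<bar>f x\<bar> * \<bar>g x\<bar>) \<le> (f x)\<^sup>2 + (g x)\<^sup>2" by (simp add: power2_eq_square algebra_simps)
      moreover have "0 \<le> \<bar>f x\<bar> * \<bar>g x\<bar>" by simp
      ultimately have "\<bar>f x\<bar> * \<bar>g x\<bar> \<le> (f x)\<^sup>2 + (g x)\<^sup>2" by linarith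
      then show "norm (f x * g x) \<le> norm ((f x)\<^sup>2 + (g x)\<^sup>2)"
        by (simp add: abs_mult)
    qed
  qed (use meas in simp)
  let ?a = "\<integral>x. (f x)\<^sup>2 \<partial>M" and ?b = "\<integral>x. f x * g x \<partial>M" and ?c = "\<integral>x. (g x)\<^sup>2 \<partial>M"
  have pos: "0 \<le> ?a" "0 \<le> ?c" by simp_all
  have quad: "0 \<le> ?a + 2 * s * ?b + s\<^sup>2 * ?c" for s
  proof -
    have "0 \<le> (\<integral>x. (f x + s * g x)\<^sup>2 \<partial>M)" by simp
    also have "(\<lambda>x. (f x + s * g x)\<^sup>2) = (\<lambda>x. (f x)\<^sup>2 + 2 * s * (f x * g x) + s\<^sup>2 * (g x)\<^sup>2)"
      by (simp add: fun_eq_iff power2_eq_square algebra_simps)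
    also have "(\<integral>x. (f x)\<^sup>2 + 2 * s * (f x * g x) + s\<^sup>2 * (g x)\<^sup>2 \<partial>M) = ?a + 2 * s * ?b + s\<^sup>2 * ?c"
      using f2 g2 int by simp
    finally show ?thesis .
  qed
  have "?b\<^sup>2 \<le> ?a * ?c"
  proof (cases "?c = 0")
    case True
    have "?b = 0"
    proof (rule ccontr)
      assume b: "?b \<noteq> 0"
      \<comment> \<open>Without a quadratic term the polynomial is affine in \<open>s\<close>; a
        nonzero slope would let it take the value -1 at this \<open>s\<close>.\<close>
      have "?a + 2 * (- (?a + 1) / (2 * ?b)) * ?b = -1" using b by (simp add: field_simps)
      then show False using quad[of "- (?a + 1) / (2 * ?b)"] True by simp
    qed
    then show ?thesis using True by simp
  next
    case False
    then have c: "?c > 0" using pos by linarith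
    \<comment> \<open>\<open>- ?b / ?c\<close> is the minimiser of the quadratic.\<close>
    have "?a + 2 * (- ?b / ?c) * ?b + (- ?b / ?c)\<^sup>2 * ?c = ?a - ?b\<^sup>2 / ?c"
      using c by (simp add: field_simps power2_eq_square)
    then have "?b\<^sup>2 / ?c \<le> ?a" using quad[of "- ?b / ?c"] by simp
    then show ?thesis using c by (simp add: field_simps)
  qed
  then have "sqrt (?b\<^sup>2) \<le> sqrt (?a * ?c)" by (rule real_sqrt_le_mono)
  then show "\<bar>?b\<bar> \<le> sqrt ?a * sqrt ?c" by (simp add: real_sqrt_mult)
qed

lemma norm_add_power2_le:
  fixes x y :: "'a::real_normed_vector"
  shows "(norm (x + y))\<^sup>2 \<le> 2 * (norm x)\<^sup>2 + 2 * (norm y)\<^sup>2"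
proof -
  have "(norm (x + y))\<^sup>2 \<le> (norm x + norm y)\<^sup>2"
    by (rule power_mono[OF norm_triangle_ineq]) simp
  also have "\<dots> \<le> 2 * (norm x)\<^sup>2 + 2 * (norm y)\<^sup>2"
    using zero_le_power2[of "norm x - norm y"] by (simp add: power2_eq_square algebra_simps)
  finally show ?thesis .
qed

lemma norm_L2_nonneg [simp]: "0 \<le> norm_L2 J u"
  by (simp add: norm_L2_def)

lemma norm_L2_zero [simp]: "norm_L2 J 0 = 0" "norm_L2 J (\<lambda>_. 0) = 0"
  by (simp_all add: norm_L2_def zero_fun_def)

lemma norm_L2_power2: "(norm_L2 J u)\<^sup>2 = (\<integral>t. (norm (u t))\<^sup>2 \<partial>lebesgue_on J)"
  by (simp add: norm_L2_def)

lemma norm_L2_scaleR: "norm_L2 J (c *\<^sub>R u) = \<bar>c\<bar> * norm_L2 J u"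
  by (simp add: norm_L2_def power_mult_distrib real_sqrt_mult)

lemma norm_L2_minus_commute: "norm_L2 J (u - v) = norm_L2 J (v - u)"
  by (simp add: norm_L2_def norm_minus_commute)

lemma L2_measurable_norm:
  assumes "J \<in> sets lebesgue" "u \<in> L2 J"
  shows "(\<lambda>t. norm (u t)) \<in> borel_measurable (lebesgue_on J)"
  using assms by (auto simp: L2_def intro: strongly_measurable_norm)

lemma L2_bound:
  fixes u :: "real \<Rightarrow> 'a::real_normed_vector"
  assumes J: "J \<in> sets lebesgue" and u: "strongly_measurable (lebesgue_on J) u"
    and g: "integrable (lebesgue_on J) g"
    and le: "\<And>t. t \<in> J \<Longrightarrow> (norm (u t))\<^sup>2 \<le> g t"
  shows "u \<in> L2 J"
proof -
  have [measurable]: "(\<lambda>t. norm (u t)) \<in> borel_measurable (lebesgue_on J)"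
    by (rule strongly_measurable_norm[OF J u])
  have "integrable (lebesgue_on J) (\<lambda>t. (norm (u t))\<^sup>2)"
  proof (rule Bochner_Integration.integrable_bound[OF g])
    show "AE t in lebesgue_on J. norm ((norm (u t))\<^sup>2) \<le> norm (g t)"
      using le order_trans[OF le abs_ge_self] by (intro AE_I2) auto
  qed measurable
  with u show ?thesis by (simp add: L2_def)
qed

lemma subspace_L2:
  assumes J: "J \<in> sets lebesgue"
  shows "subspace (L2 J :: (real \<Rightarrow> 'a::real_normed_vector) set)"
  unfolding subspace_def
proof (intro conjI ballI allI)
  show "0 \<in> L2 J" by (simp add: L2_def zero_fun_def strongly_measurable_const)
next
  fix u v :: "real \<Rightarrow> 'a" assume uv: "u \<in> L2 J" "v \<in> L2 J"
  show "u + v \<in> L2 J"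
  proof (rule L2_bound[OF J])
    show "strongly_measurable (lebesgue_on J) (u + v)"
      using uv unfolding plus_fun_def by (intro strongly_measurable_add) (auto simp: L2_def)
    show "integrable (lebesgue_on J) (\<lambda>t. 2 * (norm (u t))\<^sup>2 + 2 * (norm (v t))\<^sup>2)"
      using uv by (simp add: L2_def)
  qed (simp add: norm_add_power2_le)
next
  fix c :: real and u :: "real \<Rightarrow> 'a" assume "u \<in> L2 J"
  then show "c *\<^sub>R u \<in> L2 J"
    by (simp add: L2_def scaleR_fun_def strongly_measurable_scaleR power_mult_distrib)
qed

lemmas L2_add = subspace_add[OF subspace_L2]
  and L2_scaleR = subspace_scale[OF subspace_L2]
  and L2_diff = subspace_diff[OF subspace_L2]

text \<open>Minkowski's inequality: pointwise expansion of the square, with Cauchy-Schwarz for the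
  mixed term.\<close>

lemma norm_L2_triangle:
  assumes J: "J \<in> sets lebesgue" and u: "u \<in> L2 J" and v: "v \<in> L2 J"
  shows "norm_L2 J (u + v) \<le> norm_L2 J u + norm_L2 J v"
proof (rule power2_le_imp_le)
  note m = L2_measurable_norm[OF J u] L2_measurable_norm[OF J v]
  have i: "integrable (lebesgue_on J) (\<lambda>t. (norm (u t))\<^sup>2)" "integrable (lebesgue_on J) (\<lambda>t. (norm (v t))\<^sup>2)"
    using u v by (auto simp: L2_def)
  note cs = Cauchy_Schwarz_integral[OF m i]
  have "(norm_L2 J (u + v))\<^sup>2 = (\<integral>t. (norm (u t + v t))\<^sup>2 \<partial>lebesgue_on J)"
    by (simp add: norm_L2_power2)
  also have "\<dots> \<le> (\<integral>t. (norm (u t))\<^sup>2 + 2 * (norm (u t) * norm (v t)) + (norm (v t))\<^sup>2 \<partial>lebesgue_on J)"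
  proof (rule integral_mono)
    show "integrable (lebesgue_on J) (\<lambda>t. (norm (u t + v t))\<^sup>2)"
      using L2_add[OF J u v] by (simp add: L2_def)
    fix t
    have "(norm (u t + v t))\<^sup>2 \<le> (norm (u t) + norm (v t))\<^sup>2"
      by (rule power_mono[OF norm_triangle_ineq]) simp
    then show "(norm (u t + v t))\<^sup>2 \<le> (norm (u t))\<^sup>2 + 2 * (norm (u t) * norm (v t)) + (norm (v t))\<^sup>2"
      by (simp add: power2_eq_square algebra_simps)
  qed (use i cs in simp)
  also have "\<dots> = (norm_L2 J u)\<^sup>2 + 2 * (\<integral>t. norm (u t) * norm (v t) \<partial>lebesgue_on J) + (norm_L2 J v)\<^sup>2"
    using i cs by (simp add: norm_L2_power2)
  also have "\<dots> \<le> (norm_L2 J u)\<^sup>2 + 2 * (norm_L2 J u * norm_L2 J v) + (norm_L2 J v)\<^sup>2"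
    using cs(2) by (simp add: norm_L2_def)
  finally show "(norm_L2 J (u + v))\<^sup>2 \<le> (norm_L2 J u + norm_L2 J v)\<^sup>2"
    by (simp add: power2_eq_square algebra_simps)
qed simp

lemma norm_L2_triangle_diff:
  assumes J: "J \<in> sets lebesgue" and "u \<in> L2 J" "v \<in> L2 J" "w \<in> L2 J"
  shows "norm_L2 J (u - w) \<le> norm_L2 J (u - v) + norm_L2 J (v - w)"
  using norm_L2_triangle[OF J L2_diff[OF J assms(2,3)] L2_diff[OF J assms(3,4)]] by simp

text \<open>Cauchy-Schwarz against the constant 1 on an interval of length \<open>b - a\<close>. It
  makes integrands that grow linearly in the control absolutely integrable.\<close>

lemma L2_integrable_norm:
  assumes ab: "a \<le> b" and u: "u \<in> L2 {a<..<b}"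
  shows "integrable (lebesgue_on {a<..<b}) (\<lambda>t. norm (u t))"
    and "(\<integral>t. norm (u t) \<partial>lebesgue_on {a<..<b}) \<le> sqrt (b - a) * norm_L2 {a<..<b} u"
proof -
  let ?M = "lebesgue_on {a<..<b}"
  have J: "{a<..<b} \<in> sets lebesgue" by simp
  interpret finite_measure ?M by (rule finite_measure_lebesgue_on) simp
  have one: "(\<lambda>t. 1::real) \<in> borel_measurable ?M" "integrable ?M (\<lambda>t. (1::real)\<^sup>2)" by simp_all
  have u2: "integrable ?M (\<lambda>t. (norm (u t))\<^sup>2)" using u by (simp add: L2_def)
  note cs = Cauchy_Schwarz_integral[OF one(1) L2_measurable_norm[OF J u] one(2) u2]
  show "integrable ?M (\<lambda>t. norm (u t))" using cs(1) by simp
  have "measure ?M {a<..<b} = b - a"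
    using ab by (simp add: measure_restrict_space)
  then have "(\<integral>t. (1::real)\<^sup>2 \<partial>?M) = b - a" by simp
  then show "(\<integral>t. norm (u t) \<partial>?M) \<le> sqrt (b - a) * norm_L2 {a<..<b} u"
    using cs(2) by (simp add: norm_L2_def)
qed

text \<open>Cutting the approximations off where they exceed twice the limit makes them dominated.\<close>

lemma strongly_measurable_dominated_simple:
  fixes f :: "real \<Rightarrow> 'a::real_normed_vector"
  assumes J: "J \<in> sets lebesgue" and f: "strongly_measurable (lebesgue_on J) f"
  obtains s where "\<And>i. simple_function (lebesgue_on J) (s i)"
    and "AE x in lebesgue_on J. (\<lambda>i::nat. s i x) \<longlonglongrightarrow> f x"
    and "\<And>i x. norm (s i x) \<le> 2 * norm (f x)"
proof -
  let ?M = "lebesgue_on J"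
  obtain s where s: "\<And>i. simple_function ?M (s i)"
    and lim: "AE x in ?M. (\<lambda>i::nat. s i x) \<longlonglongrightarrow> f x"
    using f unfolding strongly_measurable_def by blast
  have [measurable]: "(\<lambda>x. norm (f x)) \<in> borel_measurable ?M"
    by (rule strongly_measurable_norm[OF J f])
  have [measurable]: "(\<lambda>x. norm (s i x)) \<in> borel_measurable ?M" for i
    by (rule borel_measurable_simple_function) (rule simple_function_compose1[OF s])
  define r where "r = (\<lambda>i x. if norm (s i x) \<le> 2 * norm (f x) then s i x else 0)"
  show thesis
  proof
    show "simple_function ?M (r i)" for i
      unfolding r_def by (rule simple_function_If[OF s]) (simp, measurable)
    show "AE x in ?M. (\<lambda>i. r i x) \<longlonglongrightarrow> f x"
      using lim
    proof eventually_elim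
      case (elim x)
      show ?case
      proof (cases "f x = 0")
        case True
        then have "r i x = 0" for i by (auto simp: r_def)
        then show ?thesis using True by simp
      next
        case False
        have "(\<lambda>i. norm (s i x)) \<longlonglongrightarrow> norm (f x)" using elim by (rule tendsto_norm)
        then have "\<forall>\<^sub>F i in sequentially. norm (s i x) < 2 * norm (f x)"
          by (rule order_tendstoD) (use False in simp)
        then have "\<forall>\<^sub>F i in sequentially. s i x = r i x"
          by eventually_elim (simp add: r_def)
        then show ?thesis using elim by (rule Lim_transform_eventually[rotated])
      qed
    qed
    show "norm (r i x) \<le> 2 * norm (f x)" for i x by (simp add: r_def)
  qed
qed

text \<open>Dominated convergence for the squares of the scalars \<open>norm (u t - s i t)\<close>.
  Their majorant is 9 times the square of \<open>norm (u t)\<close>, because dominated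
  approximations satisfy \<open>norm (u t - s i t) \<le> 3 * norm (u t)\<close>.\<close>

lemma L2_simple_dense:
  fixes u :: "real \<Rightarrow> 'a::real_normed_vector"
  assumes J: "J \<in> sets lebesgue" and u: "u \<in> L2 J" and e: "e > 0"
  obtains w where "simple_function (lebesgue_on J) w" "w \<in> L2 J" "norm_L2 J (u - w) < e"
proof -
  let ?M = "lebesgue_on J"
  have um: "strongly_measurable ?M u" and u2: "integrable ?M (\<lambda>t. (norm (u t))\<^sup>2)"
    using u by (auto simp: L2_def)
  obtain s where s: "\<And>i. simple_function ?M (s i)"
    and lim: "AE x in ?M. (\<lambda>i::nat. s i x) \<longlonglongrightarrow> u x"
    and dom: "\<And>i x. norm (s i x) \<le> 2 * norm (u x)"
    by (rule strongly_measurable_dominated_simple[OF J um]) (rule that)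
  have sL: "s i \<in> L2 J" for i
  proof (rule L2_bound[OF J])
    show "strongly_measurable ?M (s i)"
      unfolding strongly_measurable_def by (rule exI[of _ "\<lambda>_. s i"]) (simp add: s)
    show "integrable ?M (\<lambda>t. 4 * (norm (u t))\<^sup>2)" using u2 by simp
    show "(norm (s i t))\<^sup>2 \<le> 4 * (norm (u t))\<^sup>2" for t
      using power_mono[OF dom norm_ge_zero, of i t 2] by (simp add: power_mult_distrib)
  qed
  have "(\<lambda>i. \<integral>t. (norm ((u - s i) t))\<^sup>2 \<partial>?M) \<longlonglongrightarrow> (\<integral>t. 0 \<partial>?M)"
  proof (rule integral_dominated_convergence)
    show "(\<lambda>t. 0::real) \<in> borel_measurable ?M" by simp
    show "(\<lambda>t. (norm ((u - s i) t))\<^sup>2) \<in> borel_measurable ?M" for i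
      using L2_diff[OF J u sL] by (auto simp: L2_def)
    show "integrable ?M (\<lambda>t. 9 * (norm (u t))\<^sup>2)" using u2 by simp
    show "AE t in ?M. (\<lambda>i. (norm ((u - s i) t))\<^sup>2) \<longlonglongrightarrow> 0"
      using lim
    proof eventually_elim
      case (elim t)
      have "(\<lambda>i. (norm (u t - s i t))\<^sup>2) \<longlonglongrightarrow> (norm (u t - u t))\<^sup>2"
        by (intro tendsto_intros elim)
      then show ?case by simp
    qed
    show "AE t in ?M. norm ((norm ((u - s i) t))\<^sup>2) \<le> 9 * (norm (u t))\<^sup>2" for i
    proof (rule AE_I2)
      fix t
      have "norm (u t - s i t) \<le> 3 * norm (u t)"
        using norm_triangle_ineq4[of "u t" "s i t"] dom[of i t] by linarith
      then have "(norm (u t - s i t))\<^sup>2 \<le> (3 * norm (u t))\<^sup>2" by (rule power_mono) simp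
      then show "norm ((norm ((u - s i) t))\<^sup>2) \<le> 9 * (norm (u t))\<^sup>2"
        by (simp add: power_mult_distrib)
    qed
  qed
  then have "(\<lambda>i. norm_L2 J (u - s i)) \<longlonglongrightarrow> sqrt 0"
    unfolding norm_L2_def by (intro tendsto_real_sqrt) simp
  then have "\<forall>\<^sub>F i in sequentially. norm_L2 J (u - s i) < e"
    using e by (intro order_tendstoD(2)) auto
  then obtain i where "norm_L2 J (u - s i) < e" by (auto simp: eventually_sequentially)
  with s sL show thesis by (blast intro: that)
qed


text \<open>Riesz-Fischer. The members of the sequence are first replaced by nearby simple functions
  \<open>w k\<close>, whose pointwise limit is strongly measurable by definition. Summable
  increments take the place of the Cauchy condition and of the choice of a subsequence.\<close>

lemma L2_complete:
  fixes v :: "nat \<Rightarrow> real \<Rightarrow> 'a::banach"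
  assumes ab: "a \<le> b"
    and v: "\<And>k. v k \<in> L2 {a<..<b}"
    and le: "\<And>k. norm_L2 {a<..<b} (v (Suc k) - v k) \<le> c k"
    and c: "summable c"
  obtains u where "u \<in> L2 {a<..<b}" "(\<lambda>k. norm_L2 {a<..<b} (v k - u)) \<longlonglongrightarrow> 0"
proof -
  let ?J = "{a<..<b}" and ?M = "lebesgue_on {a<..<b}"
  have J: "?J \<in> sets lebesgue" by simp
  have "\<exists>w. simple_function ?M w \<and> w \<in> L2 ?J \<and> norm_L2 ?J (v k - w) < (1 / 2) ^ k" for k
    by (rule L2_simple_dense[OF J v, of "(1 / 2) ^ k" k]) auto
  then obtain w where w: "\<And>k. simple_function ?M (w k)" "\<And>k. w k \<in> L2 ?J"
    "\<And>k. norm_L2 ?J (v k - w k) < (1 / 2) ^ k" by metis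
  \<comment> \<open>Triangle inequality through \<open>v (Suc k)\<close> and \<open>v k\<close>: the
    increment \<open>c k\<close> plus the two replacement errors.\<close>
  define d where "d = (\<lambda>k. c k + (1 / 2) ^ k + (1 / 2) ^ Suc k :: real)"
  have d: "summable d"
    unfolding d_def by (intro summable_add c summable_geometric summable_ignore_initial_segment[of _ 1, simplified]) auto
  have wd: "norm_L2 ?J (w (Suc k) - w k) \<le> d k" for k
    using norm_L2_triangle_diff[OF J w(2)[of "Suc k"] v[of "Suc k"] w(2)[of k]]
      norm_L2_triangle_diff[OF J v[of "Suc k"] v[of k] w(2)[of k]] le[of k] w(3)[of k] w(3)[of "Suc k"]
    using norm_L2_minus_commute[of ?J "w (Suc k)" "v (Suc k)"] unfolding d_def by linarith
  have d0: "0 \<le> d k" for k using wd[of k] norm_L2_nonneg order_trans by blast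
  define g where "g = (\<lambda>k x. norm (w (Suc k) x - w k x))"
  have [measurable]: "g k \<in> borel_measurable ?M" for k
    using L2_measurable_norm[OF J L2_diff[OF J w(2) w(2)], of "Suc k" k] by (simp add: g_def)
  have gi: "integrable ?M (g k)" "(\<integral>x. g k x \<partial>?M) \<le> sqrt (b - a) * d k" for k
  proof -
    note L = L2_diff[OF J w(2) w(2), of "Suc k" k]
    show "integrable ?M (g k)" using L2_integrable_norm(1)[OF ab L] by (simp add: g_def)
    have "(\<integral>x. g k x \<partial>?M) \<le> sqrt (b - a) * norm_L2 ?J (w (Suc k) - w k)"
      using L2_integrable_norm(2)[OF ab L] by (simp add: g_def)
    also have "\<dots> \<le> sqrt (b - a) * d k" using ab wd by (intro mult_left_mono) auto
    finally show "(\<integral>x. g k x \<partial>?M) \<le> sqrt (b - a) * d k" .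
  qed
  \<comment> \<open>The integrals of the increments \<open>g k\<close> have a finite sum, so by
    monotone convergence the pointwise sum is finite almost everywhere.\<close>
  have "AE x in ?M. summable (\<lambda>k. g k x)"
  proof -
    have "(\<integral>\<^sup>+x. (\<Sum>k. ennreal (g k x)) \<partial>?M) = (\<Sum>k. \<integral>\<^sup>+x. ennreal (g k x) \<partial>?M)"
      by (rule nn_integral_suminf) simp
    also have "\<dots> = (\<Sum>k. ennreal (\<integral>x. g k x \<partial>?M))"
      using gi(1) by (subst nn_integral_eq_integral) (auto simp: g_def)
    also have "\<dots> \<le> (\<Sum>k. ennreal (sqrt (b - a) * d k))"
      by (intro suminf_le ennreal_leI gi summableI)
    also have "\<dots> < top"
      using ab d0 d by (subst suminf_ennreal2) (auto intro!: summable_mult)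
    finally have "AE x in ?M. (\<Sum>k. ennreal (g k x)) \<noteq> \<infinity>"
      by (intro nn_integral_PInf_AE) auto
    then show ?thesis
      by eventually_elim (auto intro!: summable_suminf_not_top simp: g_def)
  qed
  then have conv: "AE x in ?M. (\<lambda>k. w k x) \<longlonglongrightarrow> lim (\<lambda>k. w k x)"
  proof eventually_elim
    case (elim x)
    then have "summable (\<lambda>k. w (Suc k) x - w k x)"
      unfolding g_def by (rule summable_norm_cancel)
    then have "convergent (\<lambda>n. \<Sum>k<n. w (Suc k) x - w k x)"
      by (simp add: summable_iff_convergent)
    then obtain l where "(\<lambda>n. \<Sum>k<n. w (Suc k) x - w k x) \<longlonglongrightarrow> l" by (auto simp: convergent_def)
    then have "(\<lambda>n. w n x - w 0 x) \<longlonglongrightarrow> l" by (simp only: sum_lessThan_telescope[of "\<lambda>k. w k x"])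
    from tendsto_add[OF this tendsto_const[of "w 0 x"]]
    have "(\<lambda>n. w n x) \<longlonglongrightarrow> l + w 0 x" by simp
    then show ?case by (metis limI)
  qed
  define u where "u = (\<lambda>x. lim (\<lambda>k. w k x))"
  have um: "strongly_measurable ?M u"
    unfolding strongly_measurable_def u_def using w(1) conv by blast
  \<comment> \<open>Tail of the series \<open>d\<close>: it bounds the distance from
    \<open>w k\<close> to every later member and hence, by Fatou's lemma, to the limit.\<close>
  define D where "D = (\<lambda>k. suminf d - sum d {..<k})"
  have D: "norm_L2 ?J (w k - w m) \<le> D k" if "k \<le> m" for k m
  proof -
    have "norm_L2 ?J (w k - w m) \<le> sum d {k..<m}"
      using that
    proof (induction m rule: dec_induct)
      case base
      show ?case by simp
    next
      case (step n)
      then show ?case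
        using norm_L2_triangle_diff[OF J w(2)[of k] w(2)[of n] w(2)[of "Suc n"]] wd[of n]
          norm_L2_minus_commute[of ?J "w n" "w (Suc n)"] sum.atLeastLessThan_Suc[of k n d] by linarith
    qed
    also have "\<dots> = sum d {..<m} - sum d {..<k}"
      using that by (simp add: sum_diff_nat_ivl lessThan_atLeast0)
    also have "\<dots> \<le> D k"
      unfolding D_def using d0 by (simp add: sum_le_suminf[OF d])
    finally show ?thesis .
  qed
  have D0: "0 \<le> D k" for k using D[of k k] norm_L2_nonneg order_trans by blast
  have Dlim: "D \<longlonglongrightarrow> 0"
    using tendsto_diff[OF tendsto_const[of "suminf d"] summable_LIMSEQ[OF d]] by (simp add: D_def)
  have wu: "w k - u \<in> L2 ?J \<and> norm_L2 ?J (w k - u) \<le> D k" for k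
  proof -
    have sm: "strongly_measurable ?M (\<lambda>x. w k x - u x)"
      using w(2)[of k] um by (intro strongly_measurable_diff) (auto simp: L2_def)
    have [measurable]: "(\<lambda>x. norm (w k x - u x)) \<in> borel_measurable ?M"
      by (rule strongly_measurable_norm[OF J sm])
    have [measurable]: "(\<lambda>x. norm (w k x - w m x)) \<in> borel_measurable ?M" for m
      using L2_measurable_norm[OF J L2_diff[OF J w(2) w(2)], of k m] by simp
    have "(\<integral>\<^sup>+x. ennreal ((norm (w k x - u x))\<^sup>2) \<partial>?M) = (\<integral>\<^sup>+x. liminf (\<lambda>m. ennreal ((norm (w k x - w m x))\<^sup>2)) \<partial>?M)"
    proof (rule nn_integral_cong_AE)
      show "AE x in ?M. ennreal ((norm (w k x - u x))\<^sup>2) = liminf (\<lambda>m. ennreal ((norm (w k x - w m x))\<^sup>2))"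
        using conv
      proof eventually_elim
        case (elim x)
        have "(\<lambda>m. ennreal ((norm (w k x - w m x))\<^sup>2)) \<longlonglongrightarrow> ennreal ((norm (w k x - u x))\<^sup>2)"
          unfolding u_def by (intro tendsto_intros elim)
        then show ?case by (rule lim_imp_Liminf[OF sequentially_bot, symmetric])
      qed
    qed
    also have "\<dots> \<le> liminf (\<lambda>m. \<integral>\<^sup>+x. ennreal ((norm (w k x - w m x))\<^sup>2) \<partial>?M)"
      by (rule nn_integral_liminf) simp
    also have "\<dots> \<le> ennreal ((D k)\<^sup>2)"
    proof (rule Liminf_le)
      show "\<forall>\<^sub>F m in sequentially. (\<integral>\<^sup>+x. ennreal ((norm (w k x - w m x))\<^sup>2) \<partial>?M) \<le> ennreal ((D k)\<^sup>2)"
        using eventually_ge_at_top[of k]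
      proof eventually_elim
        case (elim m)
        have "integrable ?M (\<lambda>x. (norm ((w k - w m) x))\<^sup>2)"
          using L2_diff[OF J w(2) w(2)] by (simp add: L2_def)
        then have "(\<integral>\<^sup>+x. ennreal ((norm (w k x - w m x))\<^sup>2) \<partial>?M) = ennreal ((norm_L2 ?J (w k - w m))\<^sup>2)"
          by (subst nn_integral_eq_integral) (auto simp: norm_L2_power2)
        also have "\<dots> \<le> ennreal ((D k)\<^sup>2)"
          using D[OF elim] by (intro ennreal_leI power_mono) auto
        finally show ?case .
      qed
    qed simp
    finally have fin: "(\<integral>\<^sup>+x. ennreal ((norm (w k x - u x))\<^sup>2) \<partial>?M) \<le> ennreal ((D k)\<^sup>2)" .
    have int: "integrable ?M (\<lambda>x. (norm (w k x - u x))\<^sup>2)"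
      using fin by (intro integrableI_bounded) (auto simp: order_le_less_trans)
    have "ennreal (\<integral>x. (norm (w k x - u x))\<^sup>2 \<partial>?M) \<le> ennreal ((D k)\<^sup>2)"
      using fin int by (subst (asm) nn_integral_eq_integral) auto
    then have "(\<integral>x. (norm (w k x - u x))\<^sup>2 \<partial>?M) \<le> (D k)\<^sup>2" by simp
    then have "norm_L2 ?J (w k - u) \<le> D k"
      unfolding norm_L2_def using D0[of k] by (simp add: real_le_lsqrt)
    moreover have "w k - u \<in> L2 ?J" using int sm by (simp add: L2_def fun_diff_def)
    ultimately show ?thesis by blast
  qed
  \<comment> \<open>\<open>u\<close> is recovered as \<open>w 0 - (w 0 - u)\<close>, a difference of
    two members of the space.\<close>
  have uL: "u \<in> L2 ?J"
    using L2_diff[OF J w(2) conjunct1[OF wu], of 0 0] by simp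
  have vu: "norm_L2 ?J (v k - u) \<le> (1 / 2) ^ k + D k" for k
    using norm_L2_triangle_diff[OF J v[of k] w(2)[of k] uL] conjunct2[OF wu[of k]] w(3)[of k] by linarith
  have "(\<lambda>k. (1 / 2 :: real) ^ k) \<longlonglongrightarrow> 0" by (rule LIMSEQ_power_zero) simp
  from tendsto_add[OF this Dlim] have lim0: "(\<lambda>k. (1 / 2) ^ k + D k) \<longlonglongrightarrow> 0" by simp
  have "(\<lambda>k. norm_L2 ?J (v k - u)) \<longlonglongrightarrow> 0"
    by (rule tendsto_sandwich[OF _ _ tendsto_const lim0]) (use vu in \<open>auto intro: always_eventually\<close>)
  with uL show thesis by (rule that)
qed

section \<open>The Bochner integral as a Henstock-Kurzweil integral\<close>

text \<open>In any Riemann sum the error of replacing \<open>f\<close> by \<open>g\<close> is at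
  most the Riemann sum of the scalar majorant \<open>h\<close>. This turns L1-approximation by
  simple functions into gauge integrability.\<close>

lemma has_integral_norm_limit:
  fixes f :: "real \<Rightarrow> 'a::real_normed_vector"
  assumes "\<And>e. e > 0 \<Longrightarrow> \<exists>g I h H. (g has_integral I) {a..b} \<and> (h has_integral H) {a..b} \<and>
    H \<le> e \<and> norm (I - y) \<le> e \<and> (\<forall>x\<in>{a..b}. norm (f x - g x) \<le> h x)"
  shows "(f has_integral y) {a..b}"
  unfolding box_real[symmetric] has_integral
proof (intro allI impI)
  fix e :: real assume e: "e > 0"
  then obtain g I h H where g: "(g has_integral I) (cbox a b)" and h: "(h has_integral H) (cbox a b)"
    and H: "H \<le> e / 4" and I: "norm (I - y) \<le> e / 4"
    and le: "\<And>x. x \<in> cbox a b \<Longrightarrow> norm (f x - g x) \<le> h x"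
    using assms[of "e / 4"] by (auto simp: cbox_interval)
  \<comment> \<open>Shares of \<open>e\<close>: two quarters for the Riemann sum of
    \<open>h\<close>, one for that of \<open>g\<close> against \<open>I\<close>, one for
    \<open>norm (I - y)\<close>.\<close>
  have e4: "e / 4 > 0" using e by simp
  obtain G1 where G1: "gauge G1" "\<And>D. D tagged_division_of cbox a b \<Longrightarrow> G1 fine D \<Longrightarrow>
      norm ((\<Sum>(x, k)\<in>D. Sigma_Algebra.measure lborel k *\<^sub>R g x) - I) < e / 4"
    using g e4 unfolding has_integral by meson
  obtain G2 where G2: "gauge G2" "\<And>D. D tagged_division_of cbox a b \<Longrightarrow> G2 fine D \<Longrightarrow>
      norm ((\<Sum>(x, k)\<in>D. Sigma_Algebra.measure lborel k *\<^sub>R h x) - H) < e / 4"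
    using h e4 unfolding has_integral by meson
  have "norm ((\<Sum>(x, k)\<in>D. Sigma_Algebra.measure lborel k *\<^sub>R f x) - y) < e"
    if D: "D tagged_division_of cbox a b" "(\<lambda>x. G1 x \<inter> G2 x) fine D" for D
  proof -
    have fine: "G1 fine D" "G2 fine D" using D(2) by (auto simp: fine_Int)
    have "norm ((\<Sum>(x, k)\<in>D. Sigma_Algebra.measure lborel k *\<^sub>R f x) - (\<Sum>(x, k)\<in>D. Sigma_Algebra.measure lborel k *\<^sub>R g x))
        = norm (\<Sum>(x, k)\<in>D. Sigma_Algebra.measure lborel k *\<^sub>R (f x - g x))"
      by (simp add: sum_subtractf[symmetric] scaleR_diff_right case_prod_unfold)
    also have "\<dots> \<le> (\<Sum>(x, k)\<in>D. Sigma_Algebra.measure lborel k *\<^sub>R h x)"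
    proof (rule sum_norm_le, clarify)
      fix x k assume "(x, k) \<in> D"
      then have "x \<in> cbox a b" using D(1) tag_in_interval by blast
      then show "norm (Sigma_Algebra.measure lborel k *\<^sub>R (f x - g x)) \<le> Sigma_Algebra.measure lborel k *\<^sub>R h x"
        using le by (simp add: mult_left_mono)
    qed
    finally have 1: "norm ((\<Sum>(x, k)\<in>D. Sigma_Algebra.measure lborel k *\<^sub>R f x) - (\<Sum>(x, k)\<in>D. Sigma_Algebra.measure lborel k *\<^sub>R g x))
        \<le> (\<Sum>(x, k)\<in>D. Sigma_Algebra.measure lborel k *\<^sub>R h x)" .
    have 2: "norm ((\<Sum>(x, k)\<in>D. Sigma_Algebra.measure lborel k *\<^sub>R g x) - I) < e / 4" by (rule G1(2)[OF D(1) fine(1)])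
    have 3: "(\<Sum>(x, k)\<in>D. Sigma_Algebra.measure lborel k *\<^sub>R h x) < e / 4 + e / 4"
      using G2(2)[OF D(1) fine(2)] H unfolding real_norm_def abs_less_iff by linarith
    define F where "F = (\<Sum>(x, k)\<in>D. Sigma_Algebra.measure lborel k *\<^sub>R f x)"
    define K where "K = (\<Sum>(x, k)\<in>D. Sigma_Algebra.measure lborel k *\<^sub>R g x)"
    have "norm (F - y) \<le> norm (F - K) + norm (K - I) + norm (I - y)"
      using norm_triangle_ineq[of "F - K" "K - I"] norm_triangle_ineq[of "F - I" "I - y"] by simp
    then show ?thesis using 1 2 3 I unfolding F_def[symmetric] K_def[symmetric] by linarith
  qed
  then show "\<exists>\<gamma>. gauge \<gamma> \<and> (\<forall>D. D tagged_division_of cbox a b \<and> \<gamma> fine D \<longrightarrow>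
      norm ((\<Sum>(x, k)\<in>D. Sigma_Algebra.measure lborel k *\<^sub>R f x) - y) < e)"
    using G1(1) G2(1) by (intro exI[of _ "\<lambda>x. G1 x \<inter> G2 x"]) (auto intro: gauge_Int)
qed

lemma has_integral_open_interval_restrict:
  fixes f :: "real \<Rightarrow> 'a::banach"
  shows "((\<lambda>x. if x \<in> {a<..<b} then f x else 0) has_integral y) {a..b} \<longleftrightarrow> (f has_integral y) {a..b}"
  by (rule has_integral_spike_finite_eq[of "{a, b}"]) auto

text \<open>A simple function is the finite sum, over its values \<open>y\<close>, of
  \<open>y\<close> times the indicator of the level set \<open>A y\<close>, and the gauge integral
  of such an indicator is the Lebesgue measure of the set.\<close>

lemma simple_function_has_integral:
  fixes s :: "real \<Rightarrow> 'a::banach"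
  assumes s: "simple_function (lebesgue_on {a<..<b}) s"
  shows "(s has_integral Bochner_Integration.simple_bochner_integral (lebesgue_on {a<..<b}) s) {a..b}"
proof -
  let ?J = "{a<..<b}" and ?M = "lebesgue_on {a<..<b}"
  define A where "A = (\<lambda>y. {x \<in> ?J. s x = y})"
  have Am: "A y \<in> lmeasurable" "A y \<in> sets ?M" for y
  proof -
    have "s -` {y} \<inter> space ?M \<in> sets ?M" by (rule simple_functionD(2)[OF s])
    also have "s -` {y} \<inter> space ?M = A y" by (auto simp: A_def)
    finally show *: "A y \<in> sets ?M" .
    then have "A y \<in> sets lebesgue" by (simp add: sets_restrict_space_iff)
    then show "A y \<in> lmeasurable"
      by (rule fmeasurableI2[of ?J, rotated 2]) (auto simp: A_def)
  qed
  have "((\<lambda>x. if x \<in> A y then 1 else 0 :: real) has_integral measure ?M (A y)) {a..b}" for y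
  proof -
    have "((\<lambda>x. 1 :: real) has_integral measure lebesgue (A y)) (A y)"
    proof -
      have "(indicat_real (A y) has_integral measure lebesgue (A y)) UNIV"
        using Am(1)[of y] by (simp only: lmeasurable_iff_has_integral)
      moreover have "indicat_real (A y) = (\<lambda>x. if x \<in> A y then 1 else 0)"
        by (auto simp: indicator_def)
      ultimately show ?thesis by (simp add: has_integral_restrict_UNIV)
    qed
    moreover have "measure lebesgue (A y) = measure ?M (A y)"
      by (rule measure_restrict_space[symmetric]) (auto simp: A_def)
    ultimately show ?thesis
      by (subst has_integral_restrict) (auto simp: A_def)
  qed
  then have "((\<lambda>x. \<Sum>y\<in>s ` ?J. (if x \<in> A y then 1 else 0 :: real) *\<^sub>R y) has_integral
      (\<Sum>y\<in>s ` ?J. measure ?M (A y) *\<^sub>R y)) {a..b}"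
    using simple_functionD(1)[OF s] by (intro has_integral_sum has_integral_scaleR_left) auto
  moreover have "(\<Sum>y\<in>s ` ?J. measure ?M (A y) *\<^sub>R y) = Bochner_Integration.simple_bochner_integral ?M s"
    by (simp add: simple_bochner_integral_def A_def)
  moreover have "(\<Sum>y\<in>s ` ?J. (if x \<in> A y then 1 else 0 :: real) *\<^sub>R y) = (if x \<in> ?J then s x else 0)" for x
  proof (cases "x \<in> ?J")
    case True
    have "(\<Sum>y\<in>s ` ?J. (if x \<in> A y then 1 else 0 :: real) *\<^sub>R y) = (\<Sum>y\<in>s ` ?J. if y = s x then y else 0)"
      using True by (intro sum.cong) (auto simp: A_def)
    then show ?thesis using True simple_functionD(1)[OF s] by (simp add: sum.delta)
  next
    case False
    then have "x \<notin> A y" for y unfolding A_def by blast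
    then show ?thesis using False by (simp only: if_False scaleR_zero_left sum.neutral_const)
  qed
  ultimately show ?thesis by (simp only: has_integral_open_interval_restrict)
qed

lemma lebesgue_on_has_integral_Icc:
  fixes f :: "real \<Rightarrow> real"
  assumes "integrable (lebesgue_on {a<..<b}) f"
  shows "(f has_integral (\<integral>x. f x \<partial>lebesgue_on {a<..<b})) {a..b}"
proof -
  have "(f has_integral (\<integral>x. f x \<partial>lebesgue_on {a<..<b})) {a<..<b}"
    using assms by (rule has_integral_integral_lebesgue_on) simp
  then have "((\<lambda>x. if x \<in> {a<..<b} then f x else 0) has_integral (\<integral>x. f x \<partial>lebesgue_on {a<..<b})) {a..b}"
    by (subst has_integral_restrict) auto
  then show ?thesis by (simp only: has_integral_open_interval_restrict)
qed

lemma simple_bochner_integrable_strongly_measurable: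
  assumes "Bochner_Integration.simple_bochner_integrable M s"
  shows "strongly_measurable M s"
  using assms unfolding strongly_measurable_def
  by (intro exI[of _ "\<lambda>_. s"]) (auto elim: simple_bochner_integrable.cases)

text \<open>Bochner approximations are the input that \<open>has_integral_norm_limit\<close> asks
  for, with \<open>h\<close> the norm of the difference. Uniqueness of the gauge integral then gives
  uniqueness for the \<open>THE\<close> in \<open>strong_bochner_integral\<close>.\<close>

lemma has_strong_bochner_integral_has_integral:
  fixes f :: "real \<Rightarrow> 'a::banach"
  assumes "has_strong_bochner_integral (lebesgue_on {a<..<b}) f y"
  shows "(f has_integral y) {a..b}"
proof -
  let ?J = "{a<..<b}" and ?M = "lebesgue_on {a<..<b}"
  let ?I = "Bochner_Integration.simple_bochner_integral ?M"
  have J: "?J \<in> sets lebesgue" by simp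
  obtain s where f: "strongly_measurable ?M f"
    and s: "\<And>i::nat. Bochner_Integration.simple_bochner_integrable ?M (s i)"
    and lim1: "(\<lambda>i. \<integral>\<^sup>+ x. norm (f x - s i x) \<partial>?M) \<longlonglongrightarrow> 0"
    and lim2: "(\<lambda>i. ?I (s i)) \<longlonglongrightarrow> y"
    using assms unfolding has_strong_bochner_integral_def by blast
  have "((\<lambda>x. if x \<in> ?J then f x else 0) has_integral y) {a..b}"
  proof (rule has_integral_norm_limit)
    fix e :: real assume e: "e > 0"
    have "\<forall>\<^sub>F i in sequentially. (\<integral>\<^sup>+ x. norm (f x - s i x) \<partial>?M) < ennreal e"
      by (rule order_tendstoD(2)[OF lim1]) (use e in simp)
    moreover have "\<forall>\<^sub>F i in sequentially. dist (?I (s i)) y < e"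
      using lim2 e by (rule tendstoD)
    ultimately have "\<forall>\<^sub>F i in sequentially. (\<integral>\<^sup>+ x. norm (f x - s i x) \<partial>?M) < ennreal e \<and>
        dist (?I (s i)) y < e"
      by (rule eventually_conj)
    then obtain i where i: "(\<integral>\<^sup>+ x. norm (f x - s i x) \<partial>?M) < ennreal e"
      "dist (?I (s i)) y < e"
      by (auto simp: eventually_sequentially)
    have [measurable]: "(\<lambda>x. norm (f x - s i x)) \<in> borel_measurable ?M"
      by (intro strongly_measurable_norm[OF J] strongly_measurable_diff f
          simple_bochner_integrable_strongly_measurable s)
    have int: "integrable ?M (\<lambda>x. norm (f x - s i x))"
      using i(1) by (intro integrableI_bounded) (auto elim: order_less_trans)
    have "ennreal (\<integral>x. norm (f x - s i x) \<partial>?M) < ennreal e"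
      using i(1) int by (subst (asm) nn_integral_eq_integral) auto
    then have H: "(\<integral>x. norm (f x - s i x) \<partial>?M) \<le> e"
      using e by (simp add: ennreal_less_iff)
    have si: "simple_function ?M (s i)" using s[of i] by (auto elim: simple_bochner_integrable.cases)
    show "\<exists>g I h H. (g has_integral I) {a..b} \<and> (h has_integral H) {a..b} \<and> H \<le> e \<and> norm (I - y) \<le> e \<and>
        (\<forall>x\<in>{a..b}. norm ((if x \<in> ?J then f x else 0) - g x) \<le> h x)"
    proof (intro exI conjI)
      show "((\<lambda>x. if x \<in> ?J then s i x else 0) has_integral
          ?I (s i)) {a..b}"
        using simple_function_has_integral[OF si] by (simp only: has_integral_open_interval_restrict)
      show "((\<lambda>x. norm (f x - s i x)) has_integral (\<integral>x. norm (f x - s i x) \<partial>?M)) {a..b}"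
        by (rule lebesgue_on_has_integral_Icc[OF int])
      show "norm (?I (s i) - y) \<le> e"
        using i(2) by (simp add: dist_norm)
    qed (use H in auto)
  qed
  then show ?thesis by (simp only: has_integral_open_interval_restrict)
qed

text \<open>The integrals of dominated simple approximations form a Cauchy sequence: the difference
  of two of them is a gauge integral with integrand bounded by
  \<open>norm (f x - s i x) + norm (f x - s k x)\<close>.\<close>

lemma has_strong_bochner_integral_exists:
  fixes f :: "real \<Rightarrow> 'a::banach"
  assumes f: "strongly_measurable (lebesgue_on {a<..<b}) f"
    and int: "integrable (lebesgue_on {a<..<b}) (\<lambda>x. norm (f x))"
  shows "\<exists>y. has_strong_bochner_integral (lebesgue_on {a<..<b}) f y"
proof -
  let ?J = "{a<..<b}" and ?M = "lebesgue_on {a<..<b}"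
  let ?I = "Bochner_Integration.simple_bochner_integral ?M"
  have J: "?J \<in> sets lebesgue" by simp
  interpret finite_measure ?M by (rule finite_measure_lebesgue_on) simp
  obtain s where s: "\<And>i. simple_function ?M (s i)"
    and lim: "AE x in ?M. (\<lambda>i::nat. s i x) \<longlonglongrightarrow> f x"
    and dom: "\<And>i x. norm (s i x) \<le> 2 * norm (f x)"
    by (rule strongly_measurable_dominated_simple[OF J f]) (rule that)
  have sb: "Bochner_Integration.simple_bochner_integrable ?M (s i)" for i
    by (rule simple_bochner_integrable.intros[OF s]) (simp add: emeasure_eq_measure)
  have [measurable]: "(\<lambda>x. norm (f x - s i x)) \<in> borel_measurable ?M" for i
    by (intro strongly_measurable_norm[OF J] strongly_measurable_diff f
        simple_bochner_integrable_strongly_measurable sb)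
  have dom': "norm (f x - s i x) \<le> 3 * norm (f x)" for i x
    using norm_triangle_ineq4[of "f x" "s i x"] dom[of i x] by linarith
  have di: "integrable ?M (\<lambda>x. norm (f x - s i x))" for i
  proof (rule Bochner_Integration.integrable_bound)
    show "integrable ?M (\<lambda>x. 3 * norm (f x))" using int by simp
  qed (use dom' in auto)
  define A where "A = (\<lambda>i. \<integral>x. norm (f x - s i x) \<partial>?M)"
  have "(\<lambda>i. \<integral>x. norm (f x - s i x) \<partial>?M) \<longlonglongrightarrow> (\<integral>x. 0 \<partial>?M)"
  proof (rule integral_dominated_convergence)
    show "integrable ?M (\<lambda>x. 3 * norm (f x))" using int by simp
    show "AE x in ?M. (\<lambda>i. norm (f x - s i x)) \<longlonglongrightarrow> 0"
      using lim
    proof eventually_elim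
      case (elim x)
      have "(\<lambda>i. norm (f x - s i x)) \<longlonglongrightarrow> norm (f x - f x)" by (intro tendsto_intros elim)
      then show ?case by simp
    qed
  qed (use dom' in auto)
  then have A: "A \<longlonglongrightarrow> 0" by (simp add: A_def)
  have nn: "(\<integral>\<^sup>+x. norm (f x - s i x) \<partial>?M) = ennreal (A i)" for i
    unfolding A_def using di by (intro nn_integral_eq_integral) auto
  have diff: "norm (?I (s i) - ?I (s k)) \<le> A i + A k" for i k
  proof -
    have "((\<lambda>x. s i x - s k x) has_integral
        (?I (s i) - ?I (s k))) {a..b}"
      by (intro has_integral_diff simple_function_has_integral s)
    moreover have "((\<lambda>x. norm (f x - s i x) + norm (f x - s k x)) has_integral (A i + A k)) {a..b}"
      unfolding A_def by (intro has_integral_add lebesgue_on_has_integral_Icc di)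
    moreover have "norm (s i x - s k x) \<le> norm (f x - s i x) + norm (f x - s k x)" for x
      using norm_triangle_ineq4[of "f x - s k x" "f x - s i x"] by simp
    ultimately show ?thesis
      by (metis (no_types, lifting) has_integral_integrable integral_norm_bound_integral integral_unique)
  qed
  have "Cauchy (\<lambda>i. ?I (s i))"
  proof (rule metric_CauchyI)
    fix e :: real assume "e > 0"
    then have "\<forall>\<^sub>F i in sequentially. A i < e / 2" by (intro order_tendstoD(2)[OF A]) simp
    then obtain N where N: "\<And>i. i \<ge> N \<Longrightarrow> A i < e / 2" by (auto simp: eventually_sequentially)
    show "\<exists>N. \<forall>i\<ge>N. \<forall>k\<ge>N. dist (?I (s i)) (?I (s k)) < e"
    proof (intro exI[of _ N] allI impI)
      fix i k assume "i \<ge> N" "k \<ge> N"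
      then show "dist (?I (s i)) (?I (s k)) < e"
        using diff[of i k] N[of i] N[of k] by (simp add: dist_norm)
    qed
  qed
  then obtain y where "(\<lambda>i. ?I (s i)) \<longlonglongrightarrow> y"
    using Cauchy_convergent convergent_def by blast
  moreover have "(\<lambda>i. \<integral>\<^sup>+x. norm (f x - s i x) \<partial>?M) \<longlonglongrightarrow> 0"
    unfolding nn using tendsto_ennrealI[OF A] by simp
  ultimately show ?thesis
    unfolding has_strong_bochner_integral_def using f sb by blast
qed

text \<open>The bridge for the input integral: \<open>integral\<close> replaces
  \<open>strong_bochner_integral\<close>, and with it linearity, splitting of intervals and
  translation are at hand.\<close>

lemma strong_bochner_integral_eq_integral:
  fixes f :: "real \<Rightarrow> 'a::banach"
  assumes "strongly_measurable (lebesgue_on {a<..<b}) f"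
    and "integrable (lebesgue_on {a<..<b}) (\<lambda>x. norm (f x))"
  shows "f integrable_on {a..b}"
    and "strong_bochner_integral (lebesgue_on {a<..<b}) f = integral {a..b} f"
    and "norm (integral {a..b} f) \<le> (\<integral>x. norm (f x) \<partial>lebesgue_on {a<..<b})"
proof -
  obtain y where y: "has_strong_bochner_integral (lebesgue_on {a<..<b}) f y"
    using has_strong_bochner_integral_exists[OF assms] by blast
  note i = has_strong_bochner_integral_has_integral[OF y]
  show int: "f integrable_on {a..b}" using i by blast
  show "strong_bochner_integral (lebesgue_on {a<..<b}) f = integral {a..b} f"
    unfolding strong_bochner_integral_def
  proof (rule the_equality)
    show "has_strong_bochner_integral (lebesgue_on {a<..<b}) f (integral {a..b} f)"
      using y i by (simp add: integral_unique)
    show "z = integral {a..b} f" if "has_strong_bochner_integral (lebesgue_on {a<..<b}) f z" for z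
      using has_strong_bochner_integral_has_integral[OF that] by (simp add: integral_unique)
  qed
  note n = lebesgue_on_has_integral_Icc[OF assms(2)]
  show "norm (integral {a..b} f) \<le> (\<integral>x. norm (f x) \<partial>lebesgue_on {a<..<b})"
    using integral_norm_bound_integral[OF int has_integral_integrable[OF n]] integral_unique[OF n] by simp
qed

section \<open>Restriction, extension and translation of square integrable functions\<close>

lemma L2_cong:
  assumes "\<And>t. t \<in> J \<Longrightarrow> u t = v t"
  shows "u \<in> L2 J \<longleftrightarrow> v \<in> L2 J" "norm_L2 J u = norm_L2 J v"
proof -
  have 1: "strongly_measurable (lebesgue_on J) g"
    if eq: "\<And>t. t \<in> J \<Longrightarrow> f t = g t" and f: "strongly_measurable (lebesgue_on J) f" for f g :: "real \<Rightarrow> 'a"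
  proof -
    obtain s where s: "\<And>i. simple_function (lebesgue_on J) (s i)"
      "AE x in lebesgue_on J. (\<lambda>i::nat. s i x) \<longlonglongrightarrow> f x"
      using f unfolding strongly_measurable_def by blast
    have "AE x in lebesgue_on J. (\<lambda>i. s i x) \<longlonglongrightarrow> g x"
      using s(2) AE_space by eventually_elim (use eq in simp)
    with s(1) show ?thesis unfolding strongly_measurable_def by blast
  qed
  have 2: "integrable (lebesgue_on J) (\<lambda>t. (norm (u t))\<^sup>2) \<longleftrightarrow> integrable (lebesgue_on J) (\<lambda>t. (norm (v t))\<^sup>2)"
    by (rule Bochner_Integration.integrable_cong) (use assms in auto)
  show "u \<in> L2 J \<longleftrightarrow> v \<in> L2 J"
    unfolding L2_def mem_Collect_eq using 1[of u v, OF assms] 1[of v u, OF assms[symmetric]] 2 by blast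
  show "norm_L2 J u = norm_L2 J v"
    unfolding norm_L2_def
    by (intro arg_cong[where f = sqrt] Bochner_Integration.integral_cong) (use assms in auto)
qed

lemma L2_restrict:
  fixes u :: "real \<Rightarrow> 'a::real_normed_vector"
  assumes J: "J \<in> sets lebesgue" and K: "K \<in> sets lebesgue" and JK: "J \<subseteq> K" and u: "u \<in> L2 K"
  shows "u \<in> L2 J" "norm_L2 J u \<le> norm_L2 K u"
proof -
  obtain s where s: "\<And>i. simple_function (lebesgue_on K) (s i)"
    and lim: "AE x in lebesgue_on K. (\<lambda>i::nat. s i x) \<longlonglongrightarrow> u x"
    using u unfolding L2_def strongly_measurable_def by blast
  have "simple_function (lebesgue_on J) (s i)" for i
  proof -
    have "(\<lambda>x. x) \<in> measurable (lebesgue_on J) (lebesgue_on K)"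
      by (rule measurable_restrict_mono[OF _ JK]) simp
    from simple_function_comp[OF this s[of i]] show ?thesis by simp
  qed
  moreover have "AE x in lebesgue_on J. (\<lambda>i. s i x) \<longlonglongrightarrow> u x"
    using lim J K JK by (auto simp: AE_restrict_space_iff elim!: AE_mp)
  ultimately have sm: "strongly_measurable (lebesgue_on J) u" unfolding strongly_measurable_def by blast
  have int: "integrable (lebesgue_on K) (\<lambda>t. (norm (u t))\<^sup>2)" using u by (simp add: L2_def)
  then have int': "integrable (lebesgue_on K) (\<lambda>t. if t \<in> J then (norm (u t))\<^sup>2 else 0)"
  proof (rule Bochner_Integration.integrable_bound)
    have "J \<in> sets (lebesgue_on K)" using J K JK by (auto simp: sets_restrict_space_iff)
    then show "(\<lambda>t. if t \<in> J then (norm (u t))\<^sup>2 else 0) \<in> borel_measurable (lebesgue_on K)"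
      using int by (intro measurable_If_set) (auto intro: sets.Int)
  qed auto
  have "integrable (lebesgue_on J) (\<lambda>t. (norm (u t))\<^sup>2)"
  proof -
    have "integrable lebesgue (\<lambda>x. indicat_real K x *\<^sub>R (if x \<in> J then (norm (u x))\<^sup>2 else 0))"
      using int' K by (simp add: integrable_restrict_space)
    also have "(\<lambda>x. indicat_real K x *\<^sub>R (if x \<in> J then (norm (u x))\<^sup>2 else 0)) = (\<lambda>x. indicat_real J x *\<^sub>R (norm (u x))\<^sup>2)"
      using JK by (auto simp: fun_eq_iff indicator_def)
    finally show ?thesis using J by (simp add: integrable_restrict_space)
  qed
  with sm show "u \<in> L2 J" by (simp add: L2_def)
  have "(\<integral>t. (norm (u t))\<^sup>2 \<partial>lebesgue_on J) = (\<integral>t. (if t \<in> J then (norm (u t))\<^sup>2 else 0) \<partial>lebesgue_on K)"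
    by (rule Lebesgue_Measure.integral_restrict[OF JK J K, symmetric])
  also have "\<dots> \<le> (\<integral>t. (norm (u t))\<^sup>2 \<partial>lebesgue_on K)"
    by (rule integral_mono[OF int' int]) simp
  finally show "norm_L2 J u \<le> norm_L2 K u" unfolding norm_L2_def by (rule real_sqrt_le_mono)
qed

text \<open>Moves a control to the whole line, where translations act; restriction to an interval
  afterwards yields shifted and delayed controls.\<close>

lemma L2_zero_extension:
  fixes u :: "real \<Rightarrow> 'a::real_normed_vector"
  assumes J: "J \<in> sets lebesgue" and u: "u \<in> L2 J"
  shows "(\<lambda>t. if t \<in> J then u t else 0) \<in> L2 UNIV"
    and "norm_L2 UNIV (\<lambda>t. if t \<in> J then u t else 0) = norm_L2 J u"
proof -
  obtain s where s: "\<And>i. simple_function (lebesgue_on J) (s i)"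
    and lim: "AE x in lebesgue_on J. (\<lambda>i::nat. s i x) \<longlonglongrightarrow> u x"
    using u unfolding L2_def strongly_measurable_def by blast
  define r where "r = (\<lambda>i t. if t \<in> J then s i t else 0)"
  have "simple_function lebesgue (r i)" for i
    unfolding simple_function_def
  proof (intro conjI ballI)
    have "r i ` space lebesgue \<subseteq> insert 0 (s i ` J)" by (auto simp: r_def)
    then show "finite (r i ` space lebesgue)"
      using simple_functionD(1)[OF s[of i]] by (auto intro: finite_subset)
    fix y
    have "s i -` {y} \<inter> J \<in> sets lebesgue"
      using simple_functionD(2)[OF s[of i], of "{y}"] J by (simp add: sets_restrict_space_iff)
    moreover have "r i -` {y} \<inter> space lebesgue = (s i -` {y} \<inter> J) \<union> (if y = 0 then - J else {})"
      by (auto simp: r_def split: if_splits)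
    ultimately show "r i -` {y} \<inter> space lebesgue \<in> sets lebesgue"
      using J by (auto simp: Compl_in_sets_lebesgue)
  qed
  moreover have "AE x in lebesgue. (\<lambda>i. r i x) \<longlonglongrightarrow> (if x \<in> J then u x else 0)"
    using lim J by (auto simp: AE_restrict_space_iff r_def elim!: AE_mp)
  ultimately have sm: "strongly_measurable lebesgue (\<lambda>t. if t \<in> J then u t else 0)"
    unfolding strongly_measurable_def by blast
  have eq: "(\<lambda>t. (norm (if t \<in> J then u t else 0))\<^sup>2) = (\<lambda>t. if t \<in> J then (norm (u t))\<^sup>2 else 0)"
    by auto
  have "integrable lebesgue (\<lambda>t. indicat_real J t *\<^sub>R (norm (u t))\<^sup>2)"
    using u J by (simp add: L2_def integrable_restrict_space)
  also have "(\<lambda>t. indicat_real J t *\<^sub>R (norm (u t))\<^sup>2) = (\<lambda>t. (norm (if t \<in> J then u t else 0))\<^sup>2)"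
    by (auto simp: fun_eq_iff indicator_def)
  finally show "(\<lambda>t. if t \<in> J then u t else 0) \<in> L2 UNIV"
    using sm by (simp add: L2_def lebesgue_on_UNIV_eq)
  show "norm_L2 UNIV (\<lambda>t. if t \<in> J then u t else 0) = norm_L2 J u"
    unfolding norm_L2_def lebesgue_on_UNIV_eq eq
    by (subst Lebesgue_Measure.integral_restrict_UNIV[OF J]) simp
qed

text \<open>Lebesgue measure is its own image under \<open>t \<mapsto> c + t\<close>;
  approximations, null sets and integrals are transported along this identity.\<close>

lemma L2_translate:
  fixes u :: "real \<Rightarrow> 'a::real_normed_vector"
  assumes u: "u \<in> L2 UNIV"
  shows "(\<lambda>t. u (c + t)) \<in> L2 UNIV" "norm_L2 UNIV (\<lambda>t. u (c + t)) = norm_L2 UNIV u"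
proof -
  have T: "(\<lambda>t. c + t) \<in> measurable lebesgue lebesgue"
    using lebesgue_affine_measurable[where c = "\<lambda>x::real. 1" and t = c] by simp
  have distr: "lebesgue = distr lebesgue lebesgue (\<lambda>t. c + t)"
    using lebesgue_real_affine[of 1 c] by (simp add: density_1)
  obtain s where s: "\<And>i. simple_function lebesgue (s i)"
    and lim: "AE x in lebesgue. (\<lambda>i::nat. s i x) \<longlonglongrightarrow> u x"
    using u unfolding L2_def strongly_measurable_def lebesgue_on_UNIV_eq by blast
  have "AE x in distr lebesgue lebesgue (\<lambda>t. c + t). (\<lambda>i. s i x) \<longlonglongrightarrow> u x"
    by (subst distr[symmetric]) (rule lim)
  then have "AE x in lebesgue. (\<lambda>i. s i (c + x)) \<longlonglongrightarrow> u (c + x)"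
    by (rule AE_distrD[OF T])
  moreover have "simple_function lebesgue (\<lambda>x. s i (c + x))" for i
    by (rule simple_function_comp[OF T s])
  ultimately have sm: "strongly_measurable lebesgue (\<lambda>t. u (c + t))"
    unfolding strongly_measurable_def by (intro exI[of _ "\<lambda>i x. s i (c + x)"]) simp
  have int: "integrable lebesgue (\<lambda>t. (norm (u t))\<^sup>2)"
    using u by (simp add: L2_def lebesgue_on_UNIV_eq)
  then have "integrable (distr lebesgue lebesgue (\<lambda>t. c + t)) (\<lambda>t. (norm (u t))\<^sup>2)"
    by (subst distr[symmetric])
  then have "integrable lebesgue (\<lambda>t. (norm (u (c + t)))\<^sup>2)"
    by (rule integrable_distr[OF T])
  with sm show "(\<lambda>t. u (c + t)) \<in> L2 UNIV" by (simp add: L2_def lebesgue_on_UNIV_eq)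
  have "(\<integral>t. (norm (u t))\<^sup>2 \<partial>lebesgue) = (\<integral>t. (norm (u t))\<^sup>2 \<partial>distr lebesgue lebesgue (\<lambda>t. c + t))"
    by (subst distr[symmetric]) (rule refl)
  also have "\<dots> = (\<integral>t. (norm (u (c + t)))\<^sup>2 \<partial>lebesgue)"
    using int by (intro integral_distr[OF T]) simp
  finally show "norm_L2 UNIV (\<lambda>t. u (c + t)) = norm_L2 UNIV u"
    by (simp add: norm_L2_def lebesgue_on_UNIV_eq)
qed

section \<open>Uniform boundedness\<close>

text \<open>From 2b = (a + b) - (a - b). It supplies the choice of sign in the proof of uniform
  boundedness.\<close>

lemma norm_add_or_diff_ge:
  fixes a b :: "'a::real_normed_vector"
  shows "norm b \<le> norm (a + b) \<or> norm b \<le> norm (a - b)"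
proof (rule ccontr)
  assume "\<not> ?thesis"
  then have "norm (a + b) < norm b" "norm (a - b) < norm b" by auto
  moreover have "2 * norm b \<le> norm (a + b) + norm (a - b)"
    using norm_triangle_ineq4[of "a + b" "a - b"] by (simp flip: scaleR_2)
  ultimately show False by linarith
qed

text \<open>Sokal's elementary proof, which needs completeness of the seminorm but no Baire category
  argument; the seminorm may vanish on nonzero vectors.\<close>

lemma uniform_boundedness:
  fixes V :: "'v::real_vector set" and N :: "'v \<Rightarrow> real"
    and Q :: "'i \<Rightarrow> 'v \<Rightarrow> 'w::real_normed_vector"
  assumes V: "subspace V"
    and N_nonneg: "\<And>x. 0 \<le> N x"
    and N_add: "\<And>x y. x \<in> V \<Longrightarrow> y \<in> V \<Longrightarrow> N (x + y) \<le> N x + N y"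
    and N_scale: "\<And>c x. N (c *\<^sub>R x) = \<bar>c\<bar> * N x"
    and N_complete: "\<And>v c. (\<And>k. v k \<in> V) \<Longrightarrow> (\<And>k. N (v (Suc k) - v k) \<le> c k) \<Longrightarrow> summable c \<Longrightarrow>
      \<exists>x\<in>V. (\<lambda>k. N (v k - x)) \<longlonglongrightarrow> 0"
    and Q_add: "\<And>i x y. x \<in> V \<Longrightarrow> y \<in> V \<Longrightarrow> Q i (x + y) = Q i x + Q i y"
    and Q_scale: "\<And>i c x. x \<in> V \<Longrightarrow> Q i (c *\<^sub>R x) = c *\<^sub>R Q i x"
    and Q_bounded: "\<And>i. \<exists>K. \<forall>x\<in>V. norm (Q i x) \<le> K * N x"
    and pointwise: "\<And>x. x \<in> V \<Longrightarrow> \<exists>K. \<forall>i. norm (Q i x) \<le> K"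
  shows "\<exists>K\<ge>0. \<forall>i. \<forall>x\<in>V. norm (Q i x) \<le> K * N x"
proof (rule ccontr)
  assume no: "\<not> ?thesis"
  have N_minus: "N (- x) = N x" for x using N_scale[of "-1" x] by simp
  have N_diff_commute: "N (x - y) = N (y - x)" for x y using N_minus[of "x - y"] by simp
  have Q_minus: "x \<in> V \<Longrightarrow> Q i (- x) = - Q i x" for i x using Q_scale[of x i "-1"] by simp
  have Q_diff: "x \<in> V \<Longrightarrow> y \<in> V \<Longrightarrow> Q i (x - y) = Q i x - Q i y" for i x y
    using Q_add[of x "- y" i] subspace_neg[OF V, of y] Q_minus by simp
  define B where "B = (\<lambda>i. {norm (Q i x) |x. x \<in> V \<and> N x \<le> 1})"
  \<comment> \<open>\<open>n i\<close> is the operator norm of \<open>Q i\<close> with respect to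
    the seminorm \<open>N\<close>.\<close>
  define n where "n = (\<lambda>i. Sup (B i))"
  have bdd: "bdd_above (B i)" for i
  proof -
    obtain K where K: "\<forall>x\<in>V. norm (Q i x) \<le> K * N x" using Q_bounded by blast
    have "norm (Q i x) \<le> \<bar>K\<bar>" if "x \<in> V" "N x \<le> 1" for x
    proof -
      have "norm (Q i x) \<le> K * N x" using K that by blast
      also have "\<dots> \<le> \<bar>K\<bar> * N x" using N_nonneg by (intro mult_right_mono) auto
      also have "\<dots> \<le> \<bar>K\<bar> * 1" using that by (intro mult_left_mono) auto
      finally show ?thesis by simp
    qed
    then show ?thesis unfolding B_def bdd_above_def by blast
  qed
  have V0: "0 \<in> V" by (rule subspace_0[OF V])
  have N0: "N 0 = 0" using N_scale[of 0 0] by simp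
  have ne: "norm (Q i 0) \<in> B i" for i unfolding B_def using V0 N0 by auto
  have n_nonneg: "0 \<le> n i" for i
    unfolding n_def using cSup_upper[OF ne bdd] norm_ge_zero order_trans by blast
  have n_ge: "norm (Q i x) \<le> n i * N x" if x: "x \<in> V" for i x
  proof (cases "N x = 0")
    case True
    \<comment> \<open>On the kernel of \<open>N\<close> no normalisation is possible, but
      \<open>Q_bounded\<close> makes \<open>Q i x\<close> vanish.\<close>
    then show ?thesis using Q_bounded[of i] x by auto
  next
    case False
    then have pos: "N x > 0" using N_nonneg[of x] by linarith
    have "norm (Q i ((1 / N x) *\<^sub>R x)) \<in> B i"
      unfolding B_def using pos subspace_scale[OF V x] N_scale by auto
    then have "norm (Q i ((1 / N x) *\<^sub>R x)) \<le> n i"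
      unfolding n_def by (rule cSup_upper) (rule bdd)
    then show ?thesis using pos by (simp add: Q_scale[OF x] field_simps)
  qed
  have large: "\<exists>i. K < n i" if "K \<ge> 0" for K
  proof (rule ccontr)
    assume "\<not> ?thesis"
    then have le: "n i \<le> K" for i by (auto simp: not_less)
    have "norm (Q i x) \<le> K * N x" if "x \<in> V" for i x
      using n_ge[OF that, of i] mult_right_mono[OF le N_nonneg, of i x] by linarith
    then show False using no that \<open>K \<ge> 0\<close> by blast
  qed
  have "\<exists>i y. 4 ^ k < n i \<and> y \<in> V \<and> N y \<le> 1 \<and> 2 / 3 * n i < norm (Q i y)" for k :: nat
  proof -
    obtain i where i: "4 ^ k < n i" using large[of "4 ^ k"] by auto
    have "0 < (4::real) ^ k" by simp
    then have "0 < n i" using i by linarith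
    then have "2 / 3 * n i < Sup (B i)" by (simp add: n_def)
    then obtain b where "b \<in> B i" "2 / 3 * n i < b" using less_cSupD ne by (metis empty_iff)
    then show ?thesis using i unfolding B_def by blast
  qed
  then obtain i y where iy: "\<And>k::nat. 4 ^ k < n (i k)" "\<And>k. y k \<in> V" "\<And>k. N (y k) \<le> 1"
    "\<And>k. 2 / 3 * n (i k) < norm (Q (i k) (y k))" by metis
  \<comment> \<open>With weights \<open>(1 / 3) ^ k\<close> all later steps together amount to at
    most half of the current one, which leaves 2/3 - 1/2 = 1/6 of \<open>n (i k)\<close> at scale
    \<open>(1 / 3) ^ k\<close>; operator norms above \<open>4 ^ k\<close> outgrow that
    scale.\<close>
  define z where "z = (\<lambda>k. (1 / 3) ^ k *\<^sub>R y k)"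
  have zV: "z k \<in> V" for k unfolding z_def by (intro subspace_scale[OF V] iy)
  have Nz: "N (z k) \<le> (1 / 3) ^ k" for k
    using iy(3)[of k] by (simp add: z_def N_scale mult_left_le)
  \<comment> \<open>The sign of each step is chosen so that \<open>Q (i k)\<close> of the new point
    is at least as large in norm as \<open>Q (i k) (z k)\<close>.\<close>
  define x where "x = rec_nat 0 (\<lambda>k x. if norm (Q (i k) (z k)) \<le> norm (Q (i k) (x + z k)) then x + z k else x - z k)"
  have xS: "x (Suc k) = (if norm (Q (i k) (z k)) \<le> norm (Q (i k) (x k + z k)) then x k + z k else x k - z k)" for k
    by (simp add: x_def)
  have xV: "x k \<in> V" for k
  proof (induction k)
    case 0
    then show ?case using V0 by (simp add: x_def)
  next
    case (Suc k)
    then show ?case unfolding xS using zV[of k] subspace_add[OF V] subspace_diff[OF V] by auto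
  qed
  have step: "N (x (Suc k) - x k) \<le> (1 / 3) ^ k" for k
    unfolding xS using Nz[of k] N_minus[of "z k"] by auto
  have big: "norm (Q (i k) (z k)) \<le> norm (Q (i k) (x (Suc k)))" for k
    unfolding xS using norm_add_or_diff_ge[of "Q (i k) (z k)" "Q (i k) (x k)"]
    by (auto simp: Q_add[OF xV zV] Q_diff[OF xV zV])
  have "summable (\<lambda>k. (1 / 3 :: real) ^ k)" by (rule summable_geometric) simp
  from N_complete[of x, OF xV step this] obtain l where l: "l \<in> V" "(\<lambda>k. N (x k - l)) \<longlonglongrightarrow> 0" by blast
  \<comment> \<open>The right-hand side is the sum of \<open>(1 / 3) ^ i\<close> over
    \<open>k < i \<le> k + m\<close>, the bounds of the steps in between.\<close>
  have dist: "N (x (Suc k) - x (Suc k + m)) \<le> ((1 / 3) ^ k - (1 / 3) ^ (k + m)) / 2" for k m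
  proof (induction m)
    case 0
    then show ?case using N0 by simp
  next
    case (Suc m)
    have "N (x (Suc k) - x (Suc k + Suc m)) \<le> N (x (Suc k) - x (Suc k + m)) + N (x (Suc k + m) - x (Suc k + Suc m))"
      using N_add[OF subspace_diff[OF V xV xV] subspace_diff[OF V xV xV], of "Suc k" "Suc k + m" "Suc k + m" "Suc k + Suc m"]
      by (simp del: add_Suc add_Suc_right)
    moreover have "N (x (Suc k + m) - x (Suc k + Suc m)) \<le> (1 / 3) ^ (Suc (k + m))"
      using step[of "Suc k + m"] by (simp add: N_diff_commute)
    moreover have "a \<le> (p - q / 3) / 2" if "a \<le> b + c" "c \<le> q / 3" "b \<le> (p - q) / 2" for a b c p q :: real
      using that by argo
    moreover have "(1 / 3 :: real) ^ Suc (k + m) = (1 / 3) ^ (k + m) / 3"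
      "(1 / 3 :: real) ^ (k + Suc m) = (1 / 3) ^ (k + m) / 3" by simp_all
    ultimately show ?case using Suc by metis
  qed
  have tail: "N (x (Suc k) - l) \<le> (1 / 3) ^ k / 2" for k
  proof (rule LIMSEQ_le_const)
    have "(\<lambda>m. N (x (m + Suc k) - l)) \<longlonglongrightarrow> 0" by (rule LIMSEQ_ignore_initial_segment[OF l(2)])
    from tendsto_add[OF tendsto_const this, of "(1 / 3) ^ k / 2"]
    show "(\<lambda>m. (1 / 3) ^ k / 2 + N (x (m + Suc k) - l)) \<longlonglongrightarrow> (1 / 3) ^ k / 2" by simp
    show "\<exists>M. \<forall>m\<ge>M. N (x (Suc k) - l) \<le> (1 / 3) ^ k / 2 + N (x (m + Suc k) - l)"
    proof (intro exI[of _ 0] allI impI)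
      fix m
      have "N (x (Suc k) - l) \<le> N (x (Suc k) - x (Suc k + m)) + N (x (Suc k + m) - l)"
        using N_add[OF subspace_diff[OF V xV xV] subspace_diff[OF V xV l(1)], of "Suc k" "Suc k + m" "Suc k + m"]
        by simp
      moreover have "((1 / 3) ^ k - (1 / 3) ^ (k + m)) / 2 \<le> (1 / 3 :: real) ^ k / 2" by simp
      ultimately show "N (x (Suc k) - l) \<le> (1 / 3) ^ k / 2 + N (x (m + Suc k) - l)"
        using dist[of k m] unfolding add.commute[of m "Suc k"] by argo
    qed
  qed
  obtain K where K: "\<And>i. norm (Q i l) \<le> K" using pointwise[OF l(1)] by blast
  have lower: "(4 / 3) ^ k / 6 \<le> K" for k
  proof -
    define p where "p = (1 / 3 :: real) ^ k"
    have p0: "0 \<le> p" by (simp add: p_def)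
    have "norm (Q (i k) (x (Suc k))) \<le> norm (Q (i k) l) + norm (Q (i k) (x (Suc k) - l))"
      using norm_triangle_ineq[of "Q (i k) l" "Q (i k) (x (Suc k)) - Q (i k) l"] by (simp add: Q_diff[OF xV l(1)])
    moreover have "norm (Q (i k) (x (Suc k) - l)) \<le> n (i k) * (p / 2)"
      using n_ge[OF subspace_diff[OF V xV l(1)]] mult_left_mono[OF tail n_nonneg] order_trans
      unfolding p_def by blast
    moreover have "norm (Q (i k) (z k)) = p * norm (Q (i k) (y k))"
      by (simp add: z_def Q_scale[OF iy(2)] p_def)
    moreover have "p * (2 / 3 * n (i k)) \<le> p * norm (Q (i k) (y k))"
      using iy(4)[of k] p0 by (intro mult_left_mono) auto
    moreover have "p * 4 ^ k \<le> p * n (i k)"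
      using iy(1)[of k] p0 by (intro mult_left_mono) auto
    moreover have "p * 4 ^ k = (4 / 3) ^ k" by (simp add: p_def flip: power_mult_distrib)
    ultimately have "norm (Q (i k) l) \<ge> p * (2 / 3 * n (i k)) - n (i k) * (p / 2)" "(4 / 3) ^ k \<le> p * n (i k)"
      using big[of k] by linarith+
    moreover have "p * (2 / 3 * n (i k)) - n (i k) * (p / 2) = p * n (i k) / 6" by (simp add: field_simps)
    ultimately show ?thesis using K[of "i k"] by argo
  qed
  obtain k where "6 * K < (4 / 3) ^ k" using real_arch_pow[of "4 / 3" "6 * K"] by auto
  then show False using lower[of k] by linarith
qed

lemma banach_telescoping_convergent:
  fixes v :: "nat \<Rightarrow> 'a::banach"
  assumes "\<And>k. norm (v (Suc k) - v k) \<le> c k" "summable c"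
  shows "convergent v"
proof -
  have "summable (\<lambda>k. v (Suc k) - v k)" 
    by (rule summable_comparison_test'[OF assms(2) assms(1)])
  then obtain l where "(\<lambda>n. \<Sum>k<n. v (Suc k) - v k) \<longlonglongrightarrow> l" using summable_LIMSEQ by blast
  then have "(\<lambda>n. v n - v 0) \<longlonglongrightarrow> l" by (simp only: sum_lessThan_telescope)
  from tendsto_add[OF this tendsto_const[of "v 0"]] show ?thesis by (auto simp: convergent_def)
qed

section \<open>Strongly continuous semigroups\<close>

lemma bounded_clinear_bounded_linear: "bounded_clinear f \<Longrightarrow> bounded_linear f"
  by (simp add: bounded_clinear_def)

text \<open>Otherwise there are times tending to 0 along which the operators are not uniformly
  bounded, although they converge pointwise to the identity; uniform boundedness excludes
  this.\<close>

lemma C0_semigroup_bounded_near_0: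
  fixes S :: "real \<Rightarrow> 'h::complex_banach \<Rightarrow> 'h"
  assumes S: "C0_semigroup S"
  obtains d M where "d > 0" "M \<ge> 1" "\<And>t x. 0 \<le> t \<Longrightarrow> t \<le> d \<Longrightarrow> norm (S t x) \<le> M * norm x"
proof (rule ccontr)
  assume no: "\<not> thesis"
  have lin: "bounded_linear (S t)" if "t \<ge> 0" for t
    using S that by (auto simp: C0_semigroup_def bounded_clinear_def)
  \<comment> \<open>\<open>real (Suc n)\<close> is tried as the bound and its reciprocal as the
    length of the interval.\<close>
  have "\<exists>t x. 0 \<le> t \<and> t \<le> 1 / real (Suc n) \<and> real (Suc n) * norm x < norm (S t x)" for n
  proof (rule ccontr)
    assume "\<not> ?thesis"
    then have "norm (S t x) \<le> real (Suc n) * norm x" if "0 \<le> t" "t \<le> 1 / real (Suc n)" for t x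
      using that by (meson not_less)
    with no show False using that[of "1 / real (Suc n)" "real (Suc n)"] by auto
  qed
  then obtain t x where tx: "\<And>n. 0 \<le> t n" "\<And>n. t n \<le> 1 / real (Suc n)"
    "\<And>n. real (Suc n) * norm (x n) < norm (S (t n) (x n))" by metis
  have t0: "t \<longlonglongrightarrow> 0"
    by (rule tendsto_sandwich[OF _ _ tendsto_const LIMSEQ_Suc[OF lim_1_over_n]])
      (use tx in \<open>auto intro: always_eventually\<close>)
  have lim: "(\<lambda>n. S (t n) y) \<longlonglongrightarrow> y" for y
  proof (rule metric_LIMSEQ_I)
    fix e :: real assume e: "e > 0"
    have "((\<lambda>t. S t y) \<longlongrightarrow> y) (at_right 0)" "S 0 y = y" using S by (auto simp: C0_semigroup_def)
    then obtain d where d: "d > 0" "\<And>s. 0 < s \<Longrightarrow> s < d \<Longrightarrow> dist (S s y) y < e"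
      using e by (auto dest!: tendstoD[where e = e] simp: eventually_at_right_field)
    have "\<forall>\<^sub>F n in sequentially. t n < d" using order_tendstoD(2)[OF t0 d(1)] .
    then show "\<exists>N. \<forall>n\<ge>N. dist (S (t n) y) y < e"
      using d(2) tx(1) \<open>S 0 y = y\<close> e unfolding eventually_sequentially
      by (metis dist_self less_eq_real_def)
  qed
  have "\<exists>K\<ge>0. \<forall>n. \<forall>y\<in>UNIV. norm (S (t n) y) \<le> K * norm y"
  proof (rule uniform_boundedness[of UNIV norm "\<lambda>n. S (t n)"])
    show "\<exists>x\<in>UNIV. (\<lambda>k. norm (v k - x)) \<longlonglongrightarrow> 0"
      if "\<And>k. norm (v (Suc k) - v k) \<le> c k" "summable c" for v :: "nat \<Rightarrow> 'h" and c
    proof -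
      have "convergent v" by (rule banach_telescoping_convergent[OF that])
      then obtain l where "v \<longlonglongrightarrow> l" by (auto simp: convergent_def)
      then show ?thesis by (auto simp: tendsto_norm_zero_iff LIM_zero_iff intro!: bexI[of _ l])
    qed
    show "S (t n) (a + b) = S (t n) a + S (t n) b" for n a b
      by (rule linear_add[OF bounded_linear.linear[OF lin[OF tx(1)]]])
    show "S (t n) (c *\<^sub>R a) = c *\<^sub>R S (t n) a" for n c a
      by (rule linear_scale[OF bounded_linear.linear[OF lin[OF tx(1)]]])
    show "\<exists>K. \<forall>y\<in>UNIV. norm (S (t n) y) \<le> K * norm y" for n
      using bounded_linear.bounded[OF lin[OF tx(1), of n]] by (auto simp: mult.commute)
    show "\<exists>K. \<forall>n. norm (S (t n) y) \<le> K" for y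
      using convergent_imp_Bseq[of "\<lambda>n. S (t n) y"] lim[of y] by (auto simp: convergent_def Bseq_def)
  qed (auto simp: norm_triangle_ineq)
  then obtain K where K: "K \<ge> 0" "\<And>n y. norm (S (t n) y) \<le> K * norm y" by blast
  obtain n where n: "K < real n" using reals_Archimedean2 by blast
  have "real (Suc n) * norm (x n) < K * norm (x n)" using tx(3)[of n] K(2)[of n "x n"] by linarith
  moreover have "K * norm (x n) \<le> real (Suc n) * norm (x n)"
    using n by (intro mult_right_mono) auto
  ultimately show False by linarith
qed

text \<open>Each step of length \<open>d\<close> costs a factor \<open>M\<close>; the extra factor
  in \<open>M ^ Suc n\<close> covers the remaining time, and \<open>M \<ge> 1\<close> makes
  different powers comparable.\<close>

lemma C0_semigroup_bounded:
  fixes S :: "real \<Rightarrow> 'h::complex_banach \<Rightarrow> 'h"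
  assumes S: "C0_semigroup S"
  obtains M where "M \<ge> 1" "\<And>t x. 0 \<le> t \<Longrightarrow> t \<le> T \<Longrightarrow> norm (S t x) \<le> M * norm x"
proof -
  obtain d M where d: "d > 0" and M: "M \<ge> 1" "\<And>t x. 0 \<le> t \<Longrightarrow> t \<le> d \<Longrightarrow> norm (S t x) \<le> M * norm x"
    using C0_semigroup_bounded_near_0[OF S] by metis
  have add: "S (s + t) x = S s (S t x)" if "s \<ge> 0" "t \<ge> 0" for s t x
    using S that by (simp add: C0_semigroup_def)
  have *: "norm (S t x) \<le> M ^ Suc n * norm x" if "0 \<le> t" "t \<le> real n * d" for n t x
    using that
  proof (induction n arbitrary: t x)
    case 0
    then show ?case using M(2)[of t x] d by simp
  next
    case (Suc n)
    show ?case
    proof (cases "t \<le> d")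
      case True
      have "norm (S t x) \<le> M * norm x" using M(2) True Suc.prems by blast
      also have "\<dots> \<le> M ^ Suc (Suc n) * norm x"
        using M(1) one_le_power[OF M(1), of "Suc n"] by (intro mult_right_mono) auto
      finally show ?thesis .
    next
      case False
      have "S t x = S d (S (t - d) x)" using add[of d "t - d" x] d False by simp
      then have "norm (S t x) \<le> M * norm (S (t - d) x)" using M(2)[of d] d by simp
      also have "\<dots> \<le> M * (M ^ Suc n * norm x)"
        using M(1) Suc.IH[of "t - d" x] False Suc.prems by (intro mult_left_mono) (auto simp: algebra_simps)
      finally show ?thesis by simp
    qed
  qed
  obtain n where n: "T / d < real n" using reals_Archimedean2 by blast
  then have "T \<le> real n * d" using d by (simp add: field_simps)
  then show thesis using *[of _ n] one_le_power[OF M(1), of "Suc n"] that[of "M ^ Suc n"] by auto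
qed

text \<open>Factoring out the operator at the earlier time,
  \<open>S t x - S s x = S s (S (t - s) x - x)\<close> for \<open>s \<le> t\<close>, reduces
  continuity from either side to right continuity at 0.\<close>

lemma C0_semigroup_continuous_on:
  fixes S :: "real \<Rightarrow> 'h::complex_banach \<Rightarrow> 'h"
  assumes S: "C0_semigroup S"
  shows "continuous_on {0..T} (\<lambda>t. S t x)"
proof -
  obtain M where M: "M \<ge> 1" "\<And>t x. 0 \<le> t \<Longrightarrow> t \<le> T \<Longrightarrow> norm (S t x) \<le> M * norm x"
    using C0_semigroup_bounded[OF S] by metis
  have lim: "((\<lambda>t. S t x) \<longlongrightarrow> x) (at_right 0)" "S 0 x = x" using S by (auto simp: C0_semigroup_def)
  have bound: "norm (S t x - S s x) \<le> M * norm (S (t - s) x - x)" if "0 \<le> s" "s \<le> t" "t \<le> T" for s t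
  proof -
    have "S t x = S s (S (t - s) x)"
      using S that unfolding C0_semigroup_def by (metis add.commute diff_add_cancel diff_ge_0_iff_ge)
    then have "S t x - S s x = S s (S (t - s) x - x)"
      using S that by (simp add: C0_semigroup_def bounded_clinear_def linear_diff[OF bounded_linear.linear])
    then show ?thesis using M(2)[of s "S (t - s) x - x"] that by simp
  qed
  show ?thesis
    unfolding continuous_on_iff
  proof (intro ballI allI impI)
    fix s e :: real assume s: "s \<in> {0..T}" and e: "e > 0"
    have "e / M > 0" using e M(1) by simp
    then obtain d where d: "d > 0" "\<And>h. 0 < h \<Longrightarrow> h < d \<Longrightarrow> dist (S h x) x < e / M"
      using lim(1) by (auto dest!: tendstoD[where e = "e / M"] simp: eventually_at_right_field)
    have d': "norm (S h x - x) < e / M" if "0 \<le> h" "h < d" for h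
      using d(2)[of h] that lim(2) \<open>e / M > 0\<close> by (cases "h = 0") (auto simp: dist_norm)
    have "dist (S t x) (S s x) < e" if t: "t \<in> {0..T}" "dist t s < d" for t
    proof (cases "s \<le> t")
      case True
      then have "norm (S t x - S s x) \<le> M * norm (S (t - s) x - x)" using bound s t by auto
      also have "\<dots> < M * (e / M)"
        using d'[of "t - s"] True t M(1) by (intro mult_strict_left_mono) (auto simp: dist_real_def)
      finally show ?thesis using M(1) by (simp add: dist_norm)
    next
      case False
      then have "norm (S s x - S t x) \<le> M * norm (S (s - t) x - x)" using bound s t by auto
      also have "\<dots> < M * (e / M)"
        using d'[of "s - t"] False t M(1) by (intro mult_strict_left_mono) (auto simp: dist_real_def)
      finally show ?thesis using M(1) by (simp add: dist_norm norm_minus_commute)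
    qed
    with d(1) show "\<exists>d>0. \<forall>t\<in>{0..T}. dist t s < d \<longrightarrow> dist (S t x) (S s x) < e" by blast
  qed
qed

section \<open>Generator and resolvent of a semigroup\<close>

lemma generator_tendsto:
  assumes "x \<in> generator_domain S"
  shows "((\<lambda>t. (S t x - x) /\<^sub>R t) \<longlongrightarrow> generator S x) (at_right 0)"
proof -
  obtain y where y: "((\<lambda>t. (S t x - x) /\<^sub>R t) \<longlongrightarrow> y) (at_right 0)"
    using assms by (auto simp: generator_domain_def)
  then have "generator S x = y" unfolding generator_def by (rule tendsto_Lim[rotated]) simp
  with y show ?thesis by simp
qed

lemma generator_semigroup_commute:
  fixes S :: "real \<Rightarrow> 'h::complex_banach \<Rightarrow> 'h"
  assumes S: "C0_semigroup S" and t: "t \<ge> 0" and x: "x \<in> generator_domain S"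
  shows "S t x \<in> generator_domain S" "generator S (S t x) = S t (generator S x)"
proof -
  have lin: "bounded_linear (S t)" using S t by (auto simp: C0_semigroup_def bounded_clinear_def)
  note linear = bounded_linear.linear[OF lin]
  have "((\<lambda>h. S t ((S h x - x) /\<^sub>R h)) \<longlongrightarrow> S t (generator S x)) (at_right 0)"
    by (rule bounded_linear.tendsto[OF lin generator_tendsto[OF x]])
  moreover have "\<forall>\<^sub>F h in at_right 0. S t ((S h x - x) /\<^sub>R h) = (S h (S t x) - S t x) /\<^sub>R h"
    unfolding eventually_at_filter
  proof (intro always_eventually allI impI)
    fix h :: real assume h: "h \<in> {0<..}"
    have "S t (S h x) = S h (S t x)"
      using S t h unfolding C0_semigroup_def by (metis add.commute greaterThan_iff less_imp_le)
    then show "S t ((S h x - x) /\<^sub>R h) = (S h (S t x) - S t x) /\<^sub>R h"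
      by (simp add: linear_scale[OF linear] linear_diff[OF linear])
  qed
  ultimately have *: "((\<lambda>h. (S h (S t x) - S t x) /\<^sub>R h) \<longlongrightarrow> S t (generator S x)) (at_right 0)"
    by (rule Lim_transform_eventually)
  then show "S t x \<in> generator_domain S" by (auto simp: generator_domain_def)
  show "generator S (S t x) = S t (generator S x)"
    unfolding generator_def[of S "S t x"] by (rule tendsto_Lim[OF _ *]) simp
qed

lemma gen_resolvent_inverse:
  assumes "\<beta> \<in> gen_resolvent_set S"
  shows "gen_resolvent S \<beta> x \<in> generator_domain S"
    and "\<beta> *\<^sub>C gen_resolvent S \<beta> x - generator S (gen_resolvent S \<beta> x) = x"
proof -
  have "bij_betw (\<lambda>x. \<beta> *\<^sub>C x - generator S x) (generator_domain S) UNIV"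
    using assms by (simp add: gen_resolvent_set_def)
  then have img: "x \<in> (\<lambda>x. \<beta> *\<^sub>C x - generator S x) ` generator_domain S"
    by (auto simp: bij_betw_def)
  show "gen_resolvent S \<beta> x \<in> generator_domain S"
    unfolding gen_resolvent_def by (rule inv_into_into[OF img])
  show "\<beta> *\<^sub>C gen_resolvent S \<beta> x - generator S (gen_resolvent S \<beta> x) = x"
    unfolding gen_resolvent_def using f_inv_into_f[OF img] .
qed

text \<open>\<open>S t (gen_resolvent S \<beta> x)\<close> solves the resolvent equation with
  right-hand side \<open>S t x\<close>, and solutions are unique. In the extrapolation norm
  \<open>S t\<close> therefore keeps its original bound.\<close>

lemma gen_resolvent_semigroup_commute:
  fixes S :: "real \<Rightarrow> 'h::complex_banach \<Rightarrow> 'h"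
  assumes S: "C0_semigroup S" and \<beta>: "\<beta> \<in> gen_resolvent_set S" and t: "t \<ge> 0"
  shows "gen_resolvent S \<beta> (S t x) = S t (gen_resolvent S \<beta> x)"
proof -
  let ?y = "gen_resolvent S \<beta> x"
  have clin: "bounded_clinear (S t)" using S t by (auto simp: C0_semigroup_def)
  note linear = bounded_linear.linear[OF bounded_clinear_bounded_linear[OF clin]]
  have y: "?y \<in> generator_domain S" "\<beta> *\<^sub>C ?y - generator S ?y = x"
    by (rule gen_resolvent_inverse[OF \<beta>])+
  have "\<beta> *\<^sub>C S t ?y - generator S (S t ?y) = S t (\<beta> *\<^sub>C ?y - generator S ?y)"
    using clin by (simp add: generator_semigroup_commute(2)[OF S t y(1)] linear_diff[OF linear] bounded_clinear_def)
  then have eq: "\<beta> *\<^sub>C S t ?y - generator S (S t ?y) = S t x" by (simp only: y(2))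
  have "inj_on (\<lambda>x. \<beta> *\<^sub>C x - generator S x) (generator_domain S)"
    using \<beta> by (simp add: gen_resolvent_set_def bij_betw_def)
  then have "gen_resolvent S \<beta> (\<beta> *\<^sub>C S t ?y - generator S (S t ?y)) = S t ?y"
    unfolding gen_resolvent_def
    by (rule inv_into_f_f[OF _ generator_semigroup_commute(1)[OF S t y(1), unfolded gen_resolvent_def]])
  then show ?thesis by (simp only: eq)
qed

section \<open>Extension of bounded operators from a dense range\<close>

lemma bounded_linear_scaleC: "bounded_linear (scaleC c :: 'a::complex_banach \<Rightarrow> 'a)"
proof (rule bounded_linear_intro[of _ "cmod c"])
  show "c *\<^sub>C (r *\<^sub>R x) = r *\<^sub>R c *\<^sub>C x" for r and x :: 'a
    by (simp flip: scaleC_of_real add: scaleC_scaleC mult.commute)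
qed (simp_all add: scaleC_add_right norm_scaleC)

lemma dense_sequence:
  assumes "closure (range j) = UNIV"
  obtains a where "(\<lambda>n. j (a n)) \<longlonglongrightarrow> (y :: 'e::metric_space)"
proof -
  have "y \<in> closure (range j)" using assms by simp
  then obtain b where b: "\<And>n. b n \<in> range j" "b \<longlonglongrightarrow> y" by (auto simp: closure_sequential)
  have "\<forall>n. \<exists>x. b n = j x" using b(1) by blast
  then obtain a where "\<And>n. b n = j (a n)" by metis
  then have "b = (\<lambda>n. j (a n))" by auto
  with b(2) show thesis using that by simp
qed

text \<open>The bound makes \<open>f\<close> factor through \<open>j\<close> as a Lipschitz map on
  \<open>range j\<close>, whatever preimage \<open>SOME\<close> picks. Such a map extends to the
  closure, and linearity and the bound pass to limits. The number \<open>\<bar>M\<bar> + 1\<close>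
  serves as a positive Lipschitz constant.\<close>

lemma dense_extension:
  fixes j :: "'h::complex_banach \<Rightarrow> 'e::complex_banach" and f :: "'h \<Rightarrow> 'f::complex_banach"
  assumes j_add: "\<And>x y. j (x + y) = j x + j y" and j_scale: "\<And>c x. j (c *\<^sub>C x) = c *\<^sub>C j x"
    and dense: "closure (range j) = UNIV"
    and f_add: "\<And>x y. f (x + y) = f x + f y" and f_scale: "\<And>c x. f (c *\<^sub>C x) = c *\<^sub>C f x"
    and bound: "\<And>x. norm (f x) \<le> M * norm (j x)"
  obtains E where "bounded_clinear E" "\<And>x. E (j x) = f x"
proof -
  have j_diff: "j (x - y) = j x - j y" for x y using j_add[of "x - y" y] by simp
  have f_diff: "f (x - y) = f x - f y" for x y using f_add[of "x - y" y] by simp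
  define g where "g = (\<lambda>y. f (SOME x. j x = y))"
  have dist_f: "dist (f x) (f y) \<le> M * dist (j x) (j y)" for x y
    using bound[of "x - y"] by (simp add: dist_norm f_diff j_diff)
  have g: "g (j x) = f x" for x
  proof -
    have "j (SOME z. j z = j x) = j x" by (rule someI[of _ x]) simp
    then show ?thesis using dist_f[of "SOME z. j z = j x" x] by (simp add: g_def)
  qed
  have "uniformly_continuous_on (range j) g"
    unfolding uniformly_continuous_on_def
  proof (intro allI impI)
    fix e :: real assume e: "e > 0"
    have "dist y' y < e" if "y' = g (j a)" "y = g (j b)" "dist (j a) (j b) < e / (\<bar>M\<bar> + 1)" for a b y y'
    proof -
      have "dist y' y \<le> M * dist (j a) (j b)" using that dist_f g by simp
      also have "\<dots> \<le> (\<bar>M\<bar> + 1) * dist (j a) (j b)" by (intro mult_right_mono) auto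
      also have "\<dots> < (\<bar>M\<bar> + 1) * (e / (\<bar>M\<bar> + 1))" using that(3) by (intro mult_strict_left_mono) auto
      finally show ?thesis by simp
    qed
    then show "\<exists>d>0. \<forall>x\<in>range j. \<forall>x'\<in>range j. dist x' x < d \<longrightarrow> dist (g x') (g x) < e"
      using e by (intro exI[of _ "e / (\<bar>M\<bar> + 1)"]) auto
  qed
  then obtain E where "uniformly_continuous_on (closure (range j)) E" "\<And>y. y \<in> range j \<Longrightarrow> g y = E y"
    by (rule uniformly_continuous_on_extension_on_closure) blast
  then have cont: "continuous_on UNIV E" and E: "E (j x) = f x" for x
    using uniformly_continuous_imp_continuous g by (auto simp: dense)
  have lim: "(\<lambda>n. E (a n)) \<longlonglongrightarrow> E y" if "a \<longlonglongrightarrow> y" for a and y :: 'e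
    using continuous_on_tendsto_compose[OF cont that] by simp
  have E_add: "E (y + z) = E y + E z" for y z
  proof -
    obtain a where a: "(\<lambda>n. j (a n)) \<longlonglongrightarrow> y" by (rule dense_sequence[OF dense])
    obtain b where b: "(\<lambda>n. j (b n)) \<longlonglongrightarrow> z" by (rule dense_sequence[OF dense])
    have "(\<lambda>n. E (j (a n) + j (b n))) \<longlonglongrightarrow> E (y + z)" by (intro lim tendsto_add a b)
    moreover have "E (j x + j x') = E (j x) + E (j x')" for x x' by (metis E f_add j_add)
    ultimately have "(\<lambda>n. E (j (a n)) + E (j (b n))) \<longlonglongrightarrow> E (y + z)" by simp
    then show ?thesis using tendsto_add[OF lim[OF a] lim[OF b]] LIMSEQ_unique by blast
  qed
  have E_scale: "E (c *\<^sub>C y) = c *\<^sub>C E y" for c y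
  proof -
    obtain a where a: "(\<lambda>n. j (a n)) \<longlonglongrightarrow> y" by (rule dense_sequence[OF dense])
    have "(\<lambda>n. E (c *\<^sub>C j (a n))) \<longlonglongrightarrow> E (c *\<^sub>C y)"
      by (intro lim bounded_linear.tendsto[OF bounded_linear_scaleC] a)
    moreover have "E (c *\<^sub>C j x) = c *\<^sub>C E (j x)" for x by (metis E f_scale j_scale)
    ultimately have "(\<lambda>n. c *\<^sub>C E (j (a n))) \<longlonglongrightarrow> E (c *\<^sub>C y)" by simp
    then show ?thesis
      using bounded_linear.tendsto[OF bounded_linear_scaleC lim[OF a]] LIMSEQ_unique by blast
  qed
  have E_norm: "norm (E y) \<le> norm y * M" for y
  proof -
    obtain a where a: "(\<lambda>n. j (a n)) \<longlonglongrightarrow> y" by (rule dense_sequence[OF dense])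
    show ?thesis
    proof (rule LIMSEQ_le)
      show "(\<lambda>n. norm (E (j (a n)))) \<longlonglongrightarrow> norm (E y)" by (intro tendsto_norm lim a)
      show "(\<lambda>n. norm (j (a n)) * M) \<longlonglongrightarrow> norm y * M" by (intro tendsto_intros a)
      show "\<exists>N. \<forall>n\<ge>N. norm (E (j (a n))) \<le> norm (j (a n)) * M"
        using bound E by (auto simp: mult.commute)
    qed
  qed
  have "bounded_linear E"
    by (rule bounded_linear_intro[OF E_add _ E_norm]) (simp flip: scaleC_of_real add: E_scale)
  then have "bounded_clinear E" using E_scale by (simp add: bounded_clinear_def)
  with E show thesis using that by blast
qed

lemma bounded_clinear_dense_eq:
  fixes j :: "'h \<Rightarrow> 'e::complex_banach" and E F :: "'e \<Rightarrow> 'f::complex_banach"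
  assumes dense: "closure (range j) = UNIV" and E: "bounded_clinear E" and F: "bounded_clinear F"
    and eq: "\<And>x. E (j x) = F (j x)"
  shows "E = F"
proof
  fix y
  obtain a where a: "(\<lambda>n. j (a n)) \<longlonglongrightarrow> y" by (rule dense_sequence[OF dense])
  have "(\<lambda>n. E (j (a n))) \<longlonglongrightarrow> E y" "(\<lambda>n. F (j (a n))) \<longlonglongrightarrow> F y"
    using bounded_linear.tendsto[OF bounded_clinear_bounded_linear a] E F by blast+
  then show "E y = F y" using LIMSEQ_unique by (simp only: eq) 
qed

section \<open>The input map of an admissible control operator\<close>

locale control_system =
  fixes S :: "real \<Rightarrow> 'h::complex_banach \<Rightarrow> 'h"
    and \<beta> :: complex
    and j :: "'h \<Rightarrow> 'e::complex_banach"
    and B :: "'u::complex_banach \<Rightarrow> 'e"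
  assumes semigroup: "C0_semigroup S"
    and extrapolation: "extrapolation_space S \<beta> j"
    and admissible: "admissible_control j S B"
begin

abbreviation G :: "'h \<Rightarrow> 'h" where "G \<equiv> gen_resolvent S \<beta>"
abbreviation E :: "real \<Rightarrow> 'e \<Rightarrow> 'e" where "E \<equiv> extended_semigroup j S"
abbreviation \<Phi> :: "real \<Rightarrow> (real \<Rightarrow> 'u) \<Rightarrow> 'e" where "\<Phi> \<equiv> input_integral j S B"

lemma resolvent_set: "\<beta> \<in> gen_resolvent_set S"
  and j_add: "j (x + y) = j x + j y"
  and j_scaleC: "j (c *\<^sub>C x) = c *\<^sub>C j x"
  and norm_j: "norm (j x) = norm (G x)"
  and dense: "closure (range j) = UNIV"
  using extrapolation by (auto simp: extrapolation_space_def)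

lemma G_bounded_linear: "bounded_linear G"
  using resolvent_set by (simp add: gen_resolvent_set_def bounded_clinear_def)

lemma S_bounded_clinear: "t \<ge> 0 \<Longrightarrow> bounded_clinear (S t)"
  using semigroup by (simp add: C0_semigroup_def)

lemma S_bounded_linear: "t \<ge> 0 \<Longrightarrow> bounded_linear (S t)"
  by (rule bounded_clinear_bounded_linear[OF S_bounded_clinear])

lemma S_add: "s \<ge> 0 \<Longrightarrow> t \<ge> 0 \<Longrightarrow> S (s + t) x = S s (S t x)"
  using semigroup by (simp add: C0_semigroup_def)

lemma j_bounded_linear: "bounded_linear j"
proof -
  obtain K where K: "\<And>x. norm (G x) \<le> norm x * K" using bounded_linear.bounded[OF G_bounded_linear] by blast
  show ?thesis
  proof (rule bounded_linear_intro[of _ K])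
    show "j (r *\<^sub>R x) = r *\<^sub>R j x" for r x by (metis j_scaleC scaleC_of_real)
  qed (use K in \<open>auto simp: j_add norm_j\<close>)
qed

text \<open>\<open>norm_j\<close> reduces this to injectivity of the resolvent, and \<open>x\<close>
  is recovered from \<open>G x\<close> by applying \<open>\<beta>\<close> minus the
  generator.\<close>

lemma j_inj: "inj j"
proof (rule injI)
  fix x y assume "j x = j y"
  then have "j (x - y) = 0" by (simp add: linear_diff[OF bounded_linear.linear[OF j_bounded_linear]])
  then have "G (x - y) = 0" using norm_j[of "x - y"] by simp
  then have "G x = G y" by (simp add: linear_diff[OF bounded_linear.linear[OF G_bounded_linear]])
  then show "x = y" using gen_resolvent_inverse(2)[OF resolvent_set] by metis
qed

text \<open>Existence comes from \<open>norm (j (S t x)) = norm (S t (G x))\<close>, so the bound of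
  \<open>S t\<close> survives in the weaker norm; uniqueness comes from density. Together they
  justify the \<open>THE\<close> in \<open>extended_semigroup\<close>.\<close>

lemma E_ex1:
  assumes t: "t \<ge> 0"
  shows "\<exists>!F. bounded_clinear F \<and> (\<forall>x. F (j x) = j (S t x))"
proof -
  obtain M where M: "\<And>s x. 0 \<le> s \<Longrightarrow> s \<le> t \<Longrightarrow> norm (S s x) \<le> M * norm x"
    using C0_semigroup_bounded[OF semigroup] by metis
  obtain F where F: "bounded_clinear F" "\<And>x. F (j x) = j (S t x)"
  proof (rule dense_extension[of j "\<lambda>x. j (S t x)" M])
    show "norm (j (S t x)) \<le> M * norm (j x)" for x
      using M[of t "G x"] t by (simp add: norm_j gen_resolvent_semigroup_commute[OF semigroup resolvent_set t])
    have "linear (S t)" by (rule bounded_linear.linear[OF S_bounded_linear[OF t]])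
    then show "j (S t (x + y)) = j (S t x) + j (S t y)" for x y by (simp add: linear_add j_add)
    show "j (S t (c *\<^sub>C x)) = c *\<^sub>C j (S t x)" for c x
      using S_bounded_clinear[OF t] by (simp add: bounded_clinear_def j_scaleC)
  qed (use j_add j_scaleC dense in auto)
  then show ?thesis by (metis bounded_clinear_dense_eq[OF dense])
qed

lemma E_bounded_clinear: "t \<ge> 0 \<Longrightarrow> bounded_clinear (E t)"
  and E_j: "t \<ge> 0 \<Longrightarrow> E t (j x) = j (S t x)"
  unfolding extended_semigroup_def using theI'[OF E_ex1] by blast+

lemma E_bounded_linear: "t \<ge> 0 \<Longrightarrow> bounded_linear (E t)"
  by (rule bounded_clinear_bounded_linear[OF E_bounded_clinear])

lemma E_add:
  assumes "s \<ge> 0" "t \<ge> 0"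
  shows "E (s + t) y = E s (E t y)"
proof -
  have "E (s + t) = (\<lambda>y. E s (E t y))"
  proof (rule bounded_clinear_dense_eq[OF dense])
    show "bounded_clinear (\<lambda>y. E s (E t y))"
      using E_bounded_clinear[OF assms(1)] E_bounded_clinear[OF assms(2)]
      by (auto simp: bounded_clinear_def intro: bounded_linear_compose)
  qed (use assms in \<open>simp_all add: E_bounded_clinear E_j S_add\<close>)
  then show ?thesis by simp
qed

lemma E_bound:
  obtains M where "M \<ge> 1" "\<And>t y. 0 \<le> t \<Longrightarrow> t \<le> T \<Longrightarrow> norm (E t y) \<le> M * norm y"
proof -
  obtain M where M: "M \<ge> 1" "\<And>t x. 0 \<le> t \<Longrightarrow> t \<le> T \<Longrightarrow> norm (S t x) \<le> M * norm x"
    using C0_semigroup_bounded[OF semigroup] by metis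
  have "norm (E t y) \<le> M * norm y" if t: "0 \<le> t" "t \<le> T" for t y
  proof -
    obtain a where a: "(\<lambda>n. j (a n)) \<longlonglongrightarrow> y" by (rule dense_sequence[OF dense])
    show ?thesis
    proof (rule LIMSEQ_le)
      show "(\<lambda>n. norm (E t (j (a n)))) \<longlonglongrightarrow> norm (E t y)"
        by (intro tendsto_norm bounded_linear.tendsto[OF E_bounded_linear] t a)
      show "(\<lambda>n. M * norm (j (a n))) \<longlonglongrightarrow> M * norm y" by (intro tendsto_intros a)
      show "\<exists>N. \<forall>n\<ge>N. norm (E t (j (a n))) \<le> M * norm (j (a n))"
        using M(2)[OF t] t by (simp add: E_j norm_j gen_resolvent_semigroup_commute[OF semigroup resolvent_set])
    qed
  qed
  with M(1) show thesis using that by blast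
qed

text \<open>Orbits of points in \<open>range j\<close> are continuous because they come from
  \<open>S\<close>; by the uniform bound, orbits of approximating points converge uniformly on
  \<open>{0..T}\<close>.\<close>

lemma E_continuous_on: "continuous_on {0..T} (\<lambda>t. E t y)"
proof -
  obtain M where M: "M \<ge> 1" "\<And>t y. 0 \<le> t \<Longrightarrow> t \<le> T \<Longrightarrow> norm (E t y) \<le> M * norm y"
    using E_bound by metis
  obtain a where a: "(\<lambda>n. j (a n)) \<longlonglongrightarrow> y" by (rule dense_sequence[OF dense])
  show ?thesis
  proof (rule uniform_limit_theorem[where f = "\<lambda>n t. E t (j (a n))" and F = sequentially])
    show "\<forall>\<^sub>F n in sequentially. continuous_on {0..T} (\<lambda>t. E t (j (a n)))"
    proof (intro always_eventually allI)
      fix n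
      have "continuous_on {0..T} (\<lambda>t. j (S t (a n)))"
        by (intro bounded_linear.continuous_on[OF j_bounded_linear] C0_semigroup_continuous_on[OF semigroup])
      then show "continuous_on {0..T} (\<lambda>t. E t (j (a n)))"
        by (rule continuous_on_eq) (simp add: E_j)
    qed
    show "uniform_limit {0..T} (\<lambda>n t. E t (j (a n))) (\<lambda>t. E t y) sequentially"
    proof (rule uniform_limitI)
      fix e :: real assume e: "e > 0"
      have "e / M > 0" using e M(1) by simp
      then have "\<forall>\<^sub>F n in sequentially. dist (j (a n)) y < e / M" by (rule tendstoD[OF a])
      then show "\<forall>\<^sub>F n in sequentially. \<forall>t\<in>{0..T}. dist (E t (j (a n))) (E t y) < e"
      proof eventually_elim
        case (elim n)
        show ?case
        proof
          fix t assume t: "t \<in> {0..T}"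
          have "dist (E t (j (a n))) (E t y) = norm (E t (j (a n) - y))"
            using t by (simp add: dist_norm linear_diff[OF bounded_linear.linear[OF E_bounded_linear]])
          also have "\<dots> \<le> M * dist (j (a n)) y" using M(2) t by (simp add: dist_norm)
          also have "\<dots> < M * (e / M)" using elim M(1) by (intro mult_strict_left_mono) auto
          finally show "dist (E t (j (a n))) (E t y) < e" using M(1) by simp
        qed
      qed
    qed
  qed simp
qed

text \<open>\<open>E s w - E t y\<close> splits into \<open>E s (w - y)\<close>, small by the
  uniform bound, and \<open>E s y - E t y\<close>, small by strong continuity. Joint continuity is
  what makes the input integrand strongly measurable.\<close>

lemma E_jointly_continuous: "continuous_on ({0..T} \<times> UNIV) (\<lambda>(t, y). E t y)"
proof -
  obtain M where M: "M \<ge> 1" "\<And>t y. 0 \<le> t \<Longrightarrow> t \<le> T \<Longrightarrow> norm (E t y) \<le> M * norm y"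
    using E_bound by metis
  show ?thesis
    unfolding continuous_on_def
  proof (intro ballI, clarify)
    fix t :: real and y :: 'e assume t: "t \<in> {0..T}"
    let ?F = "at (t, y) within {0..T} \<times> UNIV"
    have "((\<lambda>s. E s y) \<longlongrightarrow> E t y) (at t within {0..T})"
      using E_continuous_on[of T y] t by (simp add: continuous_on_def)
    have fst: "filterlim fst (nhds t) ?F"
      using tendsto_fst[OF tendsto_ident_at, of "(t, y)" "{0..T} \<times> UNIV"] by simp
    have snd: "(snd \<longlongrightarrow> y) ?F"
      using tendsto_snd[OF tendsto_ident_at, of "(t, y)" "{0..T} \<times> UNIV"] by simp
    have mem: "\<forall>\<^sub>F p in ?F. fst p \<in> {0..T}"
      unfolding eventually_at_filter by (intro always_eventually) auto
    have "((\<lambda>p. E (fst p) y) \<longlongrightarrow> E t y) ?F"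
      by (rule continuous_on_tendsto_compose[OF E_continuous_on fst t mem])
    moreover have "((\<lambda>p. E (fst p) (snd p) - E (fst p) y) \<longlongrightarrow> 0) ?F"
    proof (rule Lim_null_comparison)
      show "\<forall>\<^sub>F p in ?F. norm (E (fst p) (snd p) - E (fst p) y) \<le> M * norm (snd p - y)"
        using mem
      proof eventually_elim
        case (elim p)
        then show ?case
          using M(2)[of "fst p" "snd p - y"] by (simp add: linear_diff[OF bounded_linear.linear[OF E_bounded_linear]])
      qed
      have "((\<lambda>p. M * norm (snd p - y)) \<longlongrightarrow> M * norm (y - y)) ?F" by (intro tendsto_intros snd)
      then show "((\<lambda>p. M * norm (snd p - y)) \<longlongrightarrow> 0) ?F" by simp
    qed
    ultimately have "((\<lambda>p. E (fst p) y + (E (fst p) (snd p) - E (fst p) y)) \<longlongrightarrow> E t y + 0) ?F"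
      by (rule tendsto_add)
    then show "((\<lambda>(t, y). E t y) \<longlongrightarrow> E t y) ?F" by (simp add: case_prod_unfold)
  qed
qed

lemma B_bounded_linear: "bounded_linear B"
  using admissible by (simp add: admissible_control_def bounded_clinear_def)

definition integrand :: "real \<Rightarrow> (real \<Rightarrow> 'u) \<Rightarrow> real \<Rightarrow> 'e" where
  "integrand t u = (\<lambda>\<sigma>. E (t - \<sigma>) (B (u \<sigma>)))"

text \<open>The integrand is bounded by \<open>M * K * norm (u \<sigma>)\<close>, and one constant
  serves all \<open>t \<le> T\<close>. The estimate is in the extrapolation norm; the state norm is
  reached only through admissibility.\<close>

lemma input_integral_basic:
  assumes T: "0 \<le> T"
  shows "\<exists>C\<ge>0. \<forall>t\<in>{0..T}. \<forall>u\<in>L2 {0<..<t}. integrand t u integrable_on {0..t} \<and>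
    \<Phi> t u = integral {0..t} (integrand t u) \<and> norm (\<Phi> t u) \<le> C * norm_L2 {0<..<t} u"
proof -
  obtain M where M: "M \<ge> 1" "\<And>t y. 0 \<le> t \<Longrightarrow> t \<le> T \<Longrightarrow> norm (E t y) \<le> M * norm y"
    using E_bound by metis
  obtain K where K: "K > 0" "\<And>v. norm (B v) \<le> norm v * K"
    using bounded_linear.pos_bounded[OF B_bounded_linear] by blast
  show ?thesis
  proof (intro exI[of _ "M * K * sqrt T"] conjI ballI)
    show "0 \<le> M * K * sqrt T" using M(1) K(1) T by simp
    fix t and u :: "real \<Rightarrow> 'u" assume t: "t \<in> {0..T}" and u: "u \<in> L2 {0<..<t}"
    then have t0: "0 \<le> t" by simp
    let ?M = "lebesgue_on {0<..<t}"
    have J: "{0<..<t} \<in> sets lebesgue" by simp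
    have sm: "strongly_measurable ?M (integrand t u)"
      unfolding integrand_def
    proof (rule strongly_measurable_continuous_compose[where F = "\<lambda>\<sigma> v. E (t - \<sigma>) (B v)" and u = u])
      have "continuous_on ({0..t} \<times> UNIV) (\<lambda>p. (\<lambda>(s, y). E s y) (t - fst p, B (snd p)))"
        by (rule continuous_on_compose2[OF E_jointly_continuous[of t]])
          (auto intro!: continuous_intros bounded_linear.continuous_on[OF B_bounded_linear])
      then show "continuous_on ({0..t} \<times> UNIV) (\<lambda>(s, v). E (t - s) (B v))"
        by (simp add: case_prod_unfold)
      show "strongly_measurable ?M u" using u by (simp add: L2_def)
    qed
    have le: "norm (integrand t u \<sigma>) \<le> M * K * norm (u \<sigma>)" if "\<sigma> \<in> {0<..<t}" for \<sigma>
    proof -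
      have "norm (integrand t u \<sigma>) \<le> M * norm (B (u \<sigma>))"
        unfolding integrand_def using M(2)[of "t - \<sigma>"] t that by simp
      also have "\<dots> \<le> M * (norm (u \<sigma>) * K)" using M(1) K(2) by (intro mult_left_mono) auto
      finally show ?thesis by (simp add: mult_ac)
    qed
    have un: "integrable ?M (\<lambda>\<sigma>. M * K * norm (u \<sigma>))"
      using L2_integrable_norm(1)[OF t0 u] by simp
    have int: "integrable ?M (\<lambda>\<sigma>. norm (integrand t u \<sigma>))"
    proof (rule Bochner_Integration.integrable_bound[OF un strongly_measurable_norm[OF J sm]])
      show "AE \<sigma> in ?M. norm (norm (integrand t u \<sigma>)) \<le> norm (M * K * norm (u \<sigma>))"
      proof (rule AE_I2)
        fix \<sigma> assume "\<sigma> \<in> space ?M"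
        then show "norm (norm (integrand t u \<sigma>)) \<le> norm (M * K * norm (u \<sigma>))"
          using le[of \<sigma>] order_trans[OF le abs_ge_self] by simp
      qed
    qed
    note eq = strong_bochner_integral_eq_integral[OF sm int]
    show "integrand t u integrable_on {0..t}" by (rule eq(1))
    show \<Phi>: "\<Phi> t u = integral {0..t} (integrand t u)"
      unfolding input_integral_def using eq(2) by (simp add: integrand_def)
    have "norm (\<Phi> t u) \<le> (\<integral>\<sigma>. norm (integrand t u \<sigma>) \<partial>?M)" unfolding \<Phi> by (rule eq(3))
    also have "\<dots> \<le> (\<integral>\<sigma>. M * K * norm (u \<sigma>) \<partial>?M)"
      by (rule integral_mono[OF int un]) (use le in simp)
    also have "\<dots> = M * K * (\<integral>\<sigma>. norm (u \<sigma>) \<partial>?M)" by simp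
    also have "\<dots> \<le> M * K * (sqrt T * norm_L2 {0<..<t} u)"
    proof (intro mult_left_mono)
      have "(\<integral>\<sigma>. norm (u \<sigma>) \<partial>?M) \<le> sqrt t * norm_L2 {0<..<t} u"
        using L2_integrable_norm(2)[OF t0 u] by simp
      also have "\<dots> \<le> sqrt T * norm_L2 {0<..<t} u"
        using t by (intro mult_right_mono) auto
      finally show "(\<integral>\<sigma>. norm (u \<sigma>) \<partial>?M) \<le> sqrt T * norm_L2 {0<..<t} u" .
    qed (use M(1) K(1) in auto)
    finally show "norm (\<Phi> t u) \<le> M * K * sqrt T * norm_L2 {0<..<t} u" by (simp add: mult_ac)
  qed
qed

lemma integrand_integrable: "0 \<le> t \<Longrightarrow> u \<in> L2 {0<..<t} \<Longrightarrow> integrand t u integrable_on {0..t}"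
  and input_integral_eq: "0 \<le> t \<Longrightarrow> u \<in> L2 {0<..<t} \<Longrightarrow> \<Phi> t u = integral {0..t} (integrand t u)"
  using input_integral_basic[of t] by fastforce+

lemma input_integral_cong:
  assumes t: "0 \<le> t" and u: "u \<in> L2 {0<..<t}" and eq: "\<And>s. s \<in> {0<..<t} \<Longrightarrow> u s = v s"
  shows "\<Phi> t u = \<Phi> t v"
proof -
  have v: "v \<in> L2 {0<..<t}" using L2_cong(1)[of "{0<..<t}" u v] eq u by blast
  have "integral {0..t} (integrand t u) = integral {0..t} (integrand t v)"
    by (rule integral_spike[of "{0, t}"]) (use eq in \<open>auto simp: integrand_def\<close>)
  then show ?thesis using input_integral_eq t u v by simp
qed

lemma input_integral_linear:
  assumes t: "0 \<le> t" and u: "u \<in> L2 {0<..<t}" and v: "v \<in> L2 {0<..<t}"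
  shows "\<Phi> t (a *\<^sub>R u + b *\<^sub>R v) = a *\<^sub>R \<Phi> t u + b *\<^sub>R \<Phi> t v"
proof -
  have J: "{0<..<t} \<in> sets lebesgue" by simp
  have L: "a *\<^sub>R u + b *\<^sub>R v \<in> L2 {0<..<t}" by (intro L2_add L2_scaleR J u v)
  have "((\<lambda>\<sigma>. a *\<^sub>R integrand t u \<sigma> + b *\<^sub>R integrand t v \<sigma>) has_integral
      (a *\<^sub>R \<Phi> t u + b *\<^sub>R \<Phi> t v)) {0..t}"
    using integrand_integrable[OF t] input_integral_eq[OF t] u v
    by (intro has_integral_add has_integral_cmul) (auto simp: has_integral_integral)
  moreover have "a *\<^sub>R integrand t u \<sigma> + b *\<^sub>R integrand t v \<sigma> = integrand t (a *\<^sub>R u + b *\<^sub>R v) \<sigma>"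
    if "\<sigma> \<in> {0..t}" for \<sigma>
  proof -
    have lin: "linear (\<lambda>x. E (t - \<sigma>) (B x))"
      using that by (intro bounded_linear.linear bounded_linear_compose[OF E_bounded_linear B_bounded_linear]) simp
    show ?thesis
      using linear_add[OF lin, of "a *\<^sub>R u \<sigma>" "b *\<^sub>R v \<sigma>"] linear_scale[OF lin] by (simp add: integrand_def)
  qed
  ultimately have "(integrand t (a *\<^sub>R u + b *\<^sub>R v) has_integral (a *\<^sub>R \<Phi> t u + b *\<^sub>R \<Phi> t v)) {0..t}"
    by (rule has_integral_eq[rotated])
  then show ?thesis using input_integral_eq[OF t L] by (simp add: integral_unique)
qed

text \<open>Zero extension, translation on the whole line, restriction.\<close>

lemma L2_shift:
  assumes "0 \<le> s" "0 \<le> r" and u: "u \<in> L2 {0<..<s + r}"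
  shows "(\<lambda>\<sigma>. u (s + \<sigma>)) \<in> L2 {0<..<r}" "norm_L2 {0<..<r} (\<lambda>\<sigma>. u (s + \<sigma>)) \<le> norm_L2 {0<..<s + r} u"
proof -
  have J: "{0<..<s + r} \<in> sets lebesgue" "{0<..<r} \<in> sets lebesgue" by simp_all
  define z where "z = (\<lambda>t. if t \<in> {0<..<s + r} then u t else 0)"
  note z = L2_zero_extension[OF J(1) u, folded z_def]
  note zs = L2_translate[OF z(1), of s]
  note zr = L2_restrict[OF J(2) _ subset_UNIV zs(1)]
  have eq: "z (s + \<sigma>) = u (s + \<sigma>)" if "\<sigma> \<in> {0<..<r}" for \<sigma> using that assms(1) by (auto simp: z_def)
  note cong = L2_cong[of "{0<..<r}" "\<lambda>\<sigma>. z (s + \<sigma>)" "\<lambda>\<sigma>. u (s + \<sigma>)", OF eq]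
  show "(\<lambda>\<sigma>. u (s + \<sigma>)) \<in> L2 {0<..<r}" using cong(1) zr(1) by simp
  show "norm_L2 {0<..<r} (\<lambda>\<sigma>. u (s + \<sigma>)) \<le> norm_L2 {0<..<s + r} u"
    using cong(2) zr(2) zs(2) z(2) by simp
qed

text \<open>Input before time \<open>s\<close> is carried on by \<open>E r\<close>; later input acts
  as a control started at time 0. This identity transports bounds from one time to another.\<close>

lemma input_integral_split:
  assumes s: "0 \<le> s" and r: "0 \<le> r" and u: "u \<in> L2 {0<..<s + r}"
  shows "\<Phi> (s + r) u = E r (\<Phi> s u) + \<Phi> r (\<lambda>\<sigma>. u (s + \<sigma>))"
proof -
  have us: "u \<in> L2 {0<..<s}"
    by (rule L2_restrict(1)[OF _ _ _ u]) (use r in auto)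
  note ur = L2_shift(1)[OF s r u]
  have "0 \<le> s + r" using s r by simp
  note full = integrand_integrable[OF this u] input_integral_eq[OF this u]
  have "integral {0..s + r} (integrand (s + r) u) =
      integral {0..s} (integrand (s + r) u) + integral {s..s + r} (integrand (s + r) u)"
    by (rule Henstock_Kurzweil_Integration.integral_combine[symmetric]) (use s r full in auto)
  moreover have "integral {0..s} (integrand (s + r) u) = E r (\<Phi> s u)"
  proof -
    have "integral {0..s} (integrand (s + r) u) = integral {0..s} (E r \<circ> integrand s u)"
    proof (rule integral_cong)
      fix \<sigma> assume "\<sigma> \<in> {0..s}"
      then have "E (r + (s - \<sigma>)) (B (u \<sigma>)) = E r (E (s - \<sigma>) (B (u \<sigma>)))" using r by (intro E_add) auto
      then show "integrand (s + r) u \<sigma> = (E r \<circ> integrand s u) \<sigma>" by (simp add: integrand_def algebra_simps)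
    qed
    then show ?thesis
      using integral_linear[OF integrand_integrable[OF s us] E_bounded_linear[OF r]] input_integral_eq[OF s us] by simp
  qed
  moreover have "integral {s..s + r} (integrand (s + r) u) = \<Phi> r (\<lambda>\<sigma>. u (s + \<sigma>))"
  proof (rule integral_unique)
    have "integrand (s + r) u \<circ> (+) s = integrand r (\<lambda>\<sigma>. u (s + \<sigma>))"
      by (auto simp: integrand_def fun_eq_iff)
    moreover have "(integrand r (\<lambda>\<sigma>. u (s + \<sigma>)) has_integral \<Phi> r (\<lambda>\<sigma>. u (s + \<sigma>))) {0..r}"
      using integrand_integrable[OF r ur] input_integral_eq[OF r ur] by (simp add: has_integral_integral)
    ultimately show "(integrand (s + r) u has_integral \<Phi> r (\<lambda>\<sigma>. u (s + \<sigma>))) {s..s + r}"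
      using has_integral_shift_Icc_real[of "integrand (s + r) u" s _ 0 r] by (simp add: add.commute)
  qed
  ultimately show ?thesis using full(2) by simp
qed


text \<open>In substance a closed graph theorem: \<open>range\<close> only tells where the values
  lie, while the bound is in the state norm, stronger than the extrapolation norm in which the input
  integral has been estimated so far.\<close>

lemma input_integral_tau_bounded:
  assumes tau: "\<tau> > 0" and range: "\<forall>u\<in>L2 {0<..}. \<Phi> \<tau> u \<in> range j"
  obtains K where "K \<ge> 0"
    "\<And>u. u \<in> L2 {0<..<\<tau>} \<Longrightarrow> \<Phi> \<tau> u \<in> range j \<and> norm (input_map j S B \<tau> u) \<le> K * norm_L2 {0<..<\<tau>} u"
proof -
  let ?V = "L2 {0<..<\<tau>} :: (real \<Rightarrow> 'u) set"
  let ?N = "norm_L2 {0<..<\<tau>} :: (real \<Rightarrow> 'u) \<Rightarrow> real"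
  define F where "F = input_map j S B \<tau>"
  have J: "{0<..<\<tau>} \<in> sets lebesgue" "{0::real<..} \<in> sets lebesgue" by simp_all
  have in_range: "\<Phi> \<tau> u \<in> range j" if u: "u \<in> ?V" for u
  proof -
    \<comment> \<open>Admissibility speaks of controls on all of \<open>{0<..}\<close>; the integral
      up to \<open>\<tau>\<close> sees only their values before \<open>\<tau>\<close>.\<close>
    define z where "z = (\<lambda>t. if t \<in> {0<..<\<tau>} then u t else 0)"
    note z = L2_zero_extension[OF J(1) u, folded z_def]
    have "z \<in> L2 {0<..}" by (rule L2_restrict(1)[OF J(2) _ subset_UNIV z(1)]) simp
    then have "\<Phi> \<tau> z \<in> range j" using range by blast
    also have "\<Phi> \<tau> z = \<Phi> \<tau> u"
      by (rule input_integral_cong[symmetric]) (use tau u in \<open>auto simp: z_def\<close>)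
    finally show ?thesis .
  qed
  have jF: "j (F u) = \<Phi> \<tau> u" if "u \<in> ?V" for u
    unfolding F_def input_map_def by (rule f_inv_into_f[OF in_range[OF that]])
  have F_linear: "F (a *\<^sub>R u + b *\<^sub>R v) = a *\<^sub>R F u + b *\<^sub>R F v" if "u \<in> ?V" "v \<in> ?V" for a b u v
  proof -
    note lin = bounded_linear.linear[OF j_bounded_linear]
    have "a *\<^sub>R u + b *\<^sub>R v \<in> ?V" by (intro L2_add L2_scaleR J that)
    then have "j (F (a *\<^sub>R u + b *\<^sub>R v)) = j (a *\<^sub>R F u + b *\<^sub>R F v)"
      using input_integral_linear[of \<tau> u v a b] tau that by (simp add: jF linear_add[OF lin] linear_scale[OF lin])
    then show ?thesis using j_inj by (auto dest: injD)
  qed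
  have F_add: "F (u + v) = F u + F v" if "u \<in> ?V" "v \<in> ?V" for u v
    using F_linear[OF that, of 1 1] by simp
  have F_scale: "F (c *\<^sub>R u) = c *\<^sub>R F u" if "u \<in> ?V" for c u
    using F_linear[OF that that, of c 0] by simp
  obtain C where C: "C \<ge> 0" "\<And>u. u \<in> ?V \<Longrightarrow> norm (G (F u)) \<le> C * ?N u"
  proof -
    obtain C where "C \<ge> 0" "\<forall>t\<in>{0..\<tau>}. \<forall>u\<in>L2 {0<..<t}. norm (\<Phi> t u) \<le> C * norm_L2 {0<..<t} u"
      using input_integral_basic[of \<tau>] tau by fastforce
    then show thesis using that[of C] tau jF norm_j by (metis atLeastAtMost_iff less_imp_le order_refl)
  qed
  \<comment> \<open>\<open>F\<close> is the pointwise limit of the bounded operators \<open>Q n\<close>, which approximate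
    \<open>(\<beta>I - \<A>) G F\<close> by difference quotients: \<open>G F\<close> is bounded because \<open>\<parallel>G F u\<parallel> = \<parallel>\<Phi> u\<parallel>\<close>.\<close>
  define h where "h = (\<lambda>n. 1 / real (Suc n))"
  have h: "h n > 0" for n by (simp add: h_def)
  define R where "R = (\<lambda>n x. \<beta> *\<^sub>C x - (S (h n) x - x) /\<^sub>R h n)"
  have R: "bounded_linear (R n)" for n
  proof -
    have "bounded_linear (\<lambda>x. S (h n) x - x)"
      by (intro bounded_linear_sub S_bounded_linear bounded_linear_ident) (use h less_imp_le in blast)
    then have "bounded_linear (\<lambda>x. inverse (h n) *\<^sub>R (S (h n) x - x))"
      by (rule bounded_linear_compose[OF bounded_linear_scaleR_right])
    then show ?thesis unfolding R_def by (intro bounded_linear_sub bounded_linear_scaleC)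
  qed
  have RG: "bounded_linear (\<lambda>x. R n (G x))" for n
    by (rule bounded_linear_compose[OF R G_bounded_linear])
  define Q where "Q = (\<lambda>n u. R n (G (F u)))"
  have hlim: "filterlim h (at_right 0) sequentially"
    unfolding filterlim_at using LIMSEQ_Suc[OF lim_1_over_n] h by (auto simp: h_def)
  have Qlim: "(\<lambda>n. Q n u) \<longlonglongrightarrow> F u" for u
  proof -
    have "(\<lambda>n. (S (h n) (G (F u)) - G (F u)) /\<^sub>R h n) \<longlonglongrightarrow> generator S (G (F u))"
      by (rule filterlim_compose[OF generator_tendsto[OF gen_resolvent_inverse(1)[OF resolvent_set]] hlim])
    from tendsto_diff[OF tendsto_const this, of "\<beta> *\<^sub>C G (F u)"]
    show ?thesis unfolding Q_def R_def gen_resolvent_inverse(2)[OF resolvent_set] .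
  qed
  have "\<exists>K\<ge>0. \<forall>n. \<forall>u\<in>?V. norm (Q n u) \<le> K * ?N u"
  proof (rule uniform_boundedness)
    show "subspace ?V" by (rule subspace_L2[OF J(1)])
    show "?N (u + v) \<le> ?N u + ?N v" if "u \<in> ?V" "v \<in> ?V" for u v
      by (rule norm_L2_triangle[OF J(1) that])
    show "\<exists>x\<in>?V. (\<lambda>k. ?N (v k - x)) \<longlonglongrightarrow> 0"
      if "\<And>k. v k \<in> ?V" "\<And>k. ?N (v (Suc k) - v k) \<le> c k" "summable c" for v c
      by (rule L2_complete[OF _ that]) (use tau in auto)
    show "Q n (u + v) = Q n u + Q n v" if "u \<in> ?V" "v \<in> ?V" for n u v
      unfolding Q_def F_add[OF that] by (rule linear_add[OF bounded_linear.linear[OF RG]])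
    show "Q n (c *\<^sub>R u) = c *\<^sub>R Q n u" if "u \<in> ?V" for n c u
      unfolding Q_def F_scale[OF that] by (rule linear_scale[OF bounded_linear.linear[OF RG]])
    show "\<exists>K. \<forall>u\<in>?V. norm (Q n u) \<le> K * ?N u" for n
    proof -
      obtain K where K: "K > 0" "\<And>x. norm (R n x) \<le> norm x * K" using bounded_linear.pos_bounded[OF R] by blast
      have "norm (Q n u) \<le> K * C * ?N u" if "u \<in> ?V" for u
        using K(2)[of "G (F u)"] mult_right_mono[OF C(2)[OF that] less_imp_le[OF K(1)]] unfolding Q_def
        by (simp only: mult_ac)
      then show ?thesis by blast
    qed
    show "\<exists>K. \<forall>n. norm (Q n u) \<le> K" for u
      using convergent_imp_Bseq[of "\<lambda>n. Q n u"] Qlim[of u] by (auto simp: convergent_def Bseq_def)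
  qed (simp_all add: norm_L2_scaleR)
  then obtain K where K: "K \<ge> 0" "\<And>n u. u \<in> ?V \<Longrightarrow> norm (Q n u) \<le> K * ?N u" by blast
  have "norm (F u) \<le> K * ?N u" if "u \<in> ?V" for u
    by (rule LIMSEQ_le_const2[OF tendsto_norm[OF Qlim]]) (use K(2)[OF that] in blast)
  then show thesis using that[OF K(1)] in_range by (simp add: F_def)
qed

text \<open>Times up to the admissibility time \<open>\<tau>\<close> are reduced to
  \<open>\<tau>\<close> by delaying the control, longer ones by induction in steps of
  \<open>\<tau>\<close> with \<open>input_integral_split\<close>.\<close>

lemma input_map_bounded:
  assumes T: "0 \<le> T"
  shows "\<exists>K\<ge>0. \<forall>t\<in>{0..T}. \<forall>u\<in>L2 {0<..<t}.
    \<Phi> t u \<in> range j \<and> norm (input_map j S B t u) \<le> K * norm_L2 {0<..<t} u"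
proof -
  obtain \<tau> where tau: "\<tau> > 0" and range: "\<forall>u\<in>L2 {0<..}. \<Phi> \<tau> u \<in> range j"
    using admissible by (auto simp: admissible_control_def)
  obtain K where K: "K \<ge> 0" "\<And>u. u \<in> L2 {0<..<\<tau>} \<Longrightarrow>
      \<Phi> \<tau> u \<in> range j \<and> norm (input_map j S B \<tau> u) \<le> K * norm_L2 {0<..<\<tau>} u"
    by (rule input_integral_tau_bounded[OF tau range]) (rule that)
  have map_eq: "input_map j S B t u = y" if "\<Phi> t u = j y" for t u y
    unfolding input_map_def that by (rule inv_f_f[OF j_inj])
  have small: "\<Phi> t u \<in> range j \<and> norm (input_map j S B t u) \<le> K * norm_L2 {0<..<t} u"
    if t: "0 \<le> t" "t \<le> \<tau>" and u: "u \<in> L2 {0<..<t}" for t u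
  proof -
    define z where "z = (\<lambda>s. if s \<in> {0<..<t} then u s else 0)"
    note z = L2_zero_extension[OF _ u, folded z_def, simplified]
    \<comment> \<open>The delayed control: zero up to time \<open>\<tau> - t\<close>, then
      \<open>u\<close>. Running it for the full time \<open>\<tau>\<close> has the same effect as
      running \<open>u\<close> for time \<open>t\<close>.\<close>
    define w where "w = (\<lambda>s. z (t - \<tau> + s))"
    note w = L2_translate[OF z(1), of "t - \<tau>", folded w_def]
    note wr = L2_restrict[OF _ _ subset_UNIV w(1), of "{0<..<\<tau>}", simplified]
    note w0 = L2_restrict(1)[OF _ _ subset_UNIV w(1), of "{0<..<\<tau> - t}", simplified]
    have "\<Phi> ((\<tau> - t) + t) w = E t (\<Phi> (\<tau> - t) w) + \<Phi> t (\<lambda>s. w ((\<tau> - t) + s))"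
      by (rule input_integral_split) (use t wr in auto)
    moreover have "\<Phi> (\<tau> - t) w = \<Phi> (\<tau> - t) 0"
      by (rule input_integral_cong) (use t w0 in \<open>auto simp: w_def z_def\<close>)
    moreover have "\<Phi> (\<tau> - t) 0 = 0"
      using input_integral_linear[of "\<tau> - t" 0 0 0 0] t subspace_0[OF subspace_L2, of "{0<..<\<tau> - t}"] by simp
    moreover have "\<Phi> t (\<lambda>s. w ((\<tau> - t) + s)) = \<Phi> t u"
      by (rule input_integral_cong[symmetric]) (use t u in \<open>auto simp: w_def z_def\<close>)
    moreover have "E t 0 = 0" using linear_0[OF bounded_linear.linear[OF E_bounded_linear]] t by simp
    ultimately have eq: "\<Phi> \<tau> w = \<Phi> t u" by simp
    have "norm (input_map j S B t u) \<le> K * norm_L2 {0<..<\<tau>} w"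
      using K(2)[OF wr(1)] by (simp add: input_map_def eq)
    also have "\<dots> \<le> K * norm_L2 {0<..<t} u"
      using wr(2) w(2) z(2) K(1) by (intro mult_left_mono) auto
    finally show ?thesis using K(2)[OF wr(1)] eq by simp
  qed
  obtain M where M: "M \<ge> 1" "\<And>x. norm (S \<tau> x) \<le> M * norm x"
    using C0_semigroup_bounded[OF semigroup, of \<tau>] tau by (metis less_imp_le order_refl)
  have "\<exists>K\<ge>0. \<forall>t\<in>{0..real n * \<tau>}. \<forall>u\<in>L2 {0<..<t}.
    \<Phi> t u \<in> range j \<and> norm (input_map j S B t u) \<le> K * norm_L2 {0<..<t} u" for n
  proof (induction n)
    case 0
    then show ?case using small[of 0] K(1) tau by (intro exI[of _ K]) auto
  next
    case (Suc n)
    then obtain L where L: "L \<ge> 0" "\<And>t u. t \<in> {0..real n * \<tau>} \<Longrightarrow> u \<in> L2 {0<..<t} \<Longrightarrow>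
      \<Phi> t u \<in> range j \<and> norm (input_map j S B t u) \<le> L * norm_L2 {0<..<t} u" by blast
    show ?case
    \<comment> \<open>\<open>M * L\<close> bounds the effect of the input before
      \<open>t - \<tau>\<close>, carried on by \<open>S \<tau>\<close>; \<open>K\<close> bounds that
      of the last stretch of length \<open>\<tau>\<close>.\<close>
    proof (intro exI[of _ "M * L + K"] conjI ballI)
      have MLpos: "0 \<le> M * L" using M(1) L(1) by simp
      then show "0 \<le> M * L + K" using K(1) by simp
      fix t and u :: "real \<Rightarrow> 'u" assume t: "t \<in> {0..real (Suc n) * \<tau>}" and u: "u \<in> L2 {0<..<t}"
      have "\<Phi> t u \<in> range j \<and> norm (input_map j S B t u) \<le> (M * L + K) * norm_L2 {0<..<t} u"
      proof (cases "t \<le> \<tau>")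
        case True
        then have "\<Phi> t u \<in> range j" "norm (input_map j S B t u) \<le> K * norm_L2 {0<..<t} u"
          using small u t by auto
        moreover have "K * norm_L2 {0<..<t} u \<le> (M * L + K) * norm_L2 {0<..<t} u"
          using MLpos by (intro mult_right_mono) auto
        ultimately show ?thesis by linarith
      next
        case False
        define s where "s = t - \<tau>"
        have s: "0 \<le> s" "s \<in> {0..real n * \<tau>}" "t = s + \<tau>" using t False by (auto simp: s_def algebra_simps)
        have "{0<..<s} \<subseteq> {0<..<t}" using tau s(3) by auto
        then have us: "u \<in> L2 {0<..<s}" "norm_L2 {0<..<s} u \<le> norm_L2 {0<..<t} u"
          using L2_restrict[OF _ _ _ u, of "{0<..<s}"] by simp_all
        note ut = L2_shift[OF s(1) less_imp_le[OF tau] u[unfolded s(3)]]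
        define y where "y = input_map j S B s u"
        define v where "v = input_map j S B \<tau> (\<lambda>\<sigma>. u (s + \<sigma>))"
        have y: "\<Phi> s u = j y" "norm y \<le> L * norm_L2 {0<..<s} u"
          using L(2)[OF s(2) us(1)] by (auto simp: y_def input_map_def f_inv_into_f)
        have v: "\<Phi> \<tau> (\<lambda>\<sigma>. u (s + \<sigma>)) = j v" "norm v \<le> K * norm_L2 {0<..<\<tau>} (\<lambda>\<sigma>. u (s + \<sigma>))"
          using K(2)[OF ut(1)] by (auto simp: v_def input_map_def f_inv_into_f)
        \<comment> \<open>\<open>E \<tau>\<close> maps \<open>j y\<close> to
          \<open>j (S \<tau> y)\<close>, so the value stays in \<open>range j\<close>.\<close>
        have eq: "\<Phi> t u = j (S \<tau> y + v)"
          using input_integral_split[OF s(1) less_imp_le[OF tau] u[unfolded s(3)]] y(1) v(1) tau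
          by (simp add: s(3) E_j j_add)
        have "norm (S \<tau> y + v) \<le> M * norm y + norm v"
          using norm_triangle_ineq[of "S \<tau> y" v] M(2)[of y] by linarith
        also have "M * norm y \<le> M * (L * norm_L2 {0<..<t} u)"
          using M(1) y(2) mult_left_mono[OF us(2) L(1)] by (intro mult_left_mono) auto
        also have "norm v \<le> K * norm_L2 {0<..<t} u"
          using v(2) mult_left_mono[OF ut(2) K(1)] s(3) by simp
        finally show ?thesis using eq map_eq[OF eq] by (simp add: algebra_simps)
      qed
      then show "\<Phi> t u \<in> range j" "norm (input_map j S B t u) \<le> (M * L + K) * norm_L2 {0<..<t} u" by auto
    qed
  qed
  moreover obtain n where "T / \<tau> < real n" using reals_Archimedean2 by blast
  then have "T \<le> real n * \<tau>" using tau by (simp add: field_simps)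
  then have "{0..T} \<subseteq> {0..real n * \<tau>}" by auto
  ultimately show ?thesis by (meson subsetD)
qed

lemma input_map_linear:
  assumes t: "0 \<le> t" and u: "u \<in> L2 {0<..<t}" and v: "v \<in> L2 {0<..<t}"
  shows "input_map j S B t (a *\<^sub>R u + b *\<^sub>R v) = a *\<^sub>R input_map j S B t u + b *\<^sub>R input_map j S B t v"
proof -
  note lin = bounded_linear.linear[OF j_bounded_linear]
  have "\<Phi> t w \<in> range j" if "w \<in> L2 {0<..<t}" for w
    using input_map_bounded[OF t] t that by auto
  then have j: "j (input_map j S B t w) = \<Phi> t w" if "w \<in> L2 {0<..<t}" for w
    using that by (simp add: input_map_def f_inv_into_f)
  have "a *\<^sub>R u + b *\<^sub>R v \<in> L2 {0<..<t}" by (intro L2_add L2_scaleR u v) auto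
  then have "j (input_map j S B t (a *\<^sub>R u + b *\<^sub>R v)) = j (a *\<^sub>R input_map j S B t u + b *\<^sub>R input_map j S B t v)"
    using input_integral_linear[OF t u v] by (simp add: j u v linear_add[OF lin] linear_scale[OF lin])
  then show ?thesis using j_inj by (auto dest: injD)
qed

end

section \<open>The seminorm of the space of state-control pairs\<close>

lemma norm_le_Sup_norm:
  fixes x :: "real \<Rightarrow> 'a::real_normed_vector"
  assumes "continuous_on {0..T} x" "t \<in> {0..T}"
  shows "norm (x t) \<le> (SUP t\<in>{0..T}. norm (x t))"
proof (rule cSUP_upper[OF assms(2)])
  have "compact ((\<lambda>t. norm (x t)) ` {0..T})"
    by (intro compact_continuous_image continuous_on_norm assms compact_Icc)
  then show "bdd_above ((\<lambda>t. norm (x t)) ` {0..T})" by (intro bounded_imp_bdd_above compact_imp_bounded)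
qed

lemma subspace_space_X: "subspace (space_X T :: ((real \<Rightarrow> 'h::real_normed_vector) \<times> (real \<Rightarrow> 'u::real_normed_vector)) set)"
proof -
  have J: "{0<..<T} \<in> sets lebesgue" by simp
  show ?thesis
    unfolding subspace_def space_X_def
    by (auto simp: zero_prod_def plus_fun_def scaleR_fun_def zero_fun_def intro!: continuous_intros
        L2_add[OF J, unfolded plus_fun_def] L2_scaleR[OF J, unfolded scaleR_fun_def]
        subspace_0[OF subspace_L2[OF J], unfolded zero_fun_def])
qed

lemma norm_X_scaleR:
  fixes z :: "(real \<Rightarrow> 'h::real_normed_vector) \<times> (real \<Rightarrow> 'u::real_normed_vector)"
  assumes T: "0 \<le> T" and z: "z \<in> space_X T"
  shows "norm_X T (c *\<^sub>R z) = \<bar>c\<bar> * norm_X T z"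
proof -
  have cont: "continuous_on {0..T} (fst z)" using z by (auto simp: space_X_def)
  have "(SUP t\<in>{0..T}. norm (fst (c *\<^sub>R z) t)) = \<bar>c\<bar> * (SUP t\<in>{0..T}. norm (fst z t))"
  proof (rule antisym)
    show "(SUP t\<in>{0..T}. norm (fst (c *\<^sub>R z) t)) \<le> \<bar>c\<bar> * (SUP t\<in>{0..T}. norm (fst z t))"
      by (rule cSUP_least) (use T norm_le_Sup_norm[OF cont] in \<open>auto intro!: mult_left_mono\<close>)
    have cont': "continuous_on {0..T} (fst (c *\<^sub>R z))"
      using cont by (auto simp: scaleR_fun_def intro!: continuous_intros)
    show "\<bar>c\<bar> * (SUP t\<in>{0..T}. norm (fst z t)) \<le> (SUP t\<in>{0..T}. norm (fst (c *\<^sub>R z) t))"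
    proof (cases "c = 0")
      case True
      then show ?thesis using T by (simp add: cSUP_const)
    next
      case False
      have "norm (fst z t) \<le> (SUP t\<in>{0..T}. norm (fst (c *\<^sub>R z) t)) / \<bar>c\<bar>" if "t \<in> {0..T}" for t
        using norm_le_Sup_norm[OF cont' that] False by (simp add: field_simps)
      then have "(SUP t\<in>{0..T}. norm (fst z t)) \<le> (SUP t\<in>{0..T}. norm (fst (c *\<^sub>R z) t)) / \<bar>c\<bar>"
        by (intro cSUP_least) (use T in auto)
      then show ?thesis using False by (simp add: field_simps)
    qed
  qed
  then show ?thesis by (simp add: norm_X_def norm_L2_scaleR distrib_left)
qed

lemma norm_X_triangle:
  fixes z y :: "(real \<Rightarrow> 'h::real_normed_vector) \<times> (real \<Rightarrow> 'u::real_normed_vector)"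
  assumes T: "0 \<le> T" and z: "z \<in> space_X T" and y: "y \<in> space_X T"
  shows "norm_X T (z + y) \<le> norm_X T z + norm_X T y"
proof -
  have cont: "continuous_on {0..T} (fst z)" "continuous_on {0..T} (fst y)"
    and L: "snd z \<in> L2 {0<..<T}" "snd y \<in> L2 {0<..<T}"
    using z y by (auto simp: space_X_def)
  have "(SUP t\<in>{0..T}. norm (fst (z + y) t)) \<le> (SUP t\<in>{0..T}. norm (fst z t)) + (SUP t\<in>{0..T}. norm (fst y t))"
  proof (rule cSUP_least)
    fix t assume t: "t \<in> {0..T}"
    have "norm (fst (z + y) t) \<le> norm (fst z t) + norm (fst y t)" by (simp add: norm_triangle_ineq)
    also have "\<dots> \<le> (SUP t\<in>{0..T}. norm (fst z t)) + (SUP t\<in>{0..T}. norm (fst y t))"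
      by (intro add_mono norm_le_Sup_norm cont t)
    finally show "norm (fst (z + y) t) \<le> (SUP t\<in>{0..T}. norm (fst z t)) + (SUP t\<in>{0..T}. norm (fst y t))" .
  qed (use T in auto)
  moreover have "norm_L2 {0<..<T} (snd (z + y)) \<le> norm_L2 {0<..<T} (snd z) + norm_L2 {0<..<T} (snd y)"
    using norm_L2_triangle[OF _ L] by simp
  ultimately show ?thesis by (simp add: norm_X_def)
qed

lemma norm_X_upper:
  assumes "z \<in> space_X T" "t \<in> {0..T}"
  shows "norm (fst z t) \<le> norm_X T z"
  using norm_le_Sup_norm[of T "fst z" t] assms norm_L2_nonneg[of "{0<..<T}" "snd z"]
  by (auto simp: norm_X_def space_X_def intro: add_increasing2)

lemma norm_L2_le_norm_X:
  assumes "0 \<le> T" "z \<in> space_X T"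
  shows "norm_L2 {0<..<T} (snd z) \<le> norm_X T z"
proof -
  have "0 \<le> norm (fst z 0)" by simp
  also have "\<dots> \<le> (SUP t\<in>{0..T}. norm (fst z t))"
    using assms by (intro norm_le_Sup_norm) (auto simp: space_X_def)
  finally show ?thesis by (simp add: norm_X_def)
qed

lemma norm_X_nonneg:
  assumes "0 \<le> T" "z \<in> space_X T"
  shows "0 \<le> norm_X T z"
  using norm_L2_le_norm_X[OF assms] norm_L2_nonneg order_trans by blast

lemma norm_X_le:
  assumes "0 \<le> T" "\<And>t. t \<in> {0..T} \<Longrightarrow> norm (fst z t) \<le> a" "norm_L2 {0<..<T} (snd z) \<le> b"
  shows "norm_X T z \<le> a + b"
proof -
  have "(SUP t\<in>{0..T}. norm (fst z t)) \<le> a" by (rule cSUP_least) (use assms in auto)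
  with assms(3) show ?thesis by (simp add: norm_X_def)
qed

lemma norm_X_minus_commute:
  assumes "0 \<le> T" "z \<in> space_X T" "y \<in> space_X T"
  shows "norm_X T (z - y) = norm_X T (y - z)"
  using norm_X_scaleR[OF assms(1) subspace_diff[OF subspace_space_X assms(3,2)], of "-1"] by simp

lemma norm_X_triangle_diff:
  assumes "0 \<le> T" "z \<in> space_X T" "y \<in> space_X T" "w \<in> space_X T"
  shows "norm_X T (z - w) \<le> norm_X T (z - y) + norm_X T (y - w)"
  using norm_X_triangle[OF assms(1) subspace_diff[OF subspace_space_X assms(2,3)]
      subspace_diff[OF subspace_space_X assms(3,4)]] by simp

lemma segment_eq: "(1 - s) *\<^sub>R z + s *\<^sub>R y - z = s *\<^sub>R (y - z)" for z y :: "'v::real_vector"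
  by (simp add: algebra_simps)

lemma norm_X_segment:
  assumes "0 \<le> T" "z \<in> space_X T" "y \<in> space_X T" "0 \<le> s"
  shows "norm_X T ((1 - s) *\<^sub>R z + s *\<^sub>R y - z) = s * norm_X T (y - z)"
  using norm_X_scaleR[OF assms(1) subspace_diff[OF subspace_space_X assms(3,2)], of s] assms(4)
  by (simp add: segment_eq)

section \<open>Local optimality and inf-stationarity\<close>

text \<open>The punctured neighbourhoods are nested, so they form a base of the infimum of their
  principal filters.\<close>

lemma eventually_nhds_within_X:
  "eventually P (nhds_within_X T K z) \<longleftrightarrow>
    (\<exists>r>0. \<forall>y\<in>K. 0 < norm_X T (y - z) \<and> norm_X T (y - z) < r \<longrightarrow> P y)"
proof -
  have "eventually P (nhds_within_X T K z) \<longleftrightarrow>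
    (\<exists>r\<in>{0<..}. eventually P (principal {y \<in> K. 0 < norm_X T (y - z) \<and> norm_X T (y - z) < r}))"
    unfolding nhds_within_X_def
  proof (rule eventually_INF_base)
    fix a b :: real assume "a \<in> {0<..}" "b \<in> {0<..}"
    then show "\<exists>x\<in>{0<..}. principal {y \<in> K. 0 < norm_X T (y - z) \<and> norm_X T (y - z) < x}
        \<le> inf (principal {y \<in> K. 0 < norm_X T (y - z) \<and> norm_X T (y - z) < a})
              (principal {y \<in> K. 0 < norm_X T (y - z) \<and> norm_X T (y - z) < b})"
      by (intro bexI[of _ "min a b"]) auto
  qed simp
  then show ?thesis by (auto simp: eventually_principal)
qed

text \<open>Clearing the denominator gives a form that combines with Lipschitz and convexity
  estimates of \<open>f\<close>. An isolated point satisfies it vacuously, in accordance with its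
  lower slope \<infinity>.\<close>

lemma inf_stationary_iff:
  "inf_stationary T f K z \<longleftrightarrow> z \<in> K \<and>
    (\<forall>e>0. \<exists>r>0. \<forall>y\<in>K. 0 < norm_X T (y - z) \<and> norm_X T (y - z) < r \<longrightarrow>
      f z - e * norm_X T (y - z) \<le> f y)"
proof -
  have "0 \<le> lower_slope T f K z \<longleftrightarrow>
    (\<forall>e>0. \<exists>r>0. \<forall>y\<in>K. 0 < norm_X T (y - z) \<and> norm_X T (y - z) < r \<longrightarrow>
      f z - e * norm_X T (y - z) \<le> f y)" (is "?l \<longleftrightarrow> ?r")
  proof
    assume ?l
    then have *: "\<forall>\<^sub>F y in nhds_within_X T K z. c < ereal ((f y - f z) / norm_X T (y - z))" if "c < 0" for c
      using that unfolding lower_slope_def le_Liminf_iff by blast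
    show ?r
    proof (intro allI impI)
      fix e :: real assume "e > 0"
      then have "\<forall>\<^sub>F y in nhds_within_X T K z. ereal (- e) < ereal ((f y - f z) / norm_X T (y - z))"
        by (intro *) simp
      then obtain r where "r > 0" "\<And>y. y \<in> K \<Longrightarrow> 0 < norm_X T (y - z) \<Longrightarrow> norm_X T (y - z) < r \<Longrightarrow>
          - e < (f y - f z) / norm_X T (y - z)"
        unfolding eventually_nhds_within_X by auto
      then show "\<exists>r>0. \<forall>y\<in>K. 0 < norm_X T (y - z) \<and> norm_X T (y - z) < r \<longrightarrow> f z - e * norm_X T (y - z) \<le> f y"
        by (intro exI[of _ r]) (force simp: field_simps)
    qed
  next
    assume r: ?r
    show ?l
      unfolding lower_slope_def le_Liminf_iff
    proof (intro allI impI)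
      fix c :: ereal assume c: "c < 0"
      obtain e :: real where e: "e > 0" "c < ereal (- e)"
      proof (cases c)
        case (real q)
        \<comment> \<open>Halving leaves a strict gap between \<open>c\<close> and the non-strict
          slope bound obtained with \<open>e\<close>.\<close>
        then show thesis using c that[of "- q / 2"] by simp
      next
        case MInf
        then show thesis using that[of 1] by simp
      qed (use c in simp)
      obtain r where r: "r > 0" "\<And>y. y \<in> K \<Longrightarrow> 0 < norm_X T (y - z) \<Longrightarrow> norm_X T (y - z) < r \<Longrightarrow>
          f z - e * norm_X T (y - z) \<le> f y"
        using r e(1) by blast
      show "\<forall>\<^sub>F y in nhds_within_X T K z. c < ereal ((f y - f z) / norm_X T (y - z))"
        unfolding eventually_nhds_within_X
      proof (intro exI[of _ r] conjI r(1) ballI impI)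
        fix y assume y: "y \<in> K" "0 < norm_X T (y - z) \<and> norm_X T (y - z) < r"
        then have "f z - e * norm_X T (y - z) \<le> f y" using r(2) by blast
        then have "- e \<le> (f y - f z) / norm_X T (y - z)" using y by (simp add: field_simps)
        then have "ereal (- e) \<le> ereal ((f y - f z) / norm_X T (y - z))" by simp
        with e(2) show "c < ereal ((f y - f z) / norm_X T (y - z))" by (rule order_less_le_trans)
      qed
    qed
  qed
  then show ?thesis by (simp add: inf_stationary_def)
qed

text \<open>Towards a better point \<open>y\<close> a convex function falls, measured from
  \<open>z\<close>, at least at the rate \<open>(g z - g y) / norm_X T (y - z)\<close>, arbitrarily
  close to \<open>z\<close>; this contradicts stationarity. \<open>null\<close> excludes a better
  point at distance zero.\<close>

lemma convex_on_global:
  fixes K :: "((real \<Rightarrow> 'h::real_normed_vector) \<times> (real \<Rightarrow> 'u::real_normed_vector)) set"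
  assumes T: "0 \<le> T" and K: "K \<subseteq> space_X T" and g: "convex_on K g"
    and null: "\<And>y z. y \<in> K \<Longrightarrow> z \<in> K \<Longrightarrow> norm_X T (y - z) = 0 \<Longrightarrow> g y = g z"
  shows "local_opt T g K z \<longleftrightarrow> global_opt g K z" "inf_stationary T g K z \<longleftrightarrow> global_opt g K z"
proof -
  have conv: "convex K" using g by (rule convex_on_imp_convex)
  have global_imp: "inf_stationary T g K z" "local_opt T g K z" if "global_opt g K z"
  proof -
    have le: "g z \<le> g y" if "y \<in> K" for y using \<open>global_opt g K z\<close> that by (simp add: global_opt_def)
    have "z \<in> K" using that by (simp add: global_opt_def)
    then show "local_opt T g K z" using le by (auto simp: local_opt_def intro: exI[of _ 1])
    have "g z - e * norm_X T (y - z) \<le> g y" if "y \<in> K" "e > 0" "0 < norm_X T (y - z)" for y e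
      using le[OF that(1)] mult_pos_pos[OF that(2,3)] by linarith
    then show "inf_stationary T g K z"
      unfolding inf_stationary_iff using \<open>z \<in> K\<close> by (auto intro!: exI[of _ 1])
  qed
  have local_imp: "inf_stationary T g K z" if "local_opt T g K z"
  proof -
    obtain r where "z \<in> K" "r > 0" and r: "\<And>y. y \<in> K \<Longrightarrow> norm_X T (y - z) < r \<Longrightarrow> g z \<le> g y"
      using \<open>local_opt T g K z\<close> by (auto simp: local_opt_def)
    have "g z - e * norm_X T (y - z) \<le> g y"
      if "y \<in> K" "e > 0" "0 < norm_X T (y - z)" "norm_X T (y - z) < r" for y e
      using r[OF that(1,4)] mult_pos_pos[OF that(2,3)] by linarith
    then show ?thesis
      unfolding inf_stationary_iff using \<open>z \<in> K\<close> \<open>r > 0\<close> by (auto intro!: exI[of _ r])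
  qed
  have stat_imp: "global_opt g K z" if st: "inf_stationary T g K z"
  proof -
    have z: "z \<in> K" using st by (simp add: inf_stationary_iff)
    have "g z \<le> g y" if y: "y \<in> K" for y
    proof (rule ccontr)
      assume "\<not> g z \<le> g y"
      then have less: "g y < g z" by simp
      then have "norm_X T (y - z) \<noteq> 0" using null[OF y z] by auto
      then have pos: "norm_X T (y - z) > 0"
        using norm_X_nonneg[OF T subspace_diff[OF subspace_space_X subsetD[OF K y] subsetD[OF K z]]] by linarith
      \<comment> \<open>Half of the rate of decrease towards \<open>y\<close>.\<close>
      define e where "e = (g z - g y) / (2 * norm_X T (y - z))"
      have e: "e > 0" using less pos by (simp add: e_def)
      then obtain r where r: "r > 0" "\<And>w. w \<in> K \<Longrightarrow> 0 < norm_X T (w - z) \<Longrightarrow> norm_X T (w - z) < r \<Longrightarrow>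
          g z - e * norm_X T (w - z) \<le> g w"
        using st unfolding inf_stationary_iff by blast
      \<comment> \<open>The factor 2 keeps the point with parameter \<open>s\<close> strictly within
        distance \<open>r\<close> of \<open>z\<close>.\<close>
      define s where "s = min 1 (r / (2 * norm_X T (y - z)))"
      have s: "0 < s" "s \<le> 1" "s * norm_X T (y - z) < r"
        using r(1) pos by (auto simp: s_def min_def field_simps)
      define w where "w = (1 - s) *\<^sub>R z + s *\<^sub>R y"
      have wN: "norm_X T (w - z) = s * norm_X T (y - z)"
        unfolding w_def using T K y z s by (intro norm_X_segment) auto
      have "w \<in> K" unfolding w_def using convexD_alt[OF conv z y, of s] s by simp
      then have "g z - e * (s * norm_X T (y - z)) \<le> g w" using r(2)[of w] wN s pos by simp
      moreover have "g w \<le> (1 - s) * g z + s * g y"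
        unfolding w_def using convex_onD[OF g, of s z y] s y z by simp
      moreover have "e * (s * norm_X T (y - z)) = s * (g z - g y) / 2"
        using pos by (simp add: e_def field_simps)
      moreover have "(1 - s) * g z + s * g y = g z - s * (g z - g y)" by (simp add: algebra_simps)
      ultimately have "s * (g z - g y) \<le> s * (g z - g y) / 2" by linarith
      moreover have "s * (g z - g y) > 0" using s less by simp
      ultimately show False by simp
    qed
    with z show ?thesis by (simp add: global_opt_def)
  qed
  show "local_opt T g K z \<longleftrightarrow> global_opt g K z" "inf_stationary T g K z \<longleftrightarrow> global_opt g K z"
    using global_imp local_imp stat_imp by blast+
qed

section \<open>Complete exactness\<close>

lemma terminal_gap_nonneg [simp]: "0 \<le> terminal_gap T xT z"
  by (simp add: terminal_gap_def)

lemma terminal_gap_Lipschitz: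
  fixes z y :: "(real \<Rightarrow> 'h::real_normed_vector) \<times> (real \<Rightarrow> 'u::real_normed_vector)"
  assumes "0 \<le> T" "z \<in> space_X T" "y \<in> space_X T"
  shows "terminal_gap T xT z \<le> terminal_gap T xT y + norm_X T (z - y)"
proof -
  have "norm (fst z T - xT) \<le> norm (fst y T - xT) + norm (fst (z - y) T)"
    using norm_triangle_ineq[of "fst y T - xT" "fst z T - fst y T"] by simp
  then show ?thesis
    using norm_X_upper[OF subspace_diff[OF subspace_space_X assms(2,3)], of T] assms(1)
    by (simp add: terminal_gap_def)
qed

lemma convex_on_terminal_gap:
  assumes "convex A"
  shows "convex_on A (terminal_gap T xT)"
  unfolding convex_on_def
proof (intro conjI assms ballI allI impI)
  fix z y :: "(real \<Rightarrow> 'a) \<times> (real \<Rightarrow> 'b)" and u v :: real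
  assume uv: "0 \<le> u" "0 \<le> v" "u + v = 1"
  then have "xT = u *\<^sub>R xT + v *\<^sub>R xT" by (simp flip: scaleR_left_distrib)
  then have "fst (u *\<^sub>R z + v *\<^sub>R y) T - xT = u *\<^sub>R (fst z T - xT) + v *\<^sub>R (fst y T - xT)"
    by (simp add: algebra_simps)
  then show "terminal_gap T xT (u *\<^sub>R z + v *\<^sub>R y) \<le> u * terminal_gap T xT z + v * terminal_gap T xT y"
    using norm_triangle_ineq[of "u *\<^sub>R (fst z T - xT)" "v *\<^sub>R (fst y T - xT)"] uv
    by (simp add: terminal_gap_def)
qed

text \<open>\<open>penalty\<close> and \<open>f\<close> agree on the feasible set, which gives one
  inequality; \<open>proj\<close> gives the other.\<close>

lemma INF_penalty_eq:
  fixes f :: "'z \<Rightarrow> real"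
  assumes proj: "\<And>z. z \<in> A \<Longrightarrow> \<exists>y\<in>feasible_set \<phi> A. f y \<le> penalty f \<phi> c z"
  shows "(INF z\<in>feasible_set \<phi> A. ereal (f z)) = (INF z\<in>A. ereal (penalty f \<phi> c z))"
proof (rule antisym)
  show "(INF z\<in>feasible_set \<phi> A. ereal (f z)) \<le> (INF z\<in>A. ereal (penalty f \<phi> c z))"
    by (rule INF_mono) (use proj in auto)
  show "(INF z\<in>A. ereal (penalty f \<phi> c z)) \<le> (INF z\<in>feasible_set \<phi> A. ereal (f z))"
  proof (rule INF_mono)
    fix y assume "y \<in> feasible_set \<phi> A"
    then show "\<exists>z\<in>A. ereal (penalty f \<phi> c z) \<le> ereal (f y)"
      by (intro bexI[of _ y]) (simp_all add: feasible_set_def penalty_def)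
  qed
qed

text \<open>Both problems are convex, so local and stationary points are global ones and only the
  global solutions have to be matched. The threshold one above \<open>c0\<close> bounds the penalty
  function below by \<open>f z0 + terminal_gap T xT z\<close>, hence its minimisers have no
  gap.\<close>

lemma completely_exact_convex:
  fixes A :: "((real \<Rightarrow> 'h::real_normed_vector) \<times> (real \<Rightarrow> 'u::real_normed_vector)) set"
  assumes T: "0 \<le> T" and A: "A \<subseteq> space_X T" and f: "convex_on A f"
    and null: "\<And>y z. y \<in> A \<Longrightarrow> z \<in> A \<Longrightarrow> norm_X T (y - z) = 0 \<Longrightarrow> f y = f z"
    and opt: "global_opt f (feasible_set (terminal_gap T xT) A) z0"
    and c0: "0 \<le> c0" "\<And>z. z \<in> A \<Longrightarrow> f z0 \<le> f z + c0 * terminal_gap T xT z"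
  shows "completely_exact T f (terminal_gap T xT) A"
  unfolding completely_exact_def
proof (intro exI[of _ "c0 + 1"] conjI allI impI ballI)
  let ?\<phi> = "terminal_gap T xT"
  let ?\<Omega> = "feasible_set ?\<phi> A"
  show "0 \<le> c0 + 1" using c0 by simp
  fix c assume c: "c0 + 1 \<le> c"
  let ?P = "penalty f ?\<phi> c"
  have conv: "convex A" using f by (rule convex_on_imp_convex)
  have z0: "z0 \<in> A" "?\<phi> z0 = 0" and z0_le: "\<And>y. y \<in> ?\<Omega> \<Longrightarrow> f z0 \<le> f y"
    using opt by (auto simp: global_opt_def feasible_set_def)
  have low: "f z0 + ?\<phi> z \<le> ?P z" if "z \<in> A" for z
  proof -
    have "(c0 + 1) * ?\<phi> z \<le> c * ?\<phi> z" using c by (intro mult_right_mono) auto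
    then show ?thesis using c0(2)[OF that] by (simp add: penalty_def algebra_simps)
  qed
  have P\<Omega>: "?P z = f z" if "z \<in> ?\<Omega>" for z using that by (simp add: penalty_def feasible_set_def)
  have global: "global_opt f ?\<Omega> z \<longleftrightarrow> global_opt ?P A z" for z
  proof
    assume z: "global_opt f ?\<Omega> z"
    have "z0 \<in> ?\<Omega>" using z0 by (simp add: feasible_set_def)
    with z have "?P z = f z" "f z \<le> f z0" "z \<in> A"
      using P\<Omega>[of z] unfolding global_opt_def by (blast, blast, simp add: feasible_set_def)
    moreover have "f z0 \<le> ?P y" if "y \<in> A" for y
      using low[OF that] terminal_gap_nonneg[of T xT y] by linarith
    ultimately show "global_opt ?P A z" unfolding global_opt_def by force
  next
    assume z: "global_opt ?P A z"
    then have zA: "z \<in> A" and le: "?P z \<le> f z0"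
      using z0 by (auto simp: global_opt_def penalty_def)
    have "?\<phi> z = 0" using low[OF zA] le terminal_gap_nonneg[of T xT z] by linarith
    then have "z \<in> ?\<Omega>" using zA by (simp add: feasible_set_def)
    moreover have "f z \<le> f y" if "y \<in> ?\<Omega>" for y
      using le P\<Omega>[OF \<open>z \<in> ?\<Omega>\<close>] z0_le[OF that] by linarith
    ultimately show "global_opt f ?\<Omega> z" by (simp add: global_opt_def)
  qed
  then show "{z. global_opt f ?\<Omega> z} = {z. global_opt ?P A z}" by blast
  show "(INF z\<in>?\<Omega>. ereal (f z)) = (INF z\<in>A. ereal (?P z))"
  proof (rule INF_penalty_eq)
    fix z assume "z \<in> A"
    then have "f z0 \<le> ?P z" using low[of z] terminal_gap_nonneg[of T xT z] by linarith
    then show "\<exists>y\<in>?\<Omega>. f y \<le> ?P z" using z0 by (intro bexI[of _ z0]) (simp_all add: feasible_set_def)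
  qed
  have \<phi>_null: "?\<phi> y = ?\<phi> z" if "y \<in> A" "z \<in> A" "norm_X T (y - z) = 0" for y z
    using terminal_gap_Lipschitz[OF T, of y z xT] terminal_gap_Lipschitz[OF T, of z y xT] that A
      norm_X_minus_commute[OF T, of y z] by fastforce
  have c_pos: "0 \<le> c" using c c0(1) by simp
  have P_convex: "convex_on A ?P"
    unfolding penalty_def using c_pos
    by (intro convex_on_add f convex_on_cmul convex_on_terminal_gap conv)
  note PA = convex_on_global[OF T A P_convex]
  have "convex ?\<Omega>"
    unfolding convex_def
  proof (intro ballI allI impI)
    fix x y u v assume xy: "x \<in> ?\<Omega>" "y \<in> ?\<Omega>" and uv: "0 \<le> u" "0 \<le> v" "u + v = (1::real)"
    have "?\<phi> (u *\<^sub>R x + v *\<^sub>R y) \<le> u * ?\<phi> x + v * ?\<phi> y"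
      using convex_on_terminal_gap[OF conv, of T xT] xy uv unfolding convex_on_def feasible_set_def by blast
    moreover have "u *\<^sub>R x + v *\<^sub>R y \<in> A"
      using convexD[OF conv _ _ uv] xy by (simp add: feasible_set_def)
    ultimately show "u *\<^sub>R x + v *\<^sub>R y \<in> ?\<Omega>"
      using xy antisym[OF _ terminal_gap_nonneg, of T xT "u *\<^sub>R x + v *\<^sub>R y"] by (simp add: feasible_set_def)
  qed
  then have f\<Omega>: "convex_on ?\<Omega> f"
    using f by (rule convex_on_subset[rotated 2]) (auto simp: feasible_set_def)
  have \<Omega>X: "?\<Omega> \<subseteq> space_X T" using A by (auto simp: feasible_set_def)
  note \<Omega> = convex_on_global[OF T \<Omega>X f\<Omega>]
  fix z assume z: "z \<in> A"
  have nP: "?P y = ?P w" if "y \<in> A" "w \<in> A" "norm_X T (y - w) = 0" for y w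
    using null[OF that] \<phi>_null[OF that] by (simp add: penalty_def)
  have nf: "f y = f w" if "y \<in> ?\<Omega>" "w \<in> ?\<Omega>" "norm_X T (y - w) = 0" for y w
    using null that by (simp add: feasible_set_def)
  have gz: "global_opt f ?\<Omega> z \<longleftrightarrow> z \<in> ?\<Omega> \<and> global_opt f ?\<Omega> z" by (auto simp: global_opt_def)
  show "local_opt T ?P A z \<longleftrightarrow> z \<in> ?\<Omega> \<and> local_opt T f ?\<Omega> z"
    using PA(1)[OF nP] \<Omega>(1)[OF nf] global gz by blast
  show "inf_stationary T ?P A z \<longleftrightarrow> z \<in> ?\<Omega> \<and> inf_stationary T f ?\<Omega> z"
    using PA(2)[OF nP] \<Omega>(2)[OF nf] global gz by blast
qed

text \<open>Clarke's exact penalty principle: the error bound \<open>D\<close> for the distance to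
  the feasible set and the Lipschitz constant \<open>L\<close> make \<open>L * D\<close> the
  critical parameter. The added 1 in the threshold leaves a gain proportional to the gap, which
  excludes infeasible local minimisers and stationary points.\<close>

lemma completely_exact_Lipschitz:
  fixes A :: "((real \<Rightarrow> 'h::real_normed_vector) \<times> (real \<Rightarrow> 'u::real_normed_vector)) set"
  assumes T: "0 \<le> T" and A: "A \<subseteq> space_X T" and conv: "convex A"
    and L: "0 \<le> L" "\<And>y z. y \<in> A \<Longrightarrow> z \<in> A \<Longrightarrow> f y \<le> f z + L * norm_X T (y - z)"
    and D: "0 < D" "\<And>z. z \<in> A \<Longrightarrow>
      \<exists>y\<in>feasible_set (terminal_gap T xT) A. norm_X T (y - z) \<le> D * terminal_gap T xT z"
  shows "completely_exact T f (terminal_gap T xT) A"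
  unfolding completely_exact_def
proof (intro exI[of _ "L * D + 1"] conjI allI impI ballI)
  let ?\<phi> = "terminal_gap T xT"
  let ?\<Omega> = "feasible_set ?\<phi> A"
  show "0 \<le> L * D + 1" using L D by simp
  fix c assume c: "L * D + 1 \<le> c"
  let ?P = "penalty f ?\<phi> c"
  have P\<Omega>: "?P z = f z" if "z \<in> ?\<Omega>" for z using that by (simp add: penalty_def feasible_set_def)
  have \<Omega>A: "z \<in> A" if "z \<in> ?\<Omega>" for z using that by (simp add: feasible_set_def)
  have c\<phi>: "L * (D * ?\<phi> z) + ?\<phi> z \<le> c * ?\<phi> z" for z
    using mult_right_mono[OF c, of "?\<phi> z"] by (simp add: algebra_simps)
  have proj: "\<exists>y\<in>?\<Omega>. norm_X T (y - z) \<le> D * ?\<phi> z \<and> f y + ?\<phi> z \<le> ?P z" if z: "z \<in> A" for z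
  proof -
    obtain y where y: "y \<in> ?\<Omega>" "norm_X T (y - z) \<le> D * ?\<phi> z" using D(2)[OF z] by blast
    have "f y \<le> f z + L * norm_X T (y - z)" using L(2)[OF \<Omega>A[OF y(1)] z] .
    also have "\<dots> \<le> f z + L * (D * ?\<phi> z)" using mult_left_mono[OF y(2) L(1)] by simp
    finally show ?thesis using y c\<phi>[of z] by (intro bexI[of _ y]) (auto simp: penalty_def)
  qed
  then have proj_le: "\<exists>y\<in>?\<Omega>. f y \<le> ?P z" if "z \<in> A" for z
    using terminal_gap_nonneg[of T xT z] that by (meson add_increasing2 order_trans add_le_cancel_left le_add_same_cancel1)
  show "(INF z\<in>?\<Omega>. ereal (f z)) = (INF z\<in>A. ereal (?P z))"
    by (rule INF_penalty_eq) (rule proj_le)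
  have diff: "y - z \<in> space_X T" if "y \<in> A" "z \<in> A" for y z
    using that A by (intro subspace_diff[OF subspace_space_X]) auto
  \<comment> \<open>Moving the fraction \<open>s\<close> towards the nearby feasible point lowers
    the gap by at least \<open>s * ?\<phi> z\<close> and raises \<open>f\<close> by at most
    \<open>s * (L * (D * ?\<phi> z))\<close>. The net gain \<open>s * ?\<phi> z\<close> exceeds the
    length of the move divided by \<open>2 * D\<close>; the 2 makes this strict.\<close>
  have descent: "\<exists>y\<in>A. 0 < norm_X T (y - z) \<and> norm_X T (y - z) < r \<and> ?P y < ?P z - norm_X T (y - z) / (2 * D)"
    if z: "z \<in> A" "?\<phi> z \<noteq> 0" and r: "r > 0" for z r
  proof -
    have pos: "?\<phi> z > 0" using z(2) terminal_gap_nonneg[of T xT z] by linarith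
    obtain y where y: "y \<in> ?\<Omega>" "norm_X T (y - z) \<le> D * ?\<phi> z" using D(2)[OF z(1)] by blast
    have yA: "y \<in> A" "?\<phi> y = 0" using y(1) by (auto simp: feasible_set_def)
    have "?\<phi> z \<le> ?\<phi> y + norm_X T (z - y)"
      by (rule terminal_gap_Lipschitz[OF T]) (use A z yA in auto)
    then have N: "0 < norm_X T (y - z)"
      using pos yA norm_X_minus_commute[OF T subsetD[OF A z(1)] subsetD[OF A yA(1)]] by linarith
    define s where "s = min 1 (r / (2 * norm_X T (y - z)))"
    have s: "0 < s" "s \<le> 1" "s * norm_X T (y - z) < r"
      using r N by (auto simp: s_def min_def field_simps)
    define w where "w = (1 - s) *\<^sub>R z + s *\<^sub>R y"
    have wA: "w \<in> A" unfolding w_def using convexD_alt[OF conv z(1) yA(1), of s] s by simp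
    have wN: "norm_X T (w - z) = s * norm_X T (y - z)"
      unfolding w_def using T A yA(1) z(1) s by (intro norm_X_segment) auto
    have "?\<phi> w \<le> (1 - s) * ?\<phi> z + s * ?\<phi> y"
      unfolding w_def using convex_onD[OF convex_on_terminal_gap[OF conv, of T xT], of s z y] s yA(1) z(1) by simp
    then have "?\<phi> w \<le> (1 - s) * ?\<phi> z" using yA by simp
    then have "c * ?\<phi> w \<le> c * ((1 - s) * ?\<phi> z)"
      using c L(1) D(1) by (intro mult_left_mono) (auto intro: order_trans[OF _ c])
    moreover have "f w \<le> f z + L * (s * norm_X T (y - z))" using L(2)[OF wA z(1)] wN by simp
    moreover have "L * (s * norm_X T (y - z)) \<le> s * (L * (D * ?\<phi> z))"
      using mult_left_mono[OF mult_left_mono[OF y(2) L(1)], of s] s by (simp add: mult_ac)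
    moreover have "s * (L * (D * ?\<phi> z)) + s * ?\<phi> z \<le> s * (c * ?\<phi> z)"
      using mult_left_mono[OF c\<phi>[of z], of s] s by (simp add: distrib_left)
    ultimately have "?P w \<le> ?P z - s * ?\<phi> z" by (simp add: penalty_def algebra_simps)
    moreover have "norm_X T (w - z) / (2 * D) < s * ?\<phi> z"
    proof -
      have "norm_X T (w - z) \<le> s * (D * ?\<phi> z)" unfolding wN using y(2) s by (intro mult_left_mono) auto
      also have "\<dots> < s * ?\<phi> z * (2 * D)" using s pos D(1) by (simp add: field_simps)
      finally show ?thesis using D(1) by (simp add: field_simps)
    qed
    ultimately show ?thesis using wA wN s N by (intro bexI[of _ w]) auto
  qed
  have not_local: "?\<phi> z = 0" if loc: "local_opt T ?P A z" for z
  proof (rule ccontr)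
    assume \<phi>: "?\<phi> z \<noteq> 0"
    obtain r where r: "z \<in> A" "r > 0" "\<And>y. y \<in> A \<Longrightarrow> norm_X T (y - z) < r \<Longrightarrow> ?P z \<le> ?P y"
      using loc unfolding local_opt_def by blast
    obtain y where y: "y \<in> A" "0 < norm_X T (y - z)" "norm_X T (y - z) < r"
      "?P y < ?P z - norm_X T (y - z) / (2 * D)" using descent[OF r(1) \<phi> r(2)] by blast
    then have "0 < norm_X T (y - z) / (2 * D)" using D(1) by simp
    then show False using r(3)[OF y(1,3)] y(4) by linarith
  qed
  have not_stat: "?\<phi> z = 0" if st: "inf_stationary T ?P A z" for z
  proof (rule ccontr)
    assume \<phi>: "?\<phi> z \<noteq> 0"
    have "1 / (2 * D) > 0" using D(1) by simp
    then obtain r where r: "z \<in> A" "r > 0" "\<And>y. y \<in> A \<Longrightarrow> 0 < norm_X T (y - z) \<Longrightarrow> norm_X T (y - z) < r \<Longrightarrow>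
        ?P z - 1 / (2 * D) * norm_X T (y - z) \<le> ?P y"
      using st unfolding inf_stationary_iff by blast
    obtain y where y: "y \<in> A" "0 < norm_X T (y - z)" "norm_X T (y - z) < r"
      "?P y < ?P z - norm_X T (y - z) / (2 * D)" using descent[OF r(1) \<phi> r(2)] by blast
    then show False using r(3)[OF y(1,2,3)] by simp
  qed
  \<comment> \<open>The gap of \<open>y\<close> is at most its distance to the feasible
    \<open>z\<close>, so a feasible companion \<open>y'\<close> is at most \<open>1 + D\<close>
    times as far from \<open>z\<close> as \<open>y\<close> is. Radii and slopes below are divided by
    \<open>1 + D\<close> for this reason.\<close>
  have near: "norm_X T (y' - z) \<le> (1 + D) * norm_X T (y - z)"
    if "z \<in> ?\<Omega>" "y \<in> A" "y' \<in> A" "norm_X T (y' - y) \<le> D * ?\<phi> y" for z y y'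
  proof -
    have z: "z \<in> A" "?\<phi> z = 0" using that(1) by (auto simp: feasible_set_def)
    have "?\<phi> y \<le> norm_X T (y - z)"
      using terminal_gap_Lipschitz[OF T, of y z xT] A that z by auto
    then have "D * ?\<phi> y \<le> D * norm_X T (y - z)" using D(1) by (intro mult_left_mono) auto
    moreover have "norm_X T (y' - z) \<le> norm_X T (y' - y) + norm_X T (y - z)"
      by (rule norm_X_triangle_diff[OF T]) (use that A z in auto)
    ultimately show ?thesis using that(4) by (simp add: algebra_simps)
  qed
  have global: "global_opt f ?\<Omega> z \<longleftrightarrow> global_opt ?P A z" for z
  proof
    assume z: "global_opt f ?\<Omega> z"
    then have z\<Omega>: "z \<in> ?\<Omega>" and le: "\<And>y. y \<in> ?\<Omega> \<Longrightarrow> f z \<le> f y" by (auto simp: global_opt_def)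
    have "?P z \<le> ?P y" if y: "y \<in> A" for y
    proof -
      obtain y' where "y' \<in> ?\<Omega>" "f y' \<le> ?P y" using proj_le[OF y] by blast
      then show ?thesis using le[of y'] P\<Omega>[OF z\<Omega>] by linarith
    qed
    then show "global_opt ?P A z" using \<Omega>A[OF z\<Omega>] by (simp add: global_opt_def)
  next
    assume z: "global_opt ?P A z"
    then have "local_opt T ?P A z" by (auto simp: global_opt_def local_opt_def intro: exI[of _ 1])
    then have z\<Omega>: "z \<in> ?\<Omega>" using not_local z by (simp add: feasible_set_def global_opt_def)
    have "f z \<le> f y" if "y \<in> ?\<Omega>" for y
      using z \<Omega>A[OF that] P\<Omega>[OF that] P\<Omega>[OF z\<Omega>] by (auto simp: global_opt_def)
    then show "global_opt f ?\<Omega> z" using z\<Omega> by (simp add: global_opt_def)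
  qed
  then show "{z. global_opt f ?\<Omega> z} = {z. global_opt ?P A z}" by blast
  fix z assume zA: "z \<in> A"
  show "local_opt T ?P A z \<longleftrightarrow> z \<in> ?\<Omega> \<and> local_opt T f ?\<Omega> z"
  proof
    assume l: "local_opt T ?P A z"
    then have z\<Omega>: "z \<in> ?\<Omega>" using not_local zA by (simp add: feasible_set_def)
    obtain r where r: "r > 0" "\<And>y. y \<in> A \<Longrightarrow> norm_X T (y - z) < r \<Longrightarrow> ?P z \<le> ?P y"
      using l unfolding local_opt_def by blast
    have "f z \<le> f y" if "y \<in> ?\<Omega>" "norm_X T (y - z) < r" for y
      using r(2)[OF \<Omega>A[OF that(1)] that(2)] P\<Omega>[OF that(1)] P\<Omega>[OF z\<Omega>] by simp
    then show "z \<in> ?\<Omega> \<and> local_opt T f ?\<Omega> z" using z\<Omega> r(1) unfolding local_opt_def by blast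
  next
    assume l: "z \<in> ?\<Omega> \<and> local_opt T f ?\<Omega> z"
    then have z\<Omega>: "z \<in> ?\<Omega>" by blast
    obtain r where r: "r > 0" "\<And>y. y \<in> ?\<Omega> \<Longrightarrow> norm_X T (y - z) < r \<Longrightarrow> f z \<le> f y"
      using l unfolding local_opt_def by blast
    have "?P z \<le> ?P y" if y: "y \<in> A" "norm_X T (y - z) < r / (1 + D)" for y
    proof -
      obtain y' where y': "y' \<in> ?\<Omega>" "norm_X T (y' - y) \<le> D * ?\<phi> y" "f y' + ?\<phi> y \<le> ?P y"
        using proj[OF y(1)] by blast
      have "norm_X T (y' - z) \<le> (1 + D) * norm_X T (y - z)" by (rule near[OF z\<Omega> y(1) \<Omega>A[OF y'(1)] y'(2)])
      also have "\<dots> < r" using y(2) D(1) by (simp add: field_simps)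
      finally have "f z \<le> f y'" by (rule r(2)[OF y'(1)])
      then show ?thesis using y'(3) P\<Omega>[OF z\<Omega>] terminal_gap_nonneg[of T xT y] by linarith
    qed
    then show "local_opt T ?P A z"
      unfolding local_opt_def using zA r(1) D(1) by (intro conjI exI[of _ "r / (1 + D)"]) auto
  qed
  show "inf_stationary T ?P A z \<longleftrightarrow> z \<in> ?\<Omega> \<and> inf_stationary T f ?\<Omega> z"
  proof
    assume l: "inf_stationary T ?P A z"
    then have z\<Omega>: "z \<in> ?\<Omega>" using not_stat zA by (simp add: feasible_set_def)
    have "\<exists>r>0. \<forall>y\<in>?\<Omega>. 0 < norm_X T (y - z) \<and> norm_X T (y - z) < r \<longrightarrow> f z - e * norm_X T (y - z) \<le> f y"
      if e: "e > 0" for e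
    proof -
      obtain r where r: "r > 0" "\<And>y. y \<in> A \<Longrightarrow> 0 < norm_X T (y - z) \<and> norm_X T (y - z) < r \<Longrightarrow>
          ?P z - e * norm_X T (y - z) \<le> ?P y"
        using l e unfolding inf_stationary_iff by blast
      then show ?thesis using \<Omega>A P\<Omega> P\<Omega>[OF z\<Omega>] by (intro exI[of _ r]) metis
    qed
    then show "z \<in> ?\<Omega> \<and> inf_stationary T f ?\<Omega> z" unfolding inf_stationary_iff using z\<Omega> by blast
  next
    assume l: "z \<in> ?\<Omega> \<and> inf_stationary T f ?\<Omega> z"
    then have z\<Omega>: "z \<in> ?\<Omega>" by blast
    have "\<exists>r>0. \<forall>y\<in>A. 0 < norm_X T (y - z) \<and> norm_X T (y - z) < r \<longrightarrow> ?P z - e * norm_X T (y - z) \<le> ?P y"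
      if e: "e > 0" for e
    proof -
      have "e / (1 + D) > 0" using e D(1) by simp
      then obtain r where r: "r > 0" "\<And>y. y \<in> ?\<Omega> \<Longrightarrow> 0 < norm_X T (y - z) \<and> norm_X T (y - z) < r \<Longrightarrow>
          f z - e / (1 + D) * norm_X T (y - z) \<le> f y"
        using l unfolding inf_stationary_iff by blast
      have "?P z - e * norm_X T (y - z) \<le> ?P y" if y: "y \<in> A" "0 < norm_X T (y - z)" "norm_X T (y - z) < r / (1 + D)" for y
      proof -
        obtain y' where y': "y' \<in> ?\<Omega>" "norm_X T (y' - y) \<le> D * ?\<phi> y" "f y' + ?\<phi> y \<le> ?P y"
          using proj[OF y(1)] by blast
        have n: "norm_X T (y' - z) \<le> (1 + D) * norm_X T (y - z)" by (rule near[OF z\<Omega> y(1) \<Omega>A[OF y'(1)] y'(2)])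
        also have "\<dots> < r" using y(3) D(1) by (simp add: field_simps)
        finally have less: "norm_X T (y' - z) < r" .
        have "f z - e * norm_X T (y - z) \<le> f y'"
        proof (cases "norm_X T (y' - z) = 0")
          case True
          \<comment> \<open>At distance zero the slope condition is silent; the Lipschitz estimate
            shows that \<open>f\<close> does not drop.\<close>
          then have "f z \<le> f y'"
            using L(2)[OF zA \<Omega>A[OF y'(1)]] norm_X_minus_commute[OF T subsetD[OF A zA] subsetD[OF A \<Omega>A[OF y'(1)]]] by simp
          then show ?thesis using mult_pos_pos[OF e y(2)] by linarith
        next
          case False
          then have "0 < norm_X T (y' - z)"
            using norm_X_nonneg[OF T diff[OF \<Omega>A[OF y'(1)] zA]] by linarith
          then have "f z - e / (1 + D) * norm_X T (y' - z) \<le> f y'" using r(2)[OF y'(1)] less by blast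
          moreover have "e / (1 + D) * norm_X T (y' - z) \<le> e / (1 + D) * ((1 + D) * norm_X T (y - z))"
            using n e D(1) by (intro mult_left_mono) auto
          moreover have "e / (1 + D) * ((1 + D) * norm_X T (y - z)) = e * norm_X T (y - z)"
            using D(1) by simp
          ultimately show ?thesis by linarith
        qed
        then show ?thesis using y'(3) P\<Omega>[OF z\<Omega>] terminal_gap_nonneg[of T xT y] by linarith
      qed
      then show ?thesis using r(1) D(1) by (intro exI[of _ "r / (1 + D)"]) auto
    qed
    then show "inf_stationary T ?P A z" unfolding inf_stationary_iff using zA by blast
  qed
qed

section \<open>Bounded preimages of a relative neighbourhood\<close>

lemma affine_closure:
  fixes L :: "'a::real_normed_vector set"
  assumes "affine L"
  shows "affine (closure L)"
  unfolding affine_def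
proof (intro ballI allI impI)
  fix x y and u v :: real assume xy: "x \<in> closure L" "y \<in> closure L" and uv: "u + v = 1"
  obtain a where a: "\<And>n. a n \<in> L" "a \<longlonglongrightarrow> x" using xy(1) by (auto simp: closure_sequential)
  obtain b where b: "\<And>n. b n \<in> L" "b \<longlonglongrightarrow> y" using xy(2) by (auto simp: closure_sequential)
  have "(\<lambda>n. u *\<^sub>R a n + v *\<^sub>R b n) \<longlonglongrightarrow> u *\<^sub>R x + v *\<^sub>R y" by (intro tendsto_intros a b)
  moreover have "u *\<^sub>R a n + v *\<^sub>R b n \<in> L" for n
    using assms a(1) b(1) uv unfolding affine_def by blast
  ultimately show "u *\<^sub>R x + v *\<^sub>R y \<in> closure L"
    unfolding closure_sequential by (intro exI[of _ "\<lambda>n. u *\<^sub>R a n + v *\<^sub>R b n"]) blast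
qed

lemma openin_affine_ball:
  assumes "x \<in> top_of_set L interior_of C"
  obtains e where "e > 0" "\<And>y. y \<in> L \<Longrightarrow> norm (y - x) < e \<Longrightarrow> y \<in> C"
proof -
  have "openin (top_of_set L) (top_of_set L interior_of C)" by (rule openin_interior_of)
  then obtain e where e: "e > 0" "ball x e \<inter> L \<subseteq> top_of_set L interior_of C"
    unfolding openin_contains_ball using assms by blast
  have "y \<in> C" if "y \<in> L" "norm (y - x) < e" for y
  proof -
    have "y \<in> ball x e \<inter> L" using that by (simp add: dist_norm norm_minus_commute)
    then show ?thesis using e(2) interior_of_subset[of "top_of_set L" C] by blast
  qed
  with e(1) show thesis using that by blast
qed

text \<open>Robinson-Ursescu for a single affine map: Baire's theorem makes the closure of the image of
  a bounded part of \<open>A\<close> a relative neighbourhood, and summing a series of corrections inside \<open>A\<close>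
  removes the closure.\<close>

lemma bounded_preimages_near_relint:
  fixes A :: "'v::real_vector set" and N :: "'v \<Rightarrow> real" and P :: "'v \<Rightarrow> 'w::banach"
  assumes V: "subspace V" and AV: "A \<subseteq> V" and A: "convex A"
    and N_add: "\<And>z y. z \<in> V \<Longrightarrow> y \<in> V \<Longrightarrow> N (z + y) \<le> N z + N y"
    and N_scale: "\<And>c z. z \<in> V \<Longrightarrow> N (c *\<^sub>R z) = \<bar>c\<bar> * N z"
    and complete: "\<And>v c. (\<And>k. v k \<in> A) \<Longrightarrow> (\<And>k. N (v (Suc k) - v k) \<le> c k) \<Longrightarrow> summable c \<Longrightarrow>
      \<exists>z\<in>A. (\<lambda>k. N (v k - z)) \<longlonglongrightarrow> 0"
    and P: "linear P" and P_le: "\<And>z. z \<in> V \<Longrightarrow> norm (P z) \<le> N z"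
    and x: "x \<in> relint (P ` A)"
  obtains r m where "r > 0"
    "\<And>y. y \<in> closure (affine hull (P ` A)) \<Longrightarrow> norm (y - x) \<le> r \<Longrightarrow> \<exists>z\<in>A. N z \<le> m \<and> P z = y"
proof -
  define L where "L = closure (affine hull (P ` A))"
  have affL: "affine L" unfolding L_def by (intro affine_closure affine_affine_hull)
  have closedL: "closed L" by (simp add: L_def)
  have PL: "P ` A \<subseteq> L" unfolding L_def by (meson closure_subset hull_subset subset_trans)
  have L_comb: "u *\<^sub>R a + v *\<^sub>R b \<in> L" if "a \<in> L" "b \<in> L" "u + v = 1" for a b u v
    using affL that unfolding affine_def by blast
  have x_int: "x \<in> top_of_set L interior_of (P ` A)" using x by (simp add: relint_def L_def)
  obtain r0 where r0: "r0 > 0" "\<And>y. y \<in> L \<Longrightarrow> norm (y - x) < r0 \<Longrightarrow> y \<in> P ` A"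
    using openin_affine_ball[OF x_int] by metis
  have xL: "x \<in> L" using x_int interior_of_subset[of "top_of_set L" "P ` A"] PL by blast
  \<comment> \<open>Bounded convex parts of \<open>A\<close> whose images exhaust the image of
    \<open>A\<close>, so Baire's theorem applies to the closures of these images in the closed set
    \<open>L\<close>.\<close>
  define A' where "A' = (\<lambda>m. {z \<in> A. N z \<le> m})"
  have A'conv: "convex (A' m)" for m
    unfolding convex_def
  proof (intro ballI allI impI)
    fix z y u v assume zy: "z \<in> A' m" "y \<in> A' m" and uv: "0 \<le> u" "0 \<le> v" "u + v = (1::real)"
    then have z: "z \<in> A" "N z \<le> m" and y: "y \<in> A" "N y \<le> m" by (auto simp: A'_def)
    have "N (u *\<^sub>R z + v *\<^sub>R y) \<le> u * N z + v * N y"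
      using N_add[of "u *\<^sub>R z" "v *\<^sub>R y"] N_scale subspace_scale[OF V] AV z(1) y(1) uv by (auto simp: subset_iff)
    also have "\<dots> \<le> u * m + v * m" using z y uv by (intro add_mono mult_left_mono) auto
    also have "\<dots> = m" using uv by (simp flip: distrib_right)
    finally show "u *\<^sub>R z + v *\<^sub>R y \<in> A' m"
      using convexD[OF A z(1) y(1) uv] by (simp add: A'_def)
  qed
  have A'mono: "A' m \<subseteq> A' m'" if "m \<le> m'" for m m' using that by (auto simp: A'_def)
  have A'L: "P ` A' m \<subseteq> L" for m using PL by (auto simp: A'_def)
  obtain n :: nat where "top_of_set L interior_of closure (P ` A' (real n)) \<noteq> {}"
  proof (rule ccontr)
    assume no: "\<not> thesis"
    have "top_of_set L interior_of \<Union>(range (\<lambda>n. closure (P ` A' (real n)))) = {}"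
    proof (rule Baire_category_alt)
      have "completely_metrizable_space (top_of_set L)"
        using closed_closedin closedL completely_metrizable_space_closedin completely_metrizable_space_euclidean
        by blast
      then show "completely_metrizable_space (top_of_set L) \<or>
          locally_compact_space (top_of_set L) \<and> regular_space (top_of_set L)" by blast
      fix C assume "C \<in> range (\<lambda>n. closure (P ` A' (real n)))"
      then obtain n where C: "C = closure (P ` A' (real n))" by blast
      have "C \<subseteq> L" unfolding C using A'L closedL by (rule closure_minimal)
      then have "closedin (top_of_set L) C" unfolding C by (simp add: closed_subset)
      then show "closedin (top_of_set L) C \<and> top_of_set L interior_of C = {}" using no that C by blast
    qed simp
    moreover have "P ` A \<subseteq> \<Union>(range (\<lambda>n. closure (P ` A' (real n))))"
    proof
      fix y assume "y \<in> P ` A"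
      then obtain z where z: "z \<in> A" "y = P z" by blast
      obtain n where "N z \<le> real n" using real_arch_simple by blast
      then have "y \<in> P ` A' (real n)" using z by (auto simp: A'_def)
      then show "y \<in> \<Union>(range (\<lambda>n. closure (P ` A' (real n))))" using closure_subset by fastforce
    qed
    ultimately show False using x_int interior_of_mono[of "P ` A" _ "top_of_set L"] by blast
  qed
  then obtain y0 where y0: "y0 \<in> top_of_set L interior_of closure (P ` A' (real n))" by blast
  obtain e where e: "e > 0" "\<And>y. y \<in> L \<Longrightarrow> norm (y - y0) < e \<Longrightarrow> y \<in> closure (P ` A' (real n))"
    using openin_affine_ball[OF y0] by metis
  have y0L: "y0 \<in> L"
    using y0 interior_of_subset[of "top_of_set L" "closure (P ` A' (real n))"] closure_minimal[OF A'L closedL]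
    by blast
  \<comment> \<open>A neighbourhood of \<open>y0\<close> has been found, but one of \<open>x\<close>
    is wanted. Continuing the line from \<open>y0\<close> through \<open>x\<close> gives a point
    \<open>y1\<close> with \<open>x = (y1 + d * y0) / (1 + d)\<close>; this \<open>d\<close> keeps
    \<open>y1\<close> within \<open>r0 / 2\<close> of \<open>x\<close>, hence reachable. The added 1
    covers \<open>x = y0\<close>.\<close>
  define d where "d = r0 / (2 * (norm (x - y0) + 1))"
  have np: "norm (x - y0) + 1 > 0" by (simp add: add_nonneg_pos)
  have d: "d > 0" using r0(1) np by (simp add: d_def)
  define y1 where "y1 = (1 + d) *\<^sub>R x + (- d) *\<^sub>R y0"
  have y1x: "y1 - x = d *\<^sub>R (x - y0)" by (simp add: y1_def algebra_simps)
  have "d * norm (x - y0) \<le> d * (norm (x - y0) + 1)" using d by (intro mult_left_mono) auto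
  also have "\<dots> = r0 / 2" using np by (simp add: d_def field_simps)
  also have "\<dots> < r0" using r0(1) by simp
  finally have "norm (y1 - x) < r0" unfolding y1x using d by simp
  moreover have "y1 \<in> L" unfolding y1_def by (rule L_comb[OF xL y0L]) simp
  ultimately obtain z1 where z1: "z1 \<in> A" "y1 = P z1" using r0(2) by blast
  \<comment> \<open>Large enough for the neighbourhood of \<open>y0\<close> and for the single
    preimage \<open>z1\<close> of \<open>y1\<close>.\<close>
  define m where "m = max (real n) (N z1)"
  define C where "C = closure (P ` A' m)"
  have C_conv: "convex C" unfolding C_def by (intro convex_closure convex_linear_image P A'conv)
  have y1C: "y1 \<in> C" unfolding C_def using z1 closure_subset by (force simp: A'_def m_def)
  have nC: "closure (P ` A' (real n)) \<subseteq> C"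
    unfolding C_def by (intro closure_mono image_mono A'mono) (simp add: m_def)
  \<comment> \<open>Radius of the ball around \<open>y0\<close> after contraction towards
    \<open>y1\<close> by the factor \<open>d / (1 + d)\<close>.\<close>
  define e1 where "e1 = e * d / (1 + d)"
  have e1: "e1 > 0" using e(1) d by (simp add: e1_def)
  have ball_C: "y \<in> C" if y: "y \<in> L" "norm (y - x) < e1" for y
  proof -
    define w where "w = ((1 + d) / d) *\<^sub>R y + (- (1 / d)) *\<^sub>R y1"
    have "w \<in> L"
      unfolding w_def by (rule L_comb[OF y(1) \<open>y1 \<in> L\<close>]) (use d in \<open>simp add: field_simps\<close>)
    have "w - y0 = ((1 + d) / d) *\<^sub>R (y - x)"
    proof -
      have "d *\<^sub>R (w - y0) = d *\<^sub>R (((1 + d) / d) *\<^sub>R (y - x))"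
        using d by (simp add: w_def y1_def scaleR_diff_right scaleR_add_right)
      then show ?thesis unfolding scaleR_cancel_left using d by blast
    qed
    then have "norm (w - y0) = (1 + d) / d * norm (y - x)" using d by simp
    moreover have "(1 + d) / d * norm (y - x) < (1 + d) / d * e1"
      using y(2) d by (intro mult_strict_left_mono) auto
    moreover have "(1 + d) / d * e1 = e" using d by (simp add: e1_def)
    ultimately have "norm (w - y0) < e" by linarith
    with \<open>w \<in> L\<close> have "w \<in> C" using e(2) nC by blast
    moreover have "y = (1 / (1 + d)) *\<^sub>R y1 + (d / (1 + d)) *\<^sub>R w"
    proof -
      have "(1 + d) *\<^sub>R y = (1 + d) *\<^sub>R ((1 / (1 + d)) *\<^sub>R y1 + (d / (1 + d)) *\<^sub>R w)"
        using d by (simp add: w_def scaleR_diff_right scaleR_add_right)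
      moreover have "1 + d \<noteq> 0" using d by simp
      ultimately show ?thesis by (simp only: scaleR_cancel_left) simp
    qed
    ultimately show ?thesis
      using convexD[OF C_conv y1C, of w "1 / (1 + d)" "d / (1 + d)"] d by (simp add: field_simps)
  qed
  have main: "\<exists>z\<in>A. N z \<le> m \<and> P z = y" if y: "y \<in> L" "norm (y - x) \<le> e1 / 2" for y
  proof -
    \<comment> \<open>These errors sum to \<open>e1 / 2\<close>, the room left for the targets
      \<open>Y k\<close> inside the ball of radius \<open>e1\<close> around
      \<open>x\<close>.\<close>
    define \<delta> where "\<delta> = (\<lambda>k::nat. e1 / 2 * (1 / 2) ^ Suc k)"
    have \<delta>: "\<delta> k > 0" for k using e1 by (simp add: \<delta>_def)
    have "\<exists>z. z \<in> A' m \<and> norm (w - P z) < \<delta> k" if "w \<in> C" for w k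
    proof -
      obtain p where "p \<in> P ` A' m" "dist p w < \<delta> k"
        using \<open>w \<in> C\<close> \<delta>[of k] unfolding C_def closure_approachable by blast
      then show ?thesis by (auto simp: dist_norm norm_minus_commute)
    qed
    then obtain Z where Z: "\<And>w k. w \<in> C \<Longrightarrow> Z w k \<in> A' m" "\<And>w k. w \<in> C \<Longrightarrow> norm (w - P (Z w k)) < \<delta> k"
      by metis
    \<comment> \<open>\<open>Y k\<close> is the remaining target: \<open>y\<close> equals the sum
      over \<open>i < k\<close> of the images of the chosen points with weights
      \<open>(1 / 2) ^ Suc i\<close>, plus \<open>(1 / 2) ^ k\<close> times \<open>Y k\<close>.
      Doubling and subtracting preserves this identity.\<close>
    define Y where "Y = rec_nat y (\<lambda>k w. 2 *\<^sub>R w - P (Z w k))"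
    have Y0: "Y 0 = y" and YS: "Y (Suc k) = 2 *\<^sub>R Y k - P (Z (Y k) k)" for k by (simp_all add: Y_def)
    have Y: "Y k \<in> L \<and> norm (Y k - x) \<le> e1 * (1 - (1 / 2) ^ Suc k)" for k
    proof (induction k)
      case 0
      then show ?case using y by (simp add: Y0)
    next
      case (Suc k)
      have pw: "0 < (1 / 2 :: real) ^ Suc k" by simp
      have "e1 * (1 - (1 / 2) ^ Suc k) < e1" using e1 mult_pos_pos[OF e1 pw] by (simp add: right_diff_distrib)
      then have YC: "Y k \<in> C" using Suc ball_C by (meson order_le_less_trans)
      have "P (Z (Y k) k) \<in> L" using Z(1)[OF YC] A'L by blast
      then have "2 *\<^sub>R Y k + (-1) *\<^sub>R P (Z (Y k) k) \<in> L" using Suc by (intro L_comb) auto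
      then have "Y (Suc k) \<in> L" by (simp add: YS)
      have "Y (Suc k) - x = (Y k - x) + (Y k - P (Z (Y k) k))" by (simp add: YS scaleR_2)
      then have "norm (Y (Suc k) - x) \<le> norm (Y k - x) + norm (Y k - P (Z (Y k) k))"
        by (simp only: norm_triangle_ineq)
      also have "\<dots> \<le> e1 * (1 - (1 / 2) ^ Suc k) + \<delta> k"
        using Suc Z(2)[OF YC, of k] by linarith
      also have "\<dots> = e1 * (1 - (1 / 2) ^ Suc (Suc k))" by (simp add: \<delta>_def algebra_simps)
      finally show ?case using \<open>Y (Suc k) \<in> L\<close> by simp
    qed
    have YC: "Y k \<in> C" for k
    proof -
      have pw: "0 < (1 / 2 :: real) ^ Suc k" by simp
      have "e1 * (1 - (1 / 2) ^ Suc k) < e1" using e1 mult_pos_pos[OF e1 pw] by (simp add: right_diff_distrib)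
      then show ?thesis using Y[of k] ball_C by (meson order_le_less_trans)
    qed
    define z where "z = (\<lambda>k. Z (Y k) k)"
    have z: "z k \<in> A' m" and zY: "norm (Y k - P (z k)) < \<delta> k" for k
      using Z[OF YC] by (auto simp: z_def)
    have zV: "z k \<in> V" for k using z[of k] AV by (auto simp: A'_def)
    define p where "p = (\<lambda>k. \<Sum>i<k. (1 / 2) ^ Suc i *\<^sub>R z i)"
    \<comment> \<open>The partial sum \<open>p k\<close> has total weight
      \<open>1 - (1 / 2) ^ k\<close>; giving the rest to \<open>z k\<close> makes \<open>v k\<close>
      a convex combination, so it stays in \<open>A' m\<close>.\<close>
    define v where "v = (\<lambda>k. p k + (1 / 2) ^ k *\<^sub>R z k)"
    have p_comb: "p k + (1 / 2) ^ k *\<^sub>R w \<in> A' m" if "w \<in> A' m" for w k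
      using that
    proof (induction k arbitrary: w)
      case 0
      then show ?case by (simp add: p_def)
    next
      case (Suc k)
      \<comment> \<open>The last two weights are merged: the midpoint of \<open>z k\<close> and
        \<open>w\<close> takes the place of \<open>w\<close> one stage earlier.\<close>
      have "(1 / 2) *\<^sub>R z k + (1 / 2) *\<^sub>R w \<in> A' m" by (rule convexD[OF A'conv z Suc.prems]) auto
      from Suc.IH[OF this] show ?case by (simp add: p_def scaleR_add_right algebra_simps)
    qed
    then have v: "v k \<in> A' m" for k using z by (simp add: v_def)
    then have vA: "v k \<in> A" and vV: "v k \<in> V" and vm: "N (v k) \<le> m" for k
      using AV by (auto simp: A'_def)
    have step: "N (v (Suc k) - v k) \<le> m * (1 / 2) ^ k" for k
    proof -
      have vd: "v (Suc k) - v k = (1 / 2) ^ Suc k *\<^sub>R (z (Suc k) + (-1) *\<^sub>R z k)"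
      proof -
        have "(1 / 2 :: real) ^ k *\<^sub>R z k = (1 / 2) ^ Suc k *\<^sub>R z k + (1 / 2) ^ Suc k *\<^sub>R z k"
          by (simp flip: scaleR_left_distrib)
        then show ?thesis by (simp add: v_def p_def scaleR_diff_right del: power_Suc)
      qed
      have "N (v (Suc k) - v k) = \<bar>(1 / 2) ^ Suc k\<bar> * N (z (Suc k) + (-1) *\<^sub>R z k)"
        unfolding vd by (rule N_scale[OF subspace_add[OF V zV subspace_scale[OF V zV]]])
      also have "\<bar>(1 / 2 :: real) ^ Suc k\<bar> = (1 / 2) ^ Suc k" by simp
      also have "(1 / 2) ^ Suc k * N (z (Suc k) + (-1) *\<^sub>R z k) \<le> (1 / 2) ^ Suc k * (m + m)"
      proof (rule mult_left_mono)
        have "N (z (Suc k) + (-1) *\<^sub>R z k) \<le> N (z (Suc k)) + N (z k)"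
          using N_add[OF zV subspace_scale[OF V zV], of "Suc k" "-1" k] N_scale[OF zV, of "-1" k] by simp
        then show "N (z (Suc k) + (-1) *\<^sub>R z k) \<le> m + m" using z[of k] z[of "Suc k"] by (auto simp: A'_def)
      qed simp
      finally show ?thesis by (simp add: mult.commute)
    qed
    have "summable (\<lambda>k. m * (1 / 2 :: real) ^ k)" by (intro summable_mult summable_geometric) simp
    from complete[OF vA step this] obtain l where l: "l \<in> A" "(\<lambda>k. N (v k - l)) \<longlonglongrightarrow> 0" by blast
    have lV: "l \<in> V" using l(1) AV by blast
    have Nl: "N l \<le> m"
    proof (rule LIMSEQ_le_const)
      show "(\<lambda>k. m + N (v k - l)) \<longlonglongrightarrow> m" using tendsto_add[OF tendsto_const l(2), of m] by simp
      have "N l \<le> m + N (v k - l)" for k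
      proof -
        have "l = v k + (-1) *\<^sub>R (v k - l)" by simp
        then have "N l \<le> N (v k) + N (v k - l)"
          using N_add[OF vV subspace_scale[OF V subspace_diff[OF V vV lV]], of k "-1" k]
            N_scale[OF subspace_diff[OF V vV lV], of "-1" k] by simp
        then show ?thesis using vm[of k] by linarith
      qed
      then show "\<exists>M. \<forall>k\<ge>M. N l \<le> m + N (v k - l)" by blast
    qed
    have "(\<lambda>k. P (v k) - P l) \<longlonglongrightarrow> 0"
    proof (rule Lim_null_comparison[OF _ l(2)])
      show "\<forall>\<^sub>F k in sequentially. norm (P (v k) - P l) \<le> N (v k - l)"
        using P_le[OF subspace_diff[OF V vV lV]] by (simp add: linear_diff[OF P])
    qed
    then have "(\<lambda>k. P (v k)) \<longlonglongrightarrow> P l" by (rule LIM_zero_cancel)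
    moreover have "(\<lambda>k. P (v k)) \<longlonglongrightarrow> y"
    proof -
      have Pp: "P (p k) = y - (1 / 2) ^ k *\<^sub>R Y k" for k
      proof (induction k)
        case 0
        then show ?case by (simp add: p_def Y0 linear_0[OF P])
      next
        case (Suc k)
        have "P (p (Suc k)) = P (p k) + (1 / 2) ^ Suc k *\<^sub>R P (z k)"
          by (simp add: p_def linear_add[OF P] linear_scale[OF P] del: power_Suc)
        also have "P (z k) = 2 *\<^sub>R Y k - Y (Suc k)" by (simp add: YS z_def)
        finally show ?case using Suc by (simp add: algebra_simps)
      qed
      have "P (v k) - y = (1 / 2) ^ k *\<^sub>R (P (z k) - Y k)" for k
        by (simp add: v_def linear_add[OF P] linear_scale[OF P] Pp algebra_simps)
      then have "norm (P (v k) - y) = (1 / 2) ^ k * norm (Y k - P (z k))" for k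
        by (simp add: norm_minus_commute)
      also have "(1 / 2) ^ k * norm (Y k - P (z k)) \<le> (1 / 2) ^ k * e1" for k
      proof (rule mult_left_mono)
        have "\<delta> k \<le> e1 * 1" unfolding \<delta>_def using e1 power_le_one[of "1 / 2 :: real" "Suc k"]
          by (simp only: times_divide_eq_left) (auto intro!: order_trans[OF mult_left_mono])
        then show "norm (Y k - P (z k)) \<le> e1" using zY[of k] by simp
      qed simp
      finally have le: "norm (P (v k) - y) \<le> (1 / 2) ^ k * e1" for k .
      have "(\<lambda>k. (1 / 2 :: real) ^ k) \<longlonglongrightarrow> 0" by (rule LIMSEQ_power_zero) simp
      then have "(\<lambda>k. (1 / 2) ^ k * e1) \<longlonglongrightarrow> 0" by (rule tendsto_mult_left_zero)
      then have "(\<lambda>k. P (v k) - y) \<longlonglongrightarrow> 0"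
        by (rule Lim_null_comparison[rotated]) (use le in simp)
      then show ?thesis by (rule LIM_zero_cancel)
    qed
    ultimately have "P l = y" by (rule LIMSEQ_unique)
    with l(1) Nl show ?thesis by blast
  qed
  show thesis
    by (rule that[of "e1 / 2" m]) (use e1 main in \<open>auto simp: L_def\<close>)
qed

text \<open>A point opposite to \<open>z\<close> across \<open>xT\<close>, at fixed distance from \<open>xT\<close>, is reached by some
  \<open>w\<close>; the segment from \<open>z\<close> to \<open>w\<close> passes through a feasible point.\<close>

lemma feasible_on_segment:
  fixes A :: "((real \<Rightarrow> 'h::real_normed_vector) \<times> (real \<Rightarrow> 'u::real_normed_vector)) set"
  assumes A: "convex A" and r: "r > 0" and xT: "xT \<in> (\<lambda>z. fst z T) ` A" and A': "A' \<subseteq> A"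
    and ball: "\<And>y. y \<in> closure (affine hull ((\<lambda>z. fst z T) ` A)) \<Longrightarrow> norm (y - xT) \<le> r \<Longrightarrow>
      \<exists>w\<in>A'. fst w T = y"
    and z: "z \<in> A" and s: "s = terminal_gap T xT z / (r + terminal_gap T xT z)"
  obtains w where "w \<in> A'" "(1 - s) *\<^sub>R z + s *\<^sub>R w \<in> feasible_set (terminal_gap T xT) A"
proof -
  let ?R = "(\<lambda>z. fst z T) ` A"
  define g where "g = terminal_gap T xT z"
  have g: "0 \<le> g" by (simp add: g_def)
  have s01: "0 \<le> s" "s \<le> 1" using g r by (auto simp: s g_def[symmetric] field_simps)
  \<comment> \<open>With \<open>y\<close> at distance \<open>r\<close> on the far side,
    \<open>xT\<close> divides the segment of end points in the ratio \<open>g : r\<close>, whence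
    \<open>s\<close>. For \<open>g = 0\<close> there is no direction, but then \<open>s = 0\<close>
    and \<open>xT\<close> itself serves.\<close>
  define y where "y = (if g = 0 then xT else xT - (r / g) *\<^sub>R (fst z T - xT))"
  have "y \<in> affine hull ?R"
  proof (cases "g = 0")
    case True
    then show ?thesis using xT by (simp add: y_def hull_inc)
  next
    case False
    have "xT \<in> affine hull ?R" "fst z T \<in> affine hull ?R" using xT z by (auto intro: hull_inc)
    moreover have "(1 + r / g) + (- (r / g)) = 1" by simp
    ultimately have "(1 + r / g) *\<^sub>R xT + (- (r / g)) *\<^sub>R fst z T \<in> affine hull ?R"
      by (rule mem_affine[OF affine_affine_hull])
    then show ?thesis using False by (simp add: y_def algebra_simps)
  qed
  then have "y \<in> closure (affine hull ?R)" using closure_subset by blast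
  moreover have "norm (y - xT) \<le> r"
    using r g by (simp add: y_def g_def[unfolded terminal_gap_def, symmetric])
  ultimately obtain w where w: "w \<in> A'" "fst w T = y" using ball by blast
  have "(1 - s) *\<^sub>R z + s *\<^sub>R w \<in> A" using convexD_alt[OF A z, of w s] w A' s01 by auto
  moreover have "fst ((1 - s) *\<^sub>R z + s *\<^sub>R w) T = xT"
  proof (cases "g = 0")
    case True
    then have "s = 0" "fst z T = xT" by (auto simp: s g_def terminal_gap_def)
    then show ?thesis by simp
  next
    case False
    have rg: "r + g > 0" using r g by simp
    have "1 - s = r / (r + g)" "s * (r / g) = r / (r + g)"
      using rg False by (auto simp: s g_def[symmetric] field_simps)
    then have "(1 - s) *\<^sub>R (fst z T - xT) = (s * (r / g)) *\<^sub>R (fst z T - xT)" by simp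
    then have "(1 - s) *\<^sub>R fst z T + s *\<^sub>R y = (1 - s) *\<^sub>R xT + s *\<^sub>R xT"
      using False by (simp add: y_def algebra_simps)
    then show ?thesis using w by (simp add: algebra_simps)
  qed
  ultimately show thesis using that[OF w(1)] by (simp add: feasible_set_def terminal_gap_def)
qed

section \<open>The cost functional\<close>

text \<open>Once the continuous state is inserted, the integrand is a jointly continuous function of
  \<open>t\<close> and the control value, composed with a strongly measurable control.\<close>

lemma cost_integrand_measurable:
  fixes \<theta> :: "'h::real_normed_vector \<Rightarrow> 'u::real_normed_vector \<Rightarrow> real \<Rightarrow> real"
  assumes \<theta>: "continuous_on (UNIV \<times> UNIV \<times> {0..T}) (\<lambda>(x, u, t). \<theta> x u t)"
    and z: "z \<in> space_X T"
  shows "(\<lambda>t. \<theta> (fst z t) (snd z t) t) \<in> borel_measurable (lebesgue_on {0<..<T})"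
proof (rule strongly_measurable_real)
  have x: "continuous_on {0..T} (fst z)" and u: "snd z \<in> L2 {0<..<T}" using z by (auto simp: space_X_def)
  show "strongly_measurable (lebesgue_on {0<..<T}) (\<lambda>t. \<theta> (fst z t) (snd z t) t)"
  proof (rule strongly_measurable_continuous_compose[where F = "\<lambda>t v. \<theta> (fst z t) v t" and u = "snd z"])
    have "continuous_on ({0..T} \<times> UNIV) (\<lambda>p. (\<lambda>(x, u, t). \<theta> x u t) (fst z (fst p), snd p, fst p))"
      by (rule continuous_on_compose2[OF \<theta>])
        (auto intro!: continuous_intros continuous_on_compose2[OF x])
    then show "continuous_on ({0..T} \<times> UNIV) (\<lambda>(t, v). \<theta> (fst z t) v t)"
      by (simp add: case_prod_unfold)
    show "strongly_measurable (lebesgue_on {0<..<T}) (snd z)" using u by (simp add: L2_def)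
  qed
qed simp

text \<open>The supremum part of \<open>norm_X\<close> bounds the state pointwise, so one choice of
  growth data serves the whole ball; the L2 part bounds the quadratic term.\<close>

lemma cost_bounded:
  fixes \<theta> :: "'h::complex_hilbert \<Rightarrow> 'u::complex_hilbert \<Rightarrow> real \<Rightarrow> real"
  assumes T: "0 \<le> T"
    and \<theta>: "continuous_on (UNIV \<times> UNIV \<times> {0..T}) (\<lambda>(x, u, t). \<theta> x u t)"
    and growth: "\<forall>R>0. \<exists>C>0. \<exists>\<omega>. integrable (lebesgue_on {0<..<T}) \<omega> \<and>
         (AE t in lebesgue_on {0<..<T}. 0 \<le> \<omega> t) \<and>
         (\<forall>x u. \<forall>t\<in>{0<..<T}. norm x \<le> R \<longrightarrow> \<bar>\<theta> x u t\<bar> \<le> C * (norm u)\<^sup>2 + \<omega> t)"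
    and R: "R > 0"
  shows "\<exists>K. \<forall>z\<in>space_X T. norm_X T z \<le> R \<longrightarrow>
    integrable (lebesgue_on {0<..<T}) (\<lambda>t. \<theta> (fst z t) (snd z t) t) \<and> \<bar>cost \<theta> T z\<bar> \<le> K"
proof -
  let ?M = "lebesgue_on {0<..<T}"
  obtain C \<omega> where C: "C > 0" "integrable ?M \<omega>"
    "\<And>x u t. t \<in> {0<..<T} \<Longrightarrow> norm x \<le> R \<Longrightarrow> \<bar>\<theta> x u t\<bar> \<le> C * (norm u)\<^sup>2 + \<omega> t"
    using growth R by metis
  have "integrable ?M (\<lambda>t. \<theta> (fst z t) (snd z t) t) \<and> \<bar>cost \<theta> T z\<bar> \<le> C * R\<^sup>2 + integral\<^sup>L ?M \<omega>"
    if z: "z \<in> space_X T" "norm_X T z \<le> R" for z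
  proof -
    have u: "integrable ?M (\<lambda>t. (norm (snd z t))\<^sup>2)" using z(1) by (auto simp: space_X_def L2_def)
    have le: "\<bar>\<theta> (fst z t) (snd z t) t\<bar> \<le> C * (norm (snd z t))\<^sup>2 + \<omega> t" if t: "t \<in> {0<..<T}" for t
      using norm_X_upper[OF z(1), of t] z(2) t by (intro C(3)) auto
    have dom: "integrable ?M (\<lambda>t. C * (norm (snd z t))\<^sup>2 + \<omega> t)" using u C(2) by simp
    have int: "integrable ?M (\<lambda>t. \<theta> (fst z t) (snd z t) t)"
    proof (rule Bochner_Integration.integrable_bound[OF dom cost_integrand_measurable[OF \<theta> z(1)]])
      show "AE t in ?M. norm (\<theta> (fst z t) (snd z t) t) \<le> norm (C * (norm (snd z t))\<^sup>2 + \<omega> t)"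
      proof (rule AE_I2)
        fix t assume "t \<in> space ?M"
        then show "norm (\<theta> (fst z t) (snd z t) t) \<le> norm (C * (norm (snd z t))\<^sup>2 + \<omega> t)"
          using order_trans[OF le abs_ge_self] by simp
      qed
    qed
    have "\<bar>cost \<theta> T z\<bar> \<le> (\<integral>t. \<bar>\<theta> (fst z t) (snd z t) t\<bar> \<partial>?M)"
      unfolding cost_def by (rule integral_abs_bound)
    also have "\<dots> \<le> (\<integral>t. C * (norm (snd z t))\<^sup>2 + \<omega> t \<partial>?M)"
      by (rule integral_mono[OF _ dom]) (use int le in auto)
    also have "\<dots> = C * (norm_L2 {0<..<T} (snd z))\<^sup>2 + integral\<^sup>L ?M \<omega>"
      using u C(2) by (simp add: norm_L2_power2)
    also have "\<dots> \<le> C * R\<^sup>2 + integral\<^sup>L ?M \<omega>"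
      using C(1) order_trans[OF norm_L2_le_norm_X[OF T z(1)] z(2)]
      by (intro add_right_mono mult_left_mono power_mono) auto
    finally show ?thesis using int by blast
  qed
  then show ?thesis by blast
qed

lemma cost_integrable:
  fixes \<theta> :: "'h::complex_hilbert \<Rightarrow> 'u::complex_hilbert \<Rightarrow> real \<Rightarrow> real"
  assumes "0 \<le> T"
    and "continuous_on (UNIV \<times> UNIV \<times> {0..T}) (\<lambda>(x, u, t). \<theta> x u t)"
    and "\<forall>R>0. \<exists>C>0. \<exists>\<omega>. integrable (lebesgue_on {0<..<T}) \<omega> \<and>
         (AE t in lebesgue_on {0<..<T}. 0 \<le> \<omega> t) \<and>
         (\<forall>x u. \<forall>t\<in>{0<..<T}. norm x \<le> R \<longrightarrow> \<bar>\<theta> x u t\<bar> \<le> C * (norm u)\<^sup>2 + \<omega> t)"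
    and z: "z \<in> space_X T"
  shows "integrable (lebesgue_on {0<..<T}) (\<lambda>t. \<theta> (fst z t) (snd z t) t)"
proof -
  have "norm_X T z + 1 > 0" using norm_X_nonneg[OF assms(1) z] by linarith
  from cost_bounded[OF assms(1-3) this] z show ?thesis by fastforce
qed

lemma cost_convex_on:
  fixes \<theta> :: "'h::complex_hilbert \<Rightarrow> 'u::complex_hilbert \<Rightarrow> real \<Rightarrow> real"
  assumes A: "convex A" "A \<subseteq> space_X T"
    and int: "\<And>z. z \<in> space_X T \<Longrightarrow> integrable (lebesgue_on {0<..<T}) (\<lambda>t. \<theta> (fst z t) (snd z t) t)"
    and conv: "\<forall>t\<in>{0..T}. convex_on UNIV (\<lambda>(x, u). \<theta> x u t)"
  shows "convex_on A (cost \<theta> T)"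
  unfolding convex_on_def
proof (intro conjI A ballI allI impI)
  let ?M = "lebesgue_on {0<..<T}"
  fix z y u v assume zy: "z \<in> A" "y \<in> A" and uv: "0 \<le> u" "0 \<le> v" "u + v = (1::real)"
  have w: "u *\<^sub>R z + v *\<^sub>R y \<in> space_X T" using convexD[OF A(1) zy uv] A(2) by blast
  have i: "integrable ?M (\<lambda>t. \<theta> (fst z t) (snd z t) t)" "integrable ?M (\<lambda>t. \<theta> (fst y t) (snd y t) t)"
    using int zy A(2) by blast+
  have "cost \<theta> T (u *\<^sub>R z + v *\<^sub>R y) \<le> (\<integral>t. u * \<theta> (fst z t) (snd z t) t + v * \<theta> (fst y t) (snd y t) t \<partial>?M)"
    unfolding cost_def
  proof (rule integral_mono[OF int[OF w]])
    fix t assume "t \<in> space ?M"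
    then have "convex_on UNIV (\<lambda>(x, u). \<theta> x u t)" using conv by auto
    then have "(\<lambda>(x, u). \<theta> x u t) (u *\<^sub>R (fst z t, snd z t) + v *\<^sub>R (fst y t, snd y t))
        \<le> u * (\<lambda>(x, u). \<theta> x u t) (fst z t, snd z t) + v * (\<lambda>(x, u). \<theta> x u t) (fst y t, snd y t)"
      using uv unfolding convex_on_def by blast
    then show "\<theta> (fst (u *\<^sub>R z + v *\<^sub>R y) t) (snd (u *\<^sub>R z + v *\<^sub>R y) t) t
        \<le> u * \<theta> (fst z t) (snd z t) t + v * \<theta> (fst y t) (snd y t) t" by simp
  qed (use i in simp)
  then show "cost \<theta> T (u *\<^sub>R z + v *\<^sub>R y) \<le> u * cost \<theta> T z + v * cost \<theta> T y"
    using i by (simp add: cost_def)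
qed

text \<open>Mean value inequality on a convex set; Cauchy-Schwarz bounds the operator norm of the
  derivative by the norm of the gradient.\<close>

lemma GDERIV_bound:
  fixes f :: "'a::real_inner \<Rightarrow> real"
  assumes "convex K" "\<And>x. x \<in> K \<Longrightarrow> GDERIV f x :> g x" "\<And>x. x \<in> K \<Longrightarrow> norm (g x) \<le> b"
    and "x \<in> K" "y \<in> K"
  shows "\<bar>f x - f y\<bar> \<le> b * norm (x - y)"
proof -
  have b: "0 \<le> b" using assms(3)[OF assms(4)] norm_ge_zero order_trans by blast
  have "norm (f x - f y) \<le> b * norm (x - y)"
  proof (rule differentiable_bound[OF assms(1) _ _ assms(4,5)])
    fix w assume w: "w \<in> K"
    show "(f has_derivative (\<lambda>h. inner h (g w))) (at w within K)"
      using assms(2)[OF w] unfolding gderiv_def by (rule has_derivative_at_withinI)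
    show "onorm (\<lambda>h. inner h (g w)) \<le> b"
    proof (rule onorm_bound[OF b])
      fix h
      have "norm (inner h (g w)) \<le> norm h * norm (g w)" using Cauchy_Schwarz_ineq2[of h "g w"] by simp
      also have "\<dots> \<le> norm h * b" using assms(3)[OF w] by (intro mult_left_mono) auto
      finally show "norm (inner h (g w)) \<le> b * norm h" by (simp add: mult.commute)
    qed
  qed
  then show ?thesis by simp
qed

lemma L2_norm:
  assumes "u \<in> L2 J"
  shows "(\<lambda>t. norm (u t)) \<in> L2 J" "norm_L2 J (\<lambda>t. norm (u t)) = norm_L2 J u"
proof -
  have u: "strongly_measurable (lebesgue_on J) u" using assms by (simp add: L2_def)
  have "strongly_measurable (lebesgue_on J) (\<lambda>t. norm (u t))"
    using u u by (rule strongly_measurable_compose2[where h = "\<lambda>x y. norm x"]) (rule tendsto_norm)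
  then show "(\<lambda>t. norm (u t)) \<in> L2 J" using assms by (simp add: L2_def)
qed (simp add: norm_L2_def)

text \<open>The state is changed first, at fixed control, then the control at fixed state. The bound
  on the state gradient is integrable in time and meets a uniform distance; the bound on the control
  gradient is square integrable and meets an L2 distance through Cauchy-Schwarz.\<close>

lemma cost_Lipschitz:
  fixes \<theta> :: "'h::complex_hilbert \<Rightarrow> 'u::complex_hilbert \<Rightarrow> real \<Rightarrow> real"
  assumes T: "0 \<le> T"
    and int: "\<And>z. z \<in> space_X T \<Longrightarrow> integrable (lebesgue_on {0<..<T}) (\<lambda>t. \<theta> (fst z t) (snd z t) t)"
    and grad_x: "\<forall>x u. \<forall>t\<in>{0..T}. GDERIV (\<lambda>y. \<theta> y u t) x :> grad_x x u t"
    and grad_u: "\<forall>x u. \<forall>t\<in>{0..T}. GDERIV (\<lambda>v. \<theta> x v t) u :> grad_u x u t"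
    and growth: "\<forall>R>0. \<exists>C>0. \<exists>\<omega> \<eta>. integrable (lebesgue_on {0<..<T}) \<omega> \<and> \<eta> \<in> L2 {0<..<T} \<and>
         (AE t in lebesgue_on {0<..<T}. 0 \<le> \<omega> t \<and> 0 \<le> \<eta> t) \<and>
         (\<forall>x u. \<forall>t\<in>{0<..<T}. norm x \<le> R \<longrightarrow>
            norm (grad_x x u t) \<le> C * (norm u)\<^sup>2 + \<omega> t \<and>
            norm (grad_u x u t) \<le> C * norm u + \<eta> t)"
    and R: "R > 0"
  shows "\<exists>L\<ge>0. \<forall>z\<in>space_X T. \<forall>y\<in>space_X T. norm_X T z \<le> R \<longrightarrow> norm_X T y \<le> R \<longrightarrow>
    cost \<theta> T z \<le> cost \<theta> T y + L * norm_X T (z - y)"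
proof -
  let ?J = "{0<..<T}" and ?M = "lebesgue_on {0<..<T}"
  have J: "?J \<in> sets lebesgue" by simp
  obtain C \<omega> \<eta> where C0: "C > 0" "integrable ?M \<omega> \<and> \<eta> \<in> L2 ?J \<and>
    (AE t in ?M. 0 \<le> \<omega> t \<and> 0 \<le> \<eta> t) \<and>
    (\<forall>x u. \<forall>t\<in>?J. norm x \<le> R \<longrightarrow>
      norm (grad_x x u t) \<le> C * (norm u)\<^sup>2 + \<omega> t \<and> norm (grad_u x u t) \<le> C * norm u + \<eta> t)"
    using growth[rule_format, OF R] by (elim exE conjE) (rule that, assumption, intro conjI)
  then have C: "C > 0" "integrable ?M \<omega>" "\<eta> \<in> L2 ?J"
    "\<And>x u t. t \<in> ?J \<Longrightarrow> norm x \<le> R \<Longrightarrow> norm (grad_x x u t) \<le> C * (norm u)\<^sup>2 + \<omega> t"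
    "\<And>x u t. t \<in> ?J \<Longrightarrow> norm x \<le> R \<Longrightarrow> norm (grad_u x u t) \<le> C * norm u + \<eta> t"
    by simp_all
  \<comment> \<open>The bracket bounds \<open>norm_L2\<close> of the control gradient, the terms
    before it the integral of the state gradient; the absolute value makes \<open>L \<ge> 0\<close>
    immediate.\<close>
  define L where "L = \<bar>C * R\<^sup>2 + integral\<^sup>L ?M \<omega> + (2 * C * R + norm_L2 ?J \<eta>)\<bar>"
  have "cost \<theta> T z \<le> cost \<theta> T y + L * norm_X T (z - y)"
    if z: "z \<in> space_X T" "norm_X T z \<le> R" and y: "y \<in> space_X T" "norm_X T y \<le> R" for z y
  proof -
    define n where "n = norm_X T (z - y)"
    have zy: "z - y \<in> space_X T" by (rule subspace_diff[OF subspace_space_X z(1) y(1)])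
    have n: "0 \<le> n" unfolding n_def by (rule norm_X_nonneg[OF T zy])
    define u v where "u = snd z" and "v = snd y"
    have uv: "u \<in> L2 ?J" "v \<in> L2 ?J" using z(1) y(1) by (auto simp: u_def v_def space_X_def)
    have uR: "norm_L2 ?J u \<le> R" "norm_L2 ?J v \<le> R"
      using order_trans[OF norm_L2_le_norm_X[OF T z(1)] z(2)] order_trans[OF norm_L2_le_norm_X[OF T y(1)] y(2)]
      by (simp_all add: u_def v_def)
    have uvn: "norm_L2 ?J (u - v) \<le> n"
      using norm_L2_le_norm_X[OF T zy] by (simp add: u_def v_def n_def)
    \<comment> \<open>Bounds the control gradient on the ball of radius
      \<open>norm (u t) + norm (v t)\<close>, which contains both control values and the segment
      between them.\<close>
    define g where "g = C *\<^sub>R (\<lambda>t. norm (u t)) + C *\<^sub>R (\<lambda>t. norm (v t)) + \<eta>"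
    have gL: "g \<in> L2 ?J" unfolding g_def by (intro L2_add[OF J] L2_scaleR[OF J] L2_norm uv C)
    have gN: "norm_L2 ?J g \<le> 2 * C * R + norm_L2 ?J \<eta>"
    proof -
      have "norm_L2 ?J g \<le> norm_L2 ?J (C *\<^sub>R (\<lambda>t. norm (u t)) + C *\<^sub>R (\<lambda>t. norm (v t))) + norm_L2 ?J \<eta>"
        unfolding g_def by (intro norm_L2_triangle[OF J] L2_add[OF J] L2_scaleR[OF J] L2_norm uv C)
      also have "norm_L2 ?J (C *\<^sub>R (\<lambda>t. norm (u t)) + C *\<^sub>R (\<lambda>t. norm (v t)))
          \<le> norm_L2 ?J (C *\<^sub>R (\<lambda>t. norm (u t))) + norm_L2 ?J (C *\<^sub>R (\<lambda>t. norm (v t)))"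
        by (intro norm_L2_triangle[OF J] L2_scaleR[OF J] L2_norm uv)
      also have "\<dots> = C * norm_L2 ?J u + C * norm_L2 ?J v"
        using C(1) by (simp only: norm_L2_scaleR L2_norm(2)[OF uv(1)] L2_norm(2)[OF uv(2)] abs_of_pos)
      also have "\<dots> \<le> C * R + C * R" using C(1) uR by (intro add_mono mult_left_mono) auto
      finally show ?thesis by (simp add: algebra_simps)
    qed
    have gm: "g \<in> borel_measurable ?M" using gL by (intro strongly_measurable_real[OF J]) (simp add: L2_def)
    have g2: "integrable ?M (\<lambda>t. (g t)\<^sup>2)" using gL by (simp add: L2_def)
    have duvL: "u - v \<in> L2 ?J" by (rule L2_diff[OF J uv])
    have d2: "integrable ?M (\<lambda>t. (norm ((u - v) t))\<^sup>2)" using duvL by (simp add: L2_def)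
    note cs = Cauchy_Schwarz_integral[OF gm L2_measurable_norm[OF J duvL] g2 d2]
    have pt: "\<theta> (fst z t) (u t) t \<le> \<theta> (fst y t) (v t) t + ((C * (norm (u t))\<^sup>2 + \<omega> t) * n + g t * norm ((u - v) t))"
      if t: "t \<in> ?J" for t
    proof -
      have t': "t \<in> {0..T}" using t by auto
      have xz: "norm (fst z t) \<le> R" "norm (fst y t) \<le> R"
        using norm_X_upper[OF z(1) t'] norm_X_upper[OF y(1) t'] z(2) y(2) by auto
      have "\<bar>\<theta> (fst z t) (u t) t - \<theta> (fst y t) (u t) t\<bar> \<le> (C * (norm (u t))\<^sup>2 + \<omega> t) * norm (fst z t - fst y t)"
        by (rule GDERIV_bound[of "cball 0 R" _ "\<lambda>x. grad_x x (u t) t"])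
          (use xz t t' C(4) grad_x in auto)
      moreover have "(C * (norm (u t))\<^sup>2 + \<omega> t) * norm (fst z t - fst y t) \<le> (C * (norm (u t))\<^sup>2 + \<omega> t) * n"
      proof (rule mult_left_mono)
        show "norm (fst z t - fst y t) \<le> n" using norm_X_upper[OF zy t'] by (simp add: n_def)
        show "0 \<le> C * (norm (u t))\<^sup>2 + \<omega> t" using C(4)[OF t xz(1), of "u t"] norm_ge_zero order_trans by blast
      qed
      moreover have "\<bar>\<theta> (fst y t) (u t) t - \<theta> (fst y t) (v t) t\<bar> \<le> g t * norm (u t - v t)"
      proof (rule GDERIV_bound[of "cball 0 (norm (u t) + norm (v t))" _ "\<lambda>w. grad_u (fst y t) w t"])
        fix w :: 'u assume "w \<in> cball 0 (norm (u t) + norm (v t))"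
        then have "C * norm w \<le> C * (norm (u t) + norm (v t))" using C(1) by (intro mult_left_mono) auto
        then show "norm (grad_u (fst y t) w t) \<le> g t"
          using C(5)[OF t xz(2), of w] by (simp add: g_def distrib_left)
      qed (use t' grad_u in auto)
      ultimately show ?thesis by simp
    qed
    have i1: "integrable ?M (\<lambda>t. C * (norm (u t))\<^sup>2 + \<omega> t)" using uv C(2) by (simp add: L2_def)
    have iz: "integrable ?M (\<lambda>t. \<theta> (fst z t) (u t) t)" "integrable ?M (\<lambda>t. \<theta> (fst y t) (v t) t)"
      using int z(1) y(1) by (simp_all add: u_def v_def)
    have ir: "integrable ?M (\<lambda>t. (C * (norm (u t))\<^sup>2 + \<omega> t) * n + g t * norm ((u - v) t))"
      by (rule Bochner_Integration.integrable_add[OF integrable_mult_left[OF i1] cs(1)])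
    have "cost \<theta> T z = (\<integral>t. \<theta> (fst z t) (u t) t \<partial>?M)" by (simp add: cost_def u_def)
    also have "\<dots> \<le> (\<integral>t. \<theta> (fst y t) (v t) t + ((C * (norm (u t))\<^sup>2 + \<omega> t) * n + g t * norm ((u - v) t)) \<partial>?M)"
      by (rule integral_mono[OF iz(1) Bochner_Integration.integrable_add[OF iz(2) ir]]) (use pt in simp)
    also have "\<dots> = (\<integral>t. \<theta> (fst y t) (v t) t \<partial>?M) + (\<integral>t. (C * (norm (u t))\<^sup>2 + \<omega> t) * n + g t * norm ((u - v) t) \<partial>?M)"
      by (rule Bochner_Integration.integral_add[OF iz(2) ir])
    also have "(\<integral>t. (C * (norm (u t))\<^sup>2 + \<omega> t) * n + g t * norm ((u - v) t) \<partial>?M)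
        = (\<integral>t. (C * (norm (u t))\<^sup>2 + \<omega> t) * n \<partial>?M) + (\<integral>t. g t * norm ((u - v) t) \<partial>?M)"
      by (rule Bochner_Integration.integral_add[OF integrable_mult_left[OF i1] cs(1)])
    also have "(\<integral>t. (C * (norm (u t))\<^sup>2 + \<omega> t) * n \<partial>?M) = (C * (norm_L2 ?J u)\<^sup>2 + integral\<^sup>L ?M \<omega>) * n"
      using uv C(2) i1 by (simp add: norm_L2_power2 L2_def)
    also have "(\<integral>t. \<theta> (fst y t) (v t) t \<partial>?M) = cost \<theta> T y" by (simp add: cost_def v_def)
    finally have 1: "cost \<theta> T z \<le> cost \<theta> T y +
        ((C * (norm_L2 ?J u)\<^sup>2 + integral\<^sup>L ?M \<omega>) * n + (\<integral>t. g t * norm ((u - v) t) \<partial>?M))" .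
    have "C * (norm_L2 ?J u)\<^sup>2 + integral\<^sup>L ?M \<omega> \<le> C * R\<^sup>2 + integral\<^sup>L ?M \<omega>"
      using C(1) uR(1) by (intro add_right_mono mult_left_mono power_mono) auto
    then have 2: "(C * (norm_L2 ?J u)\<^sup>2 + integral\<^sup>L ?M \<omega>) * n \<le> (C * R\<^sup>2 + integral\<^sup>L ?M \<omega>) * n"
      using n by (rule mult_right_mono)
    have "(\<integral>t. g t * norm ((u - v) t) \<partial>?M) \<le> norm_L2 ?J g * norm_L2 ?J (u - v)"
      using cs(2) unfolding norm_L2_def real_norm_def power2_abs by linarith
    also have "\<dots> \<le> (2 * C * R + norm_L2 ?J \<eta>) * n"
      using gN uvn C(1) R by (intro mult_mono) auto
    finally have 3: "(\<integral>t. g t * norm ((u - v) t) \<partial>?M) \<le> (2 * C * R + norm_L2 ?J \<eta>) * n" .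
    have "(C * R\<^sup>2 + integral\<^sup>L ?M \<omega>) * n + (2 * C * R + norm_L2 ?J \<eta>) * n \<le> L * n"
      unfolding L_def distrib_right[symmetric] using n by (intro mult_right_mono) auto
    then show ?thesis using 1 2 3 unfolding n_def by linarith
  qed
  moreover have "L \<ge> 0" by (simp add: L_def)
  ultimately show ?thesis by blast
qed

section \<open>The set of trajectories\<close>

text \<open>Restriction to \<open>{0<..<t}\<close> does not increase the norm of a control, so the
  uniform constant may be stated with the norm on the full interval; linearity gives the difference
  form.\<close>

lemma input_map_diff_bound:
  assumes sys: "control_system S \<beta> j B" and T: "0 \<le> T"
  obtains K where "K \<ge> 0"
    "\<And>t u v. t \<in> {0..T} \<Longrightarrow> u \<in> L2 {0<..<T} \<Longrightarrow> v \<in> L2 {0<..<T} \<Longrightarrow>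
      norm (input_map j S B t u - input_map j S B t v) \<le> K * norm_L2 {0<..<T} (u - v)"
    "\<And>t u. t \<in> {0..T} \<Longrightarrow> u \<in> L2 {0<..<T} \<Longrightarrow>
      norm (input_map j S B t u) \<le> K * norm_L2 {0<..<T} u"
proof -
  interpret control_system S \<beta> j B by (rule sys)
  obtain K where K: "K \<ge> 0" "\<And>t u. t \<in> {0..T} \<Longrightarrow> u \<in> L2 {0<..<t} \<Longrightarrow>
      norm (input_map j S B t u) \<le> K * norm_L2 {0<..<t} u"
    using input_map_bounded[OF T] by blast
  have restrict: "u \<in> L2 {0<..<t}" "norm_L2 {0<..<t} u \<le> norm_L2 {0<..<T} u"
    if "t \<in> {0..T}" "u \<in> L2 {0<..<T}" for t and u :: "real \<Rightarrow> 'c"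
  proof -
    have "{0<..<t} \<subseteq> {0<..<T}" using that(1) by auto
    then show "u \<in> L2 {0<..<t}" "norm_L2 {0<..<t} u \<le> norm_L2 {0<..<T} u"
      using L2_restrict[OF _ _ _ that(2), of "{0<..<t}"] by simp_all
  qed
  have bound: "norm (input_map j S B t u) \<le> K * norm_L2 {0<..<T} u" if "t \<in> {0..T}" "u \<in> L2 {0<..<T}" for t u
    using K(2)[OF that(1) restrict(1)[OF that]] mult_left_mono[OF restrict(2)[OF that] K(1)] by linarith
  have "norm (input_map j S B t u - input_map j S B t v) \<le> K * norm_L2 {0<..<T} (u - v)"
    if t: "t \<in> {0..T}" and uv: "u \<in> L2 {0<..<T}" "v \<in> L2 {0<..<T}" for t u v
  proof -
    have "input_map j S B t (1 *\<^sub>R u + (-1) *\<^sub>R v) = 1 *\<^sub>R input_map j S B t u + (-1) *\<^sub>R input_map j S B t v"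
      by (rule input_map_linear) (use t restrict(1)[OF t] uv in auto)
    then have "input_map j S B t (u - v) = input_map j S B t u - input_map j S B t v" by simp
    then show ?thesis using bound[OF t L2_diff[OF _ uv]] by simp
  qed
  with K(1) bound show thesis using that by blast
qed

lemma trajectory_set_convex:
  assumes sys: "control_system S \<beta> j B" and T: "0 \<le> T"
    and U: "U \<subseteq> L2 {0<..<T}" "convex_L2 U"
  shows "convex (trajectory_set j S B x0 T U)"
  unfolding convex_alt
proof (intro ballI allI impI)
  interpret control_system S \<beta> j B by (rule sys)
  fix z y a assume zy: "z \<in> trajectory_set j S B x0 T U" "y \<in> trajectory_set j S B x0 T U"
    and a: "0 \<le> a \<and> a \<le> (1::real)"
  obtain x u where z: "z = (x, u)" "z \<in> space_X T" "u \<in> U" "\<And>t. t \<in> {0..T} \<Longrightarrow> x t = S t x0 + input_map j S B t u"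
    using zy(1) by (auto simp: trajectory_set_def)
  obtain x' u' where y: "y = (x', u')" "y \<in> space_X T" "u' \<in> U" "\<And>t. t \<in> {0..T} \<Longrightarrow> x' t = S t x0 + input_map j S B t u'"
    using zy(2) by (auto simp: trajectory_set_def)
  have "(\<lambda>t. (1 - a) *\<^sub>R u t + a *\<^sub>R u' t) \<in> U"
    using U(2) z(3) y(3) a unfolding convex_L2_def by auto
  then have "(1 - a) *\<^sub>R u + a *\<^sub>R u' \<in> U" by (simp add: plus_fun_def scaleR_fun_def)
  moreover have "(1 - a) *\<^sub>R z + a *\<^sub>R y \<in> space_X T"
    by (intro subspace_add subspace_scale subspace_space_X z y)
  moreover have "((1 - a) *\<^sub>R x + a *\<^sub>R x') t = S t x0 + input_map j S B t ((1 - a) *\<^sub>R u + a *\<^sub>R u')"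
    if t: "t \<in> {0..T}" for t
  proof -
    have "{0<..<t} \<subseteq> {0<..<T}" using t by auto
    then have "u \<in> L2 {0<..<t}" "u' \<in> L2 {0<..<t}"
      using z(3) y(3) U(1) L2_restrict(1)[of "{0<..<t}" "{0<..<T}"] by auto
    then have "input_map j S B t ((1 - a) *\<^sub>R u + a *\<^sub>R u') = (1 - a) *\<^sub>R input_map j S B t u + a *\<^sub>R input_map j S B t u'"
      using t by (intro input_map_linear) auto
    moreover have "S t x0 = (1 - a) *\<^sub>R S t x0 + a *\<^sub>R S t x0" by (simp flip: scaleR_left_distrib)
    ultimately show ?thesis using z(4)[OF t] y(4)[OF t] by (simp add: algebra_simps)
  qed
  ultimately show "(1 - a) *\<^sub>R z + a *\<^sub>R y \<in> trajectory_set j S B x0 T U"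
    by (simp add: trajectory_set_def z(1) y(1))
qed

lemma trajectory_set_bounded:
  assumes sys: "control_system S \<beta> j B" and T: "0 \<le> T"
    and U: "bounded_L2 {0<..<T} U"
  obtains R where "R > 0" "\<And>z. z \<in> trajectory_set j S B x0 T U \<Longrightarrow> norm_X T z \<le> R"
proof -
  interpret control_system S \<beta> j B by (rule sys)
  obtain K where K: "K \<ge> 0" "\<And>t u. t \<in> {0..T} \<Longrightarrow> u \<in> L2 {0<..<T} \<Longrightarrow>
      norm (input_map j S B t u) \<le> K * norm_L2 {0<..<T} u"
    using input_map_diff_bound[OF sys T] by metis
  obtain M where M: "M \<ge> 1" "\<And>t x. 0 \<le> t \<Longrightarrow> t \<le> T \<Longrightarrow> norm (S t x) \<le> M * norm x"
    using C0_semigroup_bounded[OF semigroup] by metis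
  obtain b where b: "\<And>u. u \<in> U \<Longrightarrow> norm_L2 {0<..<T} u \<le> b" using U by (auto simp: bounded_L2_def)
  have "norm_X T z \<le> (M * norm x0 + K * b) + b" if z: "z \<in> trajectory_set j S B x0 T U" for z
  proof (rule norm_X_le[OF T])
    have u: "snd z \<in> U" "snd z \<in> L2 {0<..<T}" using z by (auto simp: trajectory_set_def space_X_def)
    show "norm_L2 {0<..<T} (snd z) \<le> b" by (rule b[OF u(1)])
    fix t assume t: "t \<in> {0..T}"
    have "fst z t = S t x0 + input_map j S B t (snd z)" using z t by (auto simp: trajectory_set_def)
    then have "norm (fst z t) \<le> norm (S t x0) + norm (input_map j S B t (snd z))" by (simp add: norm_triangle_ineq)
    then show "norm (fst z t) \<le> M * norm x0 + K * b"
      using M(2)[of t x0] K(2)[OF t u(2)] mult_left_mono[OF b[OF u(1)] K(1)] t by auto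
  qed
  then show thesis by (intro that[of "max 1 (M * norm x0 + K * b + b)"]) (auto intro: max.coboundedI2)
qed

text \<open>The controls converge in L2, with limit in \<open>U\<close> by closedness; the input
  maps are bounded uniformly in time, so the states converge uniformly. The limit state is defined
  by the solution formula, and its continuity is inherited from the uniform limit.\<close>

lemma trajectory_set_complete:
  fixes B :: "'u::complex_hilbert \<Rightarrow> 'e::complex_banach"
  assumes sys: "control_system S \<beta> j B" and T: "0 \<le> T"
    and U: "closed_L2 {0<..<T} U"
    and v: "\<And>k. v k \<in> trajectory_set j S B x0 T U"
    and le: "\<And>k. norm_X T (v (Suc k) - v k) \<le> c k" and c: "summable c"
  shows "\<exists>z\<in>trajectory_set j S B x0 T U. (\<lambda>k. norm_X T (v k - z)) \<longlonglongrightarrow> 0"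
proof -
  let ?J = "{0<..<T}"
  obtain K where K: "K \<ge> 0" "\<And>t u v. t \<in> {0..T} \<Longrightarrow> u \<in> L2 ?J \<Longrightarrow> v \<in> L2 ?J \<Longrightarrow>
      norm (input_map j S B t u - input_map j S B t v) \<le> K * norm_L2 ?J (u - v)"
    by (rule input_map_diff_bound[OF sys T]) (rule that)
  define u where "u = (\<lambda>k. snd (v k))"
  have X: "v k \<in> space_X T" and uU: "u k \<in> U" and x: "\<And>t. t \<in> {0..T} \<Longrightarrow> fst (v k) t = S t x0 + input_map j S B t (u k)" for k
    using v[of k] by (auto simp: trajectory_set_def u_def)
  have uL: "u k \<in> L2 ?J" for k using X[of k] by (auto simp: space_X_def u_def)
  have step: "norm_L2 ?J (u (Suc k) - u k) \<le> c k" for k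
    using norm_L2_le_norm_X[OF T subspace_diff[OF subspace_space_X X X], of "Suc k" k] le[of k]
    by (simp add: u_def)
  obtain w where w: "w \<in> L2 ?J" "(\<lambda>k. norm_L2 ?J (u k - w)) \<longlonglongrightarrow> 0"
    by (rule L2_complete[OF T uL step c]) (rule that)
  have wU: "w \<in> U" using U uU w unfolding closed_L2_def by blast
  define y where "y = (\<lambda>t. S t x0 + input_map j S B t w)"
  have close: "norm (fst (v k) t - y t) \<le> K * norm_L2 ?J (u k - w)" if "t \<in> {0..T}" for k t
    using K(2)[OF that uL w(1), of k] x[OF that, of k] by (simp add: y_def)
  have Klim: "(\<lambda>k. K * norm_L2 ?J (u k - w)) \<longlonglongrightarrow> 0" using tendsto_mult_right_zero[OF w(2)] .
  have "continuous_on {0..T} y"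
  proof (rule uniform_limit_theorem[where f = "\<lambda>k. fst (v k)" and F = sequentially])
    show "\<forall>\<^sub>F k in sequentially. continuous_on {0..T} (fst (v k))"
      using X by (intro always_eventually) (auto simp: space_X_def case_prod_unfold)
    show "uniform_limit {0..T} (\<lambda>k. fst (v k)) y sequentially"
    proof (rule uniform_limitI)
      fix e :: real assume "e > 0"
      then have "\<forall>\<^sub>F k in sequentially. K * norm_L2 ?J (u k - w) < e" by (rule order_tendstoD(2)[OF Klim])
      then show "\<forall>\<^sub>F k in sequentially. \<forall>t\<in>{0..T}. dist (fst (v k) t) (y t) < e"
      proof eventually_elim
        case (elim k)
        show ?case
        proof
          fix t assume "t \<in> {0..T}"
          from order_le_less_trans[OF close[OF this] elim] show "dist (fst (v k) t) (y t) < e"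
            by (simp only: dist_norm)
        qed
      qed
    qed
  qed simp
  then have z: "(y, w) \<in> trajectory_set j S B x0 T U"
    using w(1) wU by (simp add: trajectory_set_def space_X_def y_def)
  have le2: "norm_X T (v k - (y, w)) \<le> K * norm_L2 ?J (u k - w) + norm_L2 ?J (u k - w)" for k
    by (rule norm_X_le[OF T]) (use close in \<open>auto simp: u_def\<close>)
  have lim0: "(\<lambda>k. K * norm_L2 ?J (u k - w) + norm_L2 ?J (u k - w)) \<longlonglongrightarrow> 0"
    using tendsto_add[OF Klim w(2)] by simp
  have le3: "norm (norm_X T (v k - (y, w))) \<le> K * norm_L2 ?J (u k - w) + norm_L2 ?J (u k - w)" for k
  proof -
    have "(y, w) \<in> space_X T" using z by (auto simp: trajectory_set_def)
    then have "0 \<le> norm_X T (v k - (y, w))" by (intro norm_X_nonneg[OF T] subspace_diff[OF subspace_space_X X])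
    then show ?thesis using le2[of k] by simp
  qed
  have "(\<lambda>k. norm_X T (v k - (y, w))) \<longlonglongrightarrow> 0"
    by (rule Lim_null_comparison[OF always_eventually lim0]) (rule allI, rule le3)
  with z show ?thesis by blast
qed

lemma reachable_set_eq_image:
  "reachable_set j S B x0 T U = (\<lambda>z. fst z T) ` trajectory_set j S B x0 T U"
  by (force simp: reachable_set_def image_iff)

lemma exact_bounded_controls:
  fixes f :: "(real \<Rightarrow> 'h::real_normed_vector) \<times> (real \<Rightarrow> 'u::real_normed_vector) \<Rightarrow> real"
  assumes T: "0 \<le> T" and A: "A \<subseteq> space_X T" "convex A"
    and R: "R > 0" "\<And>z. z \<in> A \<Longrightarrow> norm_X T z \<le> R"
    and L: "0 \<le> L" "\<And>y z. y \<in> A \<Longrightarrow> z \<in> A \<Longrightarrow> f y \<le> f z + L * norm_X T (y - z)"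
    and xT: "xT \<in> relint ((\<lambda>z. fst z T) ` A)"
  shows "completely_exact T f (terminal_gap T xT) A"
proof -
  let ?P = "\<lambda>z :: (real \<Rightarrow> 'h) \<times> (real \<Rightarrow> 'u). fst z T"
  have xA: "xT \<in> ?P ` A" using subsetD[OF interior_of_subset xT[unfolded relint_def]] .
  obtain r0 where r0: "r0 > 0"
    "\<And>y. y \<in> closure (affine hull (?P ` A)) \<Longrightarrow> norm (y - xT) < r0 \<Longrightarrow> y \<in> ?P ` A"
    using openin_affine_ball[OF xT[unfolded relint_def]] by metis
  \<comment> \<open>Half the radius turns the open ball into the closed one that
    \<open>feasible_on_segment\<close> asks for.\<close>
  define r where "r = r0 / 2"
  have r: "r > 0" using r0(1) by (simp add: r_def)
  have ball: "\<exists>w\<in>A. fst w T = y" if "y \<in> closure (affine hull (?P ` A))" "norm (y - xT) \<le> r" for y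
  proof -
    have "y \<in> ?P ` A" using that r0 by (intro r0(2)) (auto simp: r_def)
    then show ?thesis by auto
  qed
  \<comment> \<open>Two points of \<open>A\<close> are at most \<open>2 * R\<close> apart, and the
    fraction travelled satisfies \<open>s \<le> g / r\<close>.\<close>
  define D where "D = 2 * R / r"
  have D: "D > 0" using R(1) r by (simp add: D_def)
  show ?thesis
  proof (rule completely_exact_Lipschitz[OF T A L D])
    fix z assume z: "z \<in> A"
    define g where "g = terminal_gap T xT z"
    define s where "s = g / (r + g)"
    have g: "0 \<le> g" by (simp add: g_def)
    then have rg: "r + g > 0" using r by linarith
    have s: "0 \<le> s" using g rg by (simp add: s_def)
    obtain w where w: "w \<in> A" "(1 - s) *\<^sub>R z + s *\<^sub>R w \<in> feasible_set (terminal_gap T xT) A"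
      by (rule feasible_on_segment[OF A(2) r xA subset_refl ball z]) (auto simp: s_def g_def)
    have zX: "z \<in> space_X T" "w \<in> space_X T" using z w A by auto
    have "norm_X T (w - z) \<le> norm_X T (w - 0) + norm_X T (0 - z)"
      by (rule norm_X_triangle_diff[OF T zX(2) subspace_0[OF subspace_space_X] zX(1)])
    also have "norm_X T (0 - z) = norm_X T (z - 0)"
      by (rule norm_X_minus_commute[OF T subspace_0[OF subspace_space_X] zX(1)])
    finally have "norm_X T (w - z) \<le> 2 * R" using R(2)[OF z] R(2)[OF w(1)] by simp
    then have "s * norm_X T (w - z) \<le> s * (2 * R)" using s by (rule mult_left_mono)
    also have "\<dots> \<le> (g / r) * (2 * R)"
      unfolding s_def using g r R(1) by (intro mult_right_mono divide_left_mono) auto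
    also have "\<dots> = D * g" by (simp add: D_def)
    finally have "norm_X T ((1 - s) *\<^sub>R z + s *\<^sub>R w - z) \<le> D * g"
      by (simp only: norm_X_segment[OF T zX s])
    with w(2) show "\<exists>y\<in>feasible_set (terminal_gap T xT) A. norm_X T (y - z) \<le> D * terminal_gap T xT z"
      unfolding g_def by blast
  qed
qed

text \<open>Preimages of bounded norm give one bound \<open>K\<close> for the cost at every opposite
  point \<open>w\<close>, even where \<open>A\<close> is unbounded; convexity along the segment then
  bounds the optimal value by the cost at \<open>z\<close> plus a multiple of the gap.\<close>

lemma exact_convex_cost:
  fixes f :: "(real \<Rightarrow> 'h::banach) \<times> (real \<Rightarrow> 'u::real_normed_vector) \<Rightarrow> real"
  assumes T: "0 \<le> T" and A: "A \<subseteq> space_X T"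
    and complete: "\<And>v c. (\<And>k. v k \<in> A) \<Longrightarrow> (\<And>k. norm_X T (v (Suc k) - v k) \<le> c k) \<Longrightarrow> summable c \<Longrightarrow>
      \<exists>z\<in>A. (\<lambda>k. norm_X T (v k - z)) \<longlonglongrightarrow> 0"
    and f: "convex_on A f"
    and bounded: "\<And>R. R > 0 \<Longrightarrow> \<exists>K. \<forall>z\<in>A. norm_X T z \<le> R \<longrightarrow> f z \<le> K"
    and null: "\<And>y z. y \<in> A \<Longrightarrow> z \<in> A \<Longrightarrow> norm_X T (y - z) = 0 \<Longrightarrow> f y = f z"
    and opt: "global_opt f (feasible_set (terminal_gap T xT) A) z0"
    and xT: "xT \<in> relint ((\<lambda>z. fst z T) ` A)"
  shows "completely_exact T f (terminal_gap T xT) A"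
proof -
  let ?P = "\<lambda>z :: (real \<Rightarrow> 'h) \<times> (real \<Rightarrow> 'u). fst z T"
  have conv: "convex A" using f by (rule convex_on_imp_convex)
  have xA: "xT \<in> ?P ` A" using subsetD[OF interior_of_subset xT[unfolded relint_def]] .
  have lin: "linear ?P" by (rule linearI) simp_all
  obtain r m where r: "r > 0"
    "\<And>y. y \<in> closure (affine hull (?P ` A)) \<Longrightarrow> norm (y - xT) \<le> r \<Longrightarrow> \<exists>z\<in>A. norm_X T z \<le> m \<and> fst z T = y"
  proof (rule bounded_preimages_near_relint[OF subspace_space_X A conv _ _ _ lin _ xT])
    show "\<exists>z\<in>A. (\<lambda>k. norm_X T (v k - z)) \<longlonglongrightarrow> 0"
      if "\<And>k. v k \<in> A" "\<And>k. norm_X T (v (Suc k) - v k) \<le> c k" "summable c" for v c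
      by (rule complete[OF that])
    show "norm (fst z T) \<le> norm_X T z" if "z \<in> space_X T" for z :: "(real \<Rightarrow> 'h) \<times> (real \<Rightarrow> 'u)"
      using norm_X_upper[OF that] T by simp
  qed (rule norm_X_triangle[OF T] norm_X_scaleR[OF T] that; assumption)+
  have ball: "\<exists>w\<in>{w \<in> A. norm_X T w \<le> m}. fst w T = y"
    if "y \<in> closure (affine hull (?P ` A))" "norm (y - xT) \<le> r" for y
    using r(2)[OF that] by blast
  \<comment> \<open>\<open>bounded\<close> asks for a positive radius, hence the maximum with
    1.\<close>
  obtain K where K: "\<And>z. z \<in> A \<Longrightarrow> norm_X T z \<le> max 1 m \<Longrightarrow> f z \<le> K"
    using bounded[of "max 1 m"] by (metis less_max_iff_disj zero_less_one)
  define c0 where "c0 = max 0 ((K - f z0) / r)"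
  show ?thesis
  proof (rule completely_exact_convex[OF T A f null opt, of c0])
    show "0 \<le> c0" by (simp add: c0_def)
    fix z assume z: "z \<in> A"
    define g where "g = terminal_gap T xT z"
    define s where "s = g / (r + g)"
    have g: "0 \<le> g" by (simp add: g_def)
    then have rg: "r + g > 0" using r by linarith
    have s: "0 \<le> s" "s \<le> 1" using g rg r(1) by (auto simp: s_def)
    obtain w where w: "w \<in> {w \<in> A. norm_X T w \<le> m}" "(1 - s) *\<^sub>R z + s *\<^sub>R w \<in> feasible_set (terminal_gap T xT) A"
      by (rule feasible_on_segment[OF conv r(1) xA _ ball z]) (auto simp: s_def g_def)
    have "f z0 \<le> f ((1 - s) *\<^sub>R z + s *\<^sub>R w)" using opt w(2) by (simp add: global_opt_def)
    also have "\<dots> \<le> (1 - s) * f z + s * f w" using convex_onD[OF f, of s z w] s z w(1) by simp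
    also have "s * f w \<le> s * K" using K[of w] w(1) s(1) by (intro mult_left_mono) auto
    \<comment> \<open>Multiplication by \<open>r + g\<close> clears the denominator of
      \<open>s\<close>; what remains is linear in the gap.\<close>
    finally have "(r + g) * f z0 \<le> (r + g) * ((1 - s) * f z + s * K)" using rg by (simp add: mult_left_mono)
    also have "\<dots> = ((r + g) * (1 - s)) * f z + ((r + g) * s) * K" by (simp add: algebra_simps)
    also have "(r + g) * (1 - s) = r" using rg by (simp add: s_def right_diff_distrib)
    also have "(r + g) * s = g" using rg by (simp add: s_def)
    finally have "r * f z0 \<le> r * f z + g * (K - f z0)" by (simp add: algebra_simps)
    then have "f z0 \<le> f z + g * ((K - f z0) / r)" using r(1) by (simp add: field_simps)
    also have "g * ((K - f z0) / r) \<le> g * c0" using g by (intro mult_left_mono) (auto simp: c0_def)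
    finally show "f z0 \<le> f z + c0 * terminal_gap T xT z" by (simp add: g_def mult.commute)
  qed
qed

theorem theorem9:
  fixes S :: "real \<Rightarrow> 'h::complex_hilbert \<Rightarrow> 'h"
    and \<beta> :: complex
    and j :: "'h \<Rightarrow> 'e::complex_banach"
    and B :: "'u::complex_hilbert \<Rightarrow> 'e"
    and T :: real
    and x0 xT :: 'h
    and U :: "(real \<Rightarrow> 'u) set"
    and \<theta> :: "'h \<Rightarrow> 'u \<Rightarrow> real \<Rightarrow> real"
    and grad_x :: "'h \<Rightarrow> 'u \<Rightarrow> real \<Rightarrow> 'h"
    and grad_u :: "'h \<Rightarrow> 'u \<Rightarrow> real \<Rightarrow> 'u"
  assumes semigroup: "C0_semigroup S"
    and extrapolation: "extrapolation_space S \<beta> j"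
    and admissible: "admissible_control j S B"
    and horizon: "T > 0"
    and U_closed: "closed_L2 {0<..<T} U"
    and U_convex: "convex_L2 U"
    and theta_continuous:
      "continuous_on (UNIV \<times> UNIV \<times> {0..T}) (\<lambda>(x, u, t). \<theta> x u t)"
    and theta_growth:
      "\<forall>R>0. \<exists>C>0. \<exists>\<omega>. integrable (lebesgue_on {0<..<T}) \<omega> \<and>
         (AE t in lebesgue_on {0<..<T}. 0 \<le> \<omega> t) \<and>
         (\<forall>x u. \<forall>t\<in>{0<..<T}. norm x \<le> R \<longrightarrow> \<bar>\<theta> x u t\<bar> \<le> C * (norm u)\<^sup>2 + \<omega> t)"
    and bounded_or_coercive:
      "bounded_L2 {0<..<T} U \<or>
       (\<exists>C1>0. \<exists>\<omega>. integrable (lebesgue_on {0<..<T}) \<omega> \<and>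
          (\<forall>x u. \<forall>t\<in>{0..T}. \<theta> x u t \<ge> C1 * (norm u)\<^sup>2 + \<omega> t))"
    and theta_grad_x:
      "\<forall>x u. \<forall>t\<in>{0..T}. GDERIV (\<lambda>y. \<theta> y u t) x :> grad_x x u t"
    and theta_grad_u:
      "\<forall>x u. \<forall>t\<in>{0..T}. GDERIV (\<lambda>v. \<theta> x v t) u :> grad_u x u t"
    and grad_x_continuous:
      "continuous_on (UNIV \<times> UNIV \<times> {0..T}) (\<lambda>(x, u, t). grad_x x u t)"
    and grad_u_continuous:
      "continuous_on (UNIV \<times> UNIV \<times> {0..T}) (\<lambda>(x, u, t). grad_u x u t)"
    and grad_growth:
      "\<forall>R>0. \<exists>C>0. \<exists>\<omega> \<eta>. integrable (lebesgue_on {0<..<T}) \<omega> \<and> \<eta> \<in> L2 {0<..<T} \<and>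
         (AE t in lebesgue_on {0<..<T}. 0 \<le> \<omega> t \<and> 0 \<le> \<eta> t) \<and>
         (\<forall>x u. \<forall>t\<in>{0<..<T}. norm x \<le> R \<longrightarrow>
            norm (grad_x x u t) \<le> C * (norm u)\<^sup>2 + \<omega> t \<and>
            norm (grad_u x u t) \<le> C * norm u + \<eta> t)"
    and solution_exists:
      "\<exists>z. global_opt (cost \<theta> T)
             (feasible_set (terminal_gap T xT) (trajectory_set j S B x0 T U)) z"
    and relint_nonempty: "relint (reachable_set j S B x0 T U) \<noteq> {}"
    and xT_in_relint: "xT \<in> relint (reachable_set j S B x0 T U)"
    and bounded_or_convex:
      "bounded_L2 {0<..<T} U \<or> (\<forall>t\<in>{0..T}. convex_on UNIV (\<lambda>(x, u). \<theta> x u t))"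
  shows "completely_exact T (cost \<theta> T) (terminal_gap T xT) (trajectory_set j S B x0 T U)"
proof -
  let ?A = "trajectory_set j S B x0 T U"
  have T: "0 \<le> T" using horizon by simp
  have sys: "control_system S \<beta> j B"
    using semigroup extrapolation admissible by (rule control_system.intro)
  have U: "U \<subseteq> L2 {0<..<T}" using U_closed by (simp add: closed_L2_def)
  have A: "?A \<subseteq> space_X T" by (auto simp: trajectory_set_def)
  have conv: "convex ?A" by (rule trajectory_set_convex[OF sys T U U_convex])
  have xT: "xT \<in> relint ((\<lambda>z. fst z T) ` ?A)"
    using xT_in_relint by (simp only: reachable_set_eq_image)
  note int = cost_integrable[OF T theta_continuous theta_growth]
  have Lip: "\<exists>L\<ge>0. \<forall>z\<in>space_X T. \<forall>y\<in>space_X T. norm_X T z \<le> R \<longrightarrow> norm_X T y \<le> R \<longrightarrow>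
    cost \<theta> T z \<le> cost \<theta> T y + L * norm_X T (z - y)" if "R > 0" for R
    by (rule cost_Lipschitz[OF T int theta_grad_x theta_grad_u grad_growth that])
  show ?thesis
    using bounded_or_convex
  proof
    assume bdd: "bounded_L2 {0<..<T} U"
    obtain R where R: "R > 0" "\<And>z. z \<in> ?A \<Longrightarrow> norm_X T z \<le> R"
      by (rule trajectory_set_bounded[OF sys T bdd]) (rule that)
    obtain L where L: "L \<ge> 0" "\<And>z y. z \<in> space_X T \<Longrightarrow> y \<in> space_X T \<Longrightarrow> norm_X T z \<le> R \<Longrightarrow>
        norm_X T y \<le> R \<Longrightarrow> cost \<theta> T z \<le> cost \<theta> T y + L * norm_X T (z - y)"
      using Lip[OF R(1)] by blast
    show ?thesis
    proof (rule exact_bounded_controls[OF T A conv R L(1) _ xT])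
      fix y z assume yz: "y \<in> ?A" "z \<in> ?A"
      show "cost \<theta> T y \<le> cost \<theta> T z + L * norm_X T (y - z)"
        by (rule L(2)[OF subsetD[OF A yz(1)] subsetD[OF A yz(2)] R(2)[OF yz(1)] R(2)[OF yz(2)]])
    qed
  next
    assume convex: "\<forall>t\<in>{0..T}. convex_on UNIV (\<lambda>(x, u). \<theta> x u t)"
    obtain z0 where z0: "global_opt (cost \<theta> T) (feasible_set (terminal_gap T xT) ?A) z0"
      using solution_exists by blast
    have bounded: "\<exists>K. \<forall>z\<in>?A. norm_X T z \<le> R \<longrightarrow> cost \<theta> T z \<le> K" if "R > 0" for R
    proof -
      obtain K where "\<forall>z\<in>space_X T. norm_X T z \<le> R \<longrightarrow>
          integrable (lebesgue_on {0<..<T}) (\<lambda>t. \<theta> (fst z t) (snd z t) t) \<and> \<bar>cost \<theta> T z\<bar> \<le> K"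
        using cost_bounded[OF T theta_continuous theta_growth \<open>R > 0\<close>] by blast
      then show ?thesis using A by (intro exI[of _ K]) (meson abs_le_D1 subsetD)
    qed
    \<comment> \<open>Representatives of the same element of X have equal cost: on a ball containing
      both, the Lipschitz estimate leaves no difference.\<close>
    have le: "cost \<theta> T y \<le> cost \<theta> T z" if y: "y \<in> ?A" and z: "z \<in> ?A" and null: "norm_X T (y - z) = 0" for y z
    proof -
      have yz: "y \<in> space_X T" "z \<in> space_X T" using y z A by blast+
      have R: "norm_X T y + norm_X T z + 1 > 0" "norm_X T y \<le> norm_X T y + norm_X T z + 1"
        "norm_X T z \<le> norm_X T y + norm_X T z + 1"
        using norm_X_nonneg[OF T yz(1)] norm_X_nonneg[OF T yz(2)] by linarith+
      obtain L where "cost \<theta> T y \<le> cost \<theta> T z + L * norm_X T (y - z)"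
        using Lip[OF R(1)] yz R(2,3) by blast
      then show ?thesis using null by simp
    qed
    show ?thesis
    proof (rule exact_convex_cost[OF T A _ cost_convex_on[OF conv A int convex] bounded _ z0 xT])
      show "\<exists>z\<in>?A. (\<lambda>k. norm_X T (v k - z)) \<longlonglongrightarrow> 0"
        if "\<And>k. v k \<in> ?A" "\<And>k. norm_X T (v (Suc k) - v k) \<le> c k" "summable c" for v c
        by (rule trajectory_set_complete[OF sys T U_closed that])
      show "cost \<theta> T y = cost \<theta> T z" if "y \<in> ?A" "z \<in> ?A" "norm_X T (y - z) = 0" for y z
      proof (rule antisym[OF le[OF that] le[OF that(2,1)]])
        show "norm_X T (z - y) = 0"
          using norm_X_minus_commute[OF T subsetD[OF A that(1)] subsetD[OF A that(2)]] that(3) by simp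
      qed
    qed
  qed
qed

end
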